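(* Let $\omega=B(0,1)$ be the unit disk in $\mathbb R^2$. Assume that $\hat\nu$ satisfies (N1) and (N2) of the context, that $\mathcal J$ satisfies (J), that the unperturbed direct state $u_0^{(2)}$ is of class $C^{1,\beta}$ on $\Omega^d$ for some $\beta>0$, and that the unperturbed adjoint state $p_0^{(2)}$ is of class $C^{1,\tilde\beta}$ on $\Omega^d$ for some $\tilde\beta>0$. Then the topological derivative at $x_0\in\Omega^d$ for introducing ferromagnetic material inside air is $$G^{air\to f}(x_0)=(U_0^{(2)})^\top\mathcal M^{(2)}P_0^{(2)}+\int_\omega S_{U_0^{(2)}}(\nabla H^{(2)})\cdot(P_0^{(2)}+\nabla K^{(2)})\,dx+\delta_J,$$ i.e. $\mathcal J(u_\varepsilon^{(2)})-\mathcal J(u_0^{(2)})=\varepsilon^2\,G^{air\to f}(x_0)+o(\varepsilon^2)$ as $\varepsilon\to0^+$.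
   Context: **Material law.** $\nu_0>0$ is a constant and $\hat\nu:[0,\infty)\to[0,\infty)$. (N1) $\hat\nu$ is $C^1$ and there is $\underline\nu>0$ with $\underline\nu\le\hat\nu(s)\le\nu_0$ and $\underline\nu\le(\hat\nu(s)s)'\le\nu_0$ for all $s\ge0$. (N2) $\hat\nu\in C^3([0,\infty))$; there is $\tilde c>0$ with $|\hat\nu'(s)|/s\le\tilde c$ for all $s\ge0$ (at $s=0$ in the sense of limits); and there are nonnegative constants $\tilde c_4,\tilde c_5,\tilde c',\tilde c''$ with $|(\hat\nu(s)s)''|\le\tilde c_4$, $|(\hat\nu(s)s)'''|\le\tilde c_5$, $|\hat\nu'(s)|\le\tilde c'$, $|\hat\nu''(s)|\le\tilde c''$ for all $s\ge0$. **Operators.** For $V,W\in\mathbb R^2$: $T(W)=\hat\nu(|W|)W$, with Jacobian $\mathrm DT(W)=\hat\nu(|W|)I+\frac{\hat\nu'(|W|)}{|W|}W\otimes W$ for $W\ne0$ and $\mathrm DT(0)=\hat\nu(0)I$; $S_W(V)=T(W+V)-T(W)-\mathrm DT(W)V$. **Setting (ferromagnetic inclusion in air).** $D\subset\mathbb R^2$ is a bounded domain, $F\in H^{-1}(D)$ with $\mathrm{supp}(F)\subset\subset D$, $\Omega^d$ is open with $\Omega^d\subset\subset D\setminus\mathrm{supp}(F)$, $x_0\in\Omega^d$, $\omega_\varepsilon=x_0+\varepsilon\omega$. Unperturbed state $u_0^{(2)}\in H_0^1(D)$: $\int_D\nu_0\nabla u_0^{(2)}\cdot\nabla\eta=\langle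 F,\eta\rangle$ for all $\eta\in H_0^1(D)$. For $\varepsilon>0$, $T^{(2)}_\varepsilon(x,W)=\chi_{\omega_\varepsilon}(x)T(W)+\chi_{D\setminus\omega_\varepsilon}(x)\nu_0W$, and the perturbed state $u_\varepsilon^{(2)}\in H_0^1(D)$ solves $\int_DT^{(2)}_\varepsilon(x,\nabla u^{(2)}_\varepsilon)\cdot\nabla\eta=\langle F,\eta\rangle$ for all $\eta\in H_0^1(D)$. (J) $\mathcal J:H_0^1(D)\to\mathbb R$ is such that, for $\varepsilon\ge0$ small enough, $\mathcal J(u^{(2)}_\varepsilon)=\mathcal J(u^{(2)}_0)+\langle\tilde G,u^{(2)}_\varepsilon-u^{(2)}_0\rangle+\delta_J\varepsilon^2+R(\varepsilon)$, where $\tilde G$ is a bounded linear form on $H_0^1(D)$, $\delta_J\in\mathbb R$, and $R(\varepsilon)=O\big(\int_{D\setminus B(x_0,\hat\alpha\varepsilon^{\tilde r})}|\nabla(u^{(2)}_\varepsilon-u^{(2)}_0)|^2\big)$ for some given $\hat\alpha>0$, $\tilde r\in(0,1)$. Unperturbed adjoint state $p_0^{(2)}\in H_0^1(D)$: $\int_D\nu_0\nabla p_0^{(2)}\cdot\nabla\eta=-\langle\tilde G,\eta\rangle$ for all $\eta\in H_0^1(D)$. Set $U_0^{(2)}=\nabla u_0^{(2)}(x_0)$, $P_0^{(2)}=\nabla p_0^{(2)}(x_0)$. **Weighted space.** With $w(x)=\frac1{(1+|x|^2)^{1/2}\log(2+|x|)}$, let $\mathcal H^w(\mathbb R^2)=\{u\in\mathcal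 D'(\mathbb R^2): wu\in L^2,\nabla u\in L^2\}$ with its natural Hilbert norm, and $\mathcal H(\mathbb R^2)=\mathcal H^w(\mathbb R^2)/\mathbb R$ (quotient by constants, quotient norm). Gradients of classes are well defined. **Problems at scale 1.** $H^{(2)}\in\mathcal H(\mathbb R^2)$ solves, for all $\eta\in\mathcal H(\mathbb R^2)$, $\int_{\mathbb R^2\setminus\omega}\nu_0\nabla H^{(2)}\cdot\nabla\eta+\int_\omega(T(U_0^{(2)}+\nabla H^{(2)})-T(U_0^{(2)}))\cdot\nabla\eta=\int_\omega(\nu_0-\hat\nu(|U_0^{(2)}|))U_0^{(2)}\cdot\nabla\eta$. $K^{(2)}\in\mathcal H(\mathbb R^2)$ solves, for all $\eta\in\mathcal H(\mathbb R^2)$, $\int_{\mathbb R^2\setminus\omega}\nu_0\nabla K^{(2)}\cdot\nabla\eta+\int_\omega\mathrm DT(U_0^{(2)})\nabla K^{(2)}\cdot\nabla\eta=\int_\omega(\nu_0I-\mathrm DT(U_0^{(2)}))P_0^{(2)}\cdot\nabla\eta$. **Matrix.** With $\lambda_1=\hat\nu(|U_0^{(2)}|)$, $\lambda_2=\hat\nu(|U_0^{(2)}|)+\hat\nu'(|U_0^{(2)}|)|U_0^{(2)}|$ and $R$ a rotation matrix with $U_0^{(2)}=R(|U_0^{(2)}|,0)^\top$, $$\mathcal M^{(2)}=2|\omega|\nu_0\,R\begin{pmatrix}\frac{\lambda_1-\nu_0}{\lambda_2+\nu_0}&0\\0&\frac{\lambda_1-\nu_0}{\lambda_1+\nu_0}\end{pmatrix}R^\top.$$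 *)

theory Defs
  imports "HOL-Analysis.Analysis" "HOL-Library.Landau_Symbols"
begin

type_synonym plane = "real^2"

text \<open>Derivative of a function on the half line \<open>[0,\<infinity>)\<close>, one-sided at \<open>0\<close>; values of the
  function at negative arguments play no role.\<close>

definition deriv_half :: "(real \<Rightarrow> real) \<Rightarrow> real \<Rightarrow> real" where
  "deriv_half f s = vector_derivative f (at s within {0..})"

primrec Ck_half :: "nat \<Rightarrow> (real \<Rightarrow> real) \<Rightarrow> bool" where
  "Ck_half 0 = (\<lambda>f. continuous_on {0..} f)"
| "Ck_half (Suc k) = (\<lambda>f. (\<forall>s\<ge>0. f differentiable (at s within {0..})) \<and> Ck_half k (deriv_half f))"

definition cond_N1 :: "(real \<Rightarrow> real) \<Rightarrow> real \<Rightarrow> bool" where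
  "cond_N1 \<nu> \<nu>0 \<longleftrightarrow>
     Ck_half 1 \<nu> \<and>
     (\<exists>\<nu>l>0. \<forall>s\<ge>0. \<nu>l \<le> \<nu> s \<and> \<nu> s \<le> \<nu>0 \<and>
        \<nu>l \<le> deriv_half (\<lambda>t. \<nu> t * t) s \<and> deriv_half (\<lambda>t. \<nu> t * t) s \<le> \<nu>0)"

definition cond_N2 :: "(real \<Rightarrow> real) \<Rightarrow> bool" where
  "cond_N2 \<nu> \<longleftrightarrow>
     Ck_half 3 \<nu> \<and>
     (\<exists>c>0. (\<forall>s>0. \<bar>deriv_half \<nu> s\<bar> / s \<le> c) \<and>
        (\<exists>l\<le>c. ((\<lambda>s. \<bar>deriv_half \<nu> s\<bar> / s) \<longlongrightarrow> l) (at_right 0))) \<and>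
     (\<exists>c4\<ge>0. \<forall>s\<ge>0. \<bar>(deriv_half ^^ 2) (\<lambda>t. \<nu> t * t) s\<bar> \<le> c4) \<and>
     (\<exists>c5\<ge>0. \<forall>s\<ge>0. \<bar>(deriv_half ^^ 3) (\<lambda>t. \<nu> t * t) s\<bar> \<le> c5) \<and>
     (\<exists>c'\<ge>0. \<forall>s\<ge>0. \<bar>deriv_half \<nu> s\<bar> \<le> c') \<and>
     (\<exists>c''\<ge>0. \<forall>s\<ge>0. \<bar>(deriv_half ^^ 2) \<nu> s\<bar> \<le> c'')"

definition T_op :: "(real \<Rightarrow> real) \<Rightarrow> plane \<Rightarrow> plane" where
  "T_op \<nu> W = \<nu> (norm W) *\<^sub>R W"

definition outer :: "plane \<Rightarrow> plane \<Rightarrow> real^2^2" where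
  "outer V W = (\<chi> i j. V $ i * W $ j)"

definition DT :: "(real \<Rightarrow> real) \<Rightarrow> plane \<Rightarrow> real^2^2" where
  "DT \<nu> W = (if W = 0 then mat (\<nu> 0)
     else mat (\<nu> (norm W)) + (deriv_half \<nu> (norm W) / norm W) *\<^sub>R outer W W)"

definition S_op :: "(real \<Rightarrow> real) \<Rightarrow> plane \<Rightarrow> plane \<Rightarrow> plane" where
  "S_op \<nu> W V = T_op \<nu> (W + V) - T_op \<nu> W - DT \<nu> W *v V"

text \<open>\<open>A\<close> is the ferromagnetic inclusion, its complement is air.\<close>

definition T_pert :: "(real \<Rightarrow> real) \<Rightarrow> real \<Rightarrow> plane set \<Rightarrow> plane \<Rightarrow> plane \<Rightarrow> plane" where
  "T_pert \<nu> \<nu>0 A x W = (if x \<in> A then T_op \<nu> W else \<nu>0 *\<^sub>R W)"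

definition scaled :: "plane \<Rightarrow> real \<Rightarrow> plane set \<Rightarrow> plane set" where
  "scaled x0 \<epsilon> \<omega> = (\<lambda>y. x0 + \<epsilon> *\<^sub>R y) ` \<omega>"

definition grad :: "(plane \<Rightarrow> real) \<Rightarrow> plane \<Rightarrow> plane" where
  "grad f x = (THE g. GDERIV f x :> g)"

primrec Ck :: "nat \<Rightarrow> (plane \<Rightarrow> real) \<Rightarrow> bool" where
  "Ck 0 = (\<lambda>f. continuous_on UNIV f)"
| "Ck (Suc k) = (\<lambda>f. (\<forall>x. GDERIV f x :> grad f x) \<and> (\<forall>i. Ck k (\<lambda>x. grad f x $ i)))"

definition compactly_in :: "plane set \<Rightarrow> plane set \<Rightarrow> bool" where
  "compactly_in A B \<longleftrightarrow> compact (closure A) \<and> closure A \<subseteq> B"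

definition test_fun :: "plane set \<Rightarrow> (plane \<Rightarrow> real) \<Rightarrow> bool" where
  "test_fun \<Omega> \<phi> \<longleftrightarrow> (\<forall>k. Ck k \<phi>) \<and> compactly_in {x. \<phi> x \<noteq> 0} \<Omega>"

definition locally_integrable :: "plane set \<Rightarrow> (plane \<Rightarrow> 'b::euclidean_space) \<Rightarrow> bool" where
  "locally_integrable \<Omega> f \<longleftrightarrow> (\<forall>K. compact K \<and> K \<subseteq> \<Omega> \<longrightarrow> set_integrable lborel K f)"

definition L2 :: "plane set \<Rightarrow> (plane \<Rightarrow> 'b::euclidean_space) set" where
  "L2 \<Omega> = {f. set_borel_measurable lborel \<Omega> f \<and> set_integrable lborel \<Omega> (\<lambda>x. (norm (f x))\<^sup>2)}"

definition has_weak_grad :: "plane set \<Rightarrow> (plane \<Rightarrow> real) \<Rightarrow> (plane \<Rightarrow> plane) \<Rightarrow> bool" where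
  "has_weak_grad \<Omega> u g \<longleftrightarrow>
     locally_integrable \<Omega> u \<and> locally_integrable \<Omega> g \<and>
     (\<forall>\<phi>. test_fun \<Omega> \<phi> \<longrightarrow>
        (LINT x:\<Omega>|lborel. u x *\<^sub>R grad \<phi> x) = - (LINT x:\<Omega>|lborel. \<phi> x *\<^sub>R g x))"

text \<open>The weak gradient is unique almost everywhere on \<open>\<Omega>\<close>; \<open>wgrad\<close> picks a version of it and
  is only ever used under an integral over a subset of \<open>\<Omega>\<close>.\<close>

definition wgrad :: "plane set \<Rightarrow> (plane \<Rightarrow> real) \<Rightarrow> plane \<Rightarrow> plane" where
  "wgrad \<Omega> u = (SOME g. has_weak_grad \<Omega> u g)"

text \<open>Elements of \<open>H1 \<Omega>\<close> and \<open>H01 \<Omega>\<close> are representatives of almost-everywhere classes on \<open>\<Omega>\<close>;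
  their values outside \<open>\<Omega>\<close> are irrelevant. Functionals on these spaces have to respect
  almost-everywhere equality, see \<open>ae_invariant\<close>; for \<open>bounded_form\<close> this follows from the bound.\<close>

definition H1 :: "plane set \<Rightarrow> (plane \<Rightarrow> real) set" where
  "H1 \<Omega> = {u. u \<in> L2 \<Omega> \<and> (\<exists>g. has_weak_grad \<Omega> u g \<and> g \<in> L2 \<Omega>)}"

definition H1_norm :: "plane set \<Rightarrow> (plane \<Rightarrow> real) \<Rightarrow> real" where
  "H1_norm \<Omega> u =
     sqrt ((LINT x:\<Omega>|lborel. (u x)\<^sup>2) + (LINT x:\<Omega>|lborel. (norm (wgrad \<Omega> u x))\<^sup>2))"

definition H01 :: "plane set \<Rightarrow> (plane \<Rightarrow> real) set" where
  "H01 \<Omega> = {u \<in> H1 \<Omega>. \<exists>\<phi>. (\<forall>n::nat. test_fun \<Omega> (\<phi> n)) \<and>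
                 (\<lambda>n. H1_norm \<Omega> (\<lambda>x. u x - \<phi> n x)) \<longlonglongrightarrow> 0}"

definition ae_invariant :: "plane set \<Rightarrow> ((plane \<Rightarrow> real) \<Rightarrow> real) \<Rightarrow> bool" where
  "ae_invariant \<Omega> J \<longleftrightarrow>
     (\<forall>u\<in>H01 \<Omega>. \<forall>v\<in>H01 \<Omega>. (AE x in lborel. x \<in> \<Omega> \<longrightarrow> u x = v x) \<longrightarrow> J u = J v)"

text \<open>Membership in \<open>H\<^sup>-\<^sup>1(\<Omega>)\<close>, the dual of \<open>H01 \<Omega>\<close>.\<close>

definition bounded_form :: "plane set \<Rightarrow> ((plane \<Rightarrow> real) \<Rightarrow> real) \<Rightarrow> bool" where
  "bounded_form \<Omega> F \<longleftrightarrow>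
     (\<forall>u\<in>H01 \<Omega>. \<forall>v\<in>H01 \<Omega>. F (\<lambda>x. u x + v x) = F u + F v) \<and>
     (\<forall>c. \<forall>u\<in>H01 \<Omega>. F (\<lambda>x. c * u x) = c * F u) \<and>
     (\<exists>C. \<forall>u\<in>H01 \<Omega>. \<bar>F u\<bar> \<le> C * H1_norm \<Omega> u)"

definition supp_form :: "plane set \<Rightarrow> ((plane \<Rightarrow> real) \<Rightarrow> real) \<Rightarrow> plane set" where
  "supp_form \<Omega> F =
     {x\<in>\<Omega>. \<forall>U. open U \<and> x \<in> U \<and> U \<subseteq> \<Omega> \<longrightarrow> (\<exists>\<phi>. test_fun U \<phi> \<and> F \<phi> \<noteq> 0)}"

text \<open>\<open>v\<close> is the representative of class \<open>C\<^sup>1\<^sup>,\<^sup>\<beta>\<close> of \<open>u\<close> on the open set \<open>\<Omega>\<close>; the Hoelder condition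
  is the local one, on compact subsets of \<open>\<Omega>\<close>.\<close>

definition C1_holder_repr :: "plane set \<Rightarrow> real \<Rightarrow> (plane \<Rightarrow> real) \<Rightarrow> (plane \<Rightarrow> real) \<Rightarrow> bool" where
  "C1_holder_repr \<Omega> \<beta> u v \<longleftrightarrow>
     (AE x in lborel. x \<in> \<Omega> \<longrightarrow> u x = v x) \<and>
     (\<forall>x\<in>\<Omega>. GDERIV v x :> grad v x) \<and>
     (\<forall>K. compact K \<and> K \<subseteq> \<Omega> \<longrightarrow>
        (\<exists>C. \<forall>x\<in>K. \<forall>y\<in>K. norm (grad v x - grad v y) \<le> C * norm (x - y) powr \<beta>))"

definition solves_unperturbed ::
    "plane set \<Rightarrow> real \<Rightarrow> ((plane \<Rightarrow> real) \<Rightarrow> real) \<Rightarrow> (plane \<Rightarrow> real) \<Rightarrow> bool" where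
  "solves_unperturbed D \<nu>0 F u \<longleftrightarrow>
     u \<in> H01 D \<and>
     (\<forall>\<eta>\<in>H01 D. (LINT x:D|lborel. (\<nu>0 *\<^sub>R wgrad D u x) \<bullet> wgrad D \<eta> x) = F \<eta>)"

definition solves_perturbed ::
    "plane set \<Rightarrow> (real \<Rightarrow> real) \<Rightarrow> real \<Rightarrow> plane set \<Rightarrow> ((plane \<Rightarrow> real) \<Rightarrow> real) \<Rightarrow>
     (plane \<Rightarrow> real) \<Rightarrow> bool" where
  "solves_perturbed D \<nu> \<nu>0 A F u \<longleftrightarrow>
     u \<in> H01 D \<and>
     (\<forall>\<eta>\<in>H01 D. (LINT x:D|lborel. T_pert \<nu> \<nu>0 A x (wgrad D u x) \<bullet> wgrad D \<eta> x) = F \<eta>)"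

text \<open>\<open>J\<close> is only required to have this expansion along the family \<open>u\<close>;
  \<open>u \<epsilon>\<close> is the perturbed state for \<open>\<epsilon> > 0\<close> and \<open>u 0\<close> the unperturbed one.\<close>

definition cond_J ::
    "plane set \<Rightarrow> plane \<Rightarrow> (real \<Rightarrow> plane \<Rightarrow> real) \<Rightarrow> ((plane \<Rightarrow> real) \<Rightarrow> real) \<Rightarrow>
     ((plane \<Rightarrow> real) \<Rightarrow> real) \<Rightarrow> real \<Rightarrow> bool" where
  "cond_J D x0 u J G \<delta> \<longleftrightarrow>
     ae_invariant D J \<and> bounded_form D G \<and>
     (\<exists>Rem \<alpha> r \<epsilon>0. \<alpha> > 0 \<and> 0 < r \<and> r < 1 \<and> \<epsilon>0 > 0 \<and>
        (\<forall>\<epsilon>\<in>{0..<\<epsilon>0}.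
           J (u \<epsilon>) = J (u 0) + G (\<lambda>x. u \<epsilon> x - u 0 x) + \<delta> * \<epsilon>\<^sup>2 + Rem \<epsilon>) \<and>
        Rem \<in> O[at_right 0](\<lambda>\<epsilon>. LINT x:(D - ball x0 (\<alpha> * \<epsilon> powr r))|lborel.
                 (norm (wgrad D (\<lambda>y. u \<epsilon> y - u 0 y) x))\<^sup>2))"

definition weight :: "plane \<Rightarrow> real" where
  "weight x = 1 / (sqrt (1 + (norm x)\<^sup>2) * ln (2 + norm x))"

text \<open>A distribution \<open>u\<close> with \<open>weight * u\<close> in \<open>L\<^sup>2\<close> is a locally square integrable function,
  so it suffices to consider functions.\<close>

definition Hw :: "(plane \<Rightarrow> real) set" where
  "Hw = {u. (\<lambda>x. weight x * u x) \<in> L2 UNIV \<and> (\<exists>g. has_weak_grad UNIV u g \<and> g \<in> L2 UNIV)}"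

text \<open>The relation identifies functions up to null sets and additive constants.\<close>

definition const_rel :: "((plane \<Rightarrow> real) \<times> (plane \<Rightarrow> real)) set" where
  "const_rel = {(u, v). u \<in> Hw \<and> v \<in> Hw \<and> (\<exists>c. AE x in lborel. u x - v x = c)}"

definition Hquot :: "(plane \<Rightarrow> real) set set" where
  "Hquot = Hw // const_rel"

definition cgrad :: "(plane \<Rightarrow> real) set \<Rightarrow> plane \<Rightarrow> plane" where
  "cgrad X = wgrad UNIV (SOME u. u \<in> X)"

definition solves_H ::
    "(real \<Rightarrow> real) \<Rightarrow> real \<Rightarrow> plane set \<Rightarrow> plane \<Rightarrow> (plane \<Rightarrow> real) set \<Rightarrow> bool" where
  "solves_H \<nu> \<nu>0 \<omega> U H \<longleftrightarrow>
     H \<in> Hquot \<and>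
     (\<forall>\<eta>\<in>Hquot.
        (LINT x:(- \<omega>)|lborel. (\<nu>0 *\<^sub>R cgrad H x) \<bullet> cgrad \<eta> x)
        + (LINT x:\<omega>|lborel. (T_op \<nu> (U + cgrad H x) - T_op \<nu> U) \<bullet> cgrad \<eta> x)
        = (LINT x:\<omega>|lborel. ((\<nu>0 - \<nu> (norm U)) *\<^sub>R U) \<bullet> cgrad \<eta> x))"

definition solves_K ::
    "(real \<Rightarrow> real) \<Rightarrow> real \<Rightarrow> plane set \<Rightarrow> plane \<Rightarrow> plane \<Rightarrow> (plane \<Rightarrow> real) set \<Rightarrow> bool" where
  "solves_K \<nu> \<nu>0 \<omega> U P K \<longleftrightarrow>
     K \<in> Hquot \<and>
     (\<forall>\<eta>\<in>Hquot.
        (LINT x:(- \<omega>)|lborel. (\<nu>0 *\<^sub>R cgrad K x) \<bullet> cgrad \<eta> x)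
        + (LINT x:\<omega>|lborel. (DT \<nu> U *v cgrad K x) \<bullet> cgrad \<eta> x)
        = (LINT x:\<omega>|lborel. ((mat \<nu>0 - DT \<nu> U) *v P) \<bullet> cgrad \<eta> x))"

definition pol_matrix ::
    "(real \<Rightarrow> real) \<Rightarrow> real \<Rightarrow> plane set \<Rightarrow> plane \<Rightarrow> real^2^2 \<Rightarrow> real^2^2" where
  "pol_matrix \<nu> \<nu>0 \<omega> U R =
     (let l1 = \<nu> (norm U);
          l2 = \<nu> (norm U) + deriv_half \<nu> (norm U) * norm U
      in (2 * measure lborel \<omega> * \<nu>0) *\<^sub>R
         (R ** vector [vector [(l1 - \<nu>0) / (l2 + \<nu>0), 0],
                       vector [0, (l1 - \<nu>0) / (l1 + \<nu>0)]] ** transpose R))"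

end

theory Submission
  imports Defs
begin

text \<open>
  Put \<open>w = u \<epsilon> - u 0\<close> and let \<open>contrast W = T W - \<nu>0 W\<close> be the difference between the two material laws.
  Subtracting the two state equations leaves the contrast on the inclusion as the only source:
  \<open>\<integral> \<nu>0 \<nabla>w \<cdot> \<nabla>\<eta> + \<integral>\<^bsub>inclusion\<^esub> contrast (\<nabla>u 0 + \<nabla>w) \<cdot> \<nabla>\<eta> = 0\<close>.
  Testing with the adjoint state, and the adjoint equation with \<open>w\<close>, gives the exact identity
  \<open>G w = \<integral>\<^bsub>inclusion\<^esub> contrast (\<nabla>u 0 + \<nabla>w) \<cdot> \<nabla>p\<close>.
  The unperturbed gradients are continuous at \<open>x0\<close>, so everything follows once \<open>\<nabla>w\<close> is known on the inclusion
  up to an error \<open>o(\<epsilon>)\<close> in \<open>L\<^sup>2\<close>.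

  The approximation of \<open>\<nabla>w\<close> is \<open>h\<^sub>\<epsilon>(x) = \<nabla>H ((x - x0) / \<epsilon>)\<close> (lemma \<open>corrector_convergence\<close>). On test functions with
  support in \<open>D\<close>, \<open>w\<close> and \<open>h\<^sub>\<epsilon>\<close> solve the same monotone equation up to the oscillation of \<open>\<nabla>u 0\<close> on the
  inclusion. Cea's argument (lemmas \<open>Cea_pointwise\<close> and \<open>Cea_estimate\<close>) bounds the error by this oscillation
  plus the distance of \<open>h\<^sub>\<epsilon>\<close> from the gradients of such test functions. By scaling, that distance is small as
  soon as the gradients of test functions on the whole plane are dense in the \<open>L\<^sup>2\<close> gradients
  (lemma \<open>curl_free_approx\<close>).

  For the density, the component of an \<open>L\<^sup>2\<close> gradient orthogonal to all \<open>\<nabla>\<phi>\<close> is both divergence free and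
  curl free, and such a field vanishes (lemma \<open>Liouville_div_curl\<close>). This is shown with explicit
  dipoles, test functions that equal \<open>a \<cdot> (x - z)\<close> on a disc of radius \<open>r\<close> and are close to the dipole
  potential \<open>r\<^sup>2 a \<cdot> (x - z) / |x - z|\<^sup>2\<close> outside of it. The gradient of such a function minus the rotated gradient of
  its conjugate is close to \<open>2 a\<close> times the indicator of the disc (lemmas \<open>dipole_conjugate\<close> and
  \<open>integral_dipole_limit\<close>). So the field has mean zero on every disc, and Vitali's covering theorem and Lebesgue differentiation finish the proof
  (lemma \<open>AE_eq_0_if_discs\<close>).

  It remains to identify \<open>\<integral>\<^bsub>\<omega>\<^esub> contrast (U + \<nabla>H) \<cdot> P\<close> with the stated formula (lemma \<open>polarisation_identity\<close>).
  Testing the equation of \<open>H\<close> with \<open>K\<close> and that of \<open>K\<close> with \<open>H\<close> turns the integral of \<open>S\<close> into the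
  wanted one, up to a multiple of \<open>\<integral>\<^bsub>\<omega>\<^esub> \<nabla>K \<cdot> U + |\<omega>| U \<cdot> P\<close>. The same dipoles, centred at \<open>0\<close>, are used as test
  functions for \<open>K\<close> and give this value (lemma \<open>polarisation_average\<close>); it produces the entry of the matrix
  belonging to the direction of \<open>U\<close>, the only one that \<open>U\<close> sees.

  The remainder of the functional is \<open>o(\<epsilon>\<^sup>2)\<close> because \<open>h\<^sub>\<epsilon>\<close> concentrates at scale \<open>\<epsilon>\<close>, whereas the remainder
  only sees \<open>\<nabla>w\<close> at distance at least of order \<open>\<epsilon>\<^sup>r\<close> with \<open>r < 1\<close> (lemma \<open>far_energy_small\<close>).
\<close>

section \<open>Calculus of smooth functions on the plane\<close>

lemma GDERIV_imp_grad: "GDERIV f x :> d \<Longrightarrow> grad f x = d"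
proof -
  assume d: "GDERIV f x :> d"
  have "e = d" if "GDERIV f x :> e" for e
  proof -
    have "(\<lambda>h. h \<bullet> e) = (\<lambda>h. h \<bullet> d)"
      using d that has_derivative_unique unfolding gderiv_def by blast
    then have "\<And>h. h \<bullet> (e - d) = 0"
      by (simp add: fun_eq_iff inner_diff_right)
    then show "e = d"
      by (metis inner_eq_zero_iff eq_iff_diff_eq_0)
  qed
  then show ?thesis
    unfolding grad_def using d by blast
qed

lemma GDERIV_imp_continuous: "(\<And>x. GDERIV f x :> g x) \<Longrightarrow> continuous_on UNIV f"
  unfolding gderiv_def
  by (metis has_derivative_continuous continuous_at_imp_continuous_on)

lemma Ck_SucI:
  assumes "\<And>x. GDERIV f x :> g x" and "\<And>i. Ck k (\<lambda>x. g x $ i)"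
  shows "Ck (Suc k) f"
proof -
  have "grad f = g"
    using GDERIV_imp_grad assms(1) by blast
  then show ?thesis
    using assms by simp
qed

lemma Ck_imp_continuous: "Ck k f \<Longrightarrow> continuous_on UNIV f"
  by (cases k) (auto intro: GDERIV_imp_continuous)

lemma Ck_SucD: "Ck (Suc k) f \<Longrightarrow> Ck k f"
proof (induction k arbitrary: f)
  case 0
  then show ?case by (metis Ck.simps(1) Ck_imp_continuous)
next
  case (Suc k)
  then show ?case by (metis Ck.simps(2))
qed

lemma Ck_const: "Ck k (\<lambda>x. c)"
proof (induction k arbitrary: c)
  case (Suc k)
  show ?case
    by (rule Ck_SucI[where g="\<lambda>x. 0"]) (use Suc in \<open>auto simp: GDERIV_const\<close>)
qed simp

lemma Ck_add: "Ck k f \<Longrightarrow> Ck k g \<Longrightarrow> Ck k (\<lambda>x. f x + g x)"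
proof (induction k arbitrary: f g)
  case (Suc k)
  show ?case
    by (rule Ck_SucI[where g="\<lambda>x. grad f x + grad g x"])
       (use Suc in \<open>auto intro!: GDERIV_add\<close>)
qed (auto intro: continuous_intros)

lemma Ck_mult: "Ck k f \<Longrightarrow> Ck k g \<Longrightarrow> Ck k (\<lambda>x. f x * g x)"
proof (induction k arbitrary: f g)
  case (Suc k)
  have "Ck k f" "Ck k g"
    using Suc.prems Ck_SucD by blast+
  then have "Ck k (\<lambda>x. f x * grad g x $ i + g x * grad f x $ i)" for i
    using Suc by (intro Ck_add Suc.IH) auto
  then show ?case
    using Suc.prems
    by (intro Ck_SucI[where g="\<lambda>x. f x *\<^sub>R grad g x + g x *\<^sub>R grad f x"]) (auto intro!: GDERIV_mult)
qed (auto intro: continuous_intros)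

lemma Ck_cmult: "Ck k f \<Longrightarrow> Ck k (\<lambda>x. c * f x)"
  by (intro Ck_mult Ck_const)

lemma Ck_diff: "Ck k f \<Longrightarrow> Ck k g \<Longrightarrow> Ck k (\<lambda>x. f x - g x)"
  using Ck_add[of k f "\<lambda>x. (-1) * g x"] Ck_cmult[of k g "-1"] by simp

lemma GDERIV_inner: "GDERIV (\<lambda>x. (x - z) \<bullet> a) x :> a"
  unfolding gderiv_def by (auto intro!: derivative_eq_intros simp: inner_commute)

lemma Ck_inner: "Ck k (\<lambda>x. (x - z) \<bullet> a)"
proof (cases k)
  case 0 then show ?thesis by (auto intro!: continuous_intros)
next
  case (Suc n)
  then show ?thesis
    by (simp only:) (rule Ck_SucI[OF GDERIV_inner Ck_const])
qed

lemma Ck_nth_diff: "Ck k (\<lambda>x. x $ i - z $ i)"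
  using Ck_inner[of k z "axis i 1"] by (simp add: inner_axis)

lemma norm_plane: "(norm (x::plane))\<^sup>2 = (x $ 1)\<^sup>2 + (x $ 2)\<^sup>2"
  by (simp add: norm_eq_sqrt_inner inner_vec_def sum_2 power2_eq_square)

lemma Ck_norm_power2: "Ck k (\<lambda>x. (norm (x - z))\<^sup>2)"
proof -
  have "Ck k (\<lambda>x. (x $ 1 - z $ 1) * (x $ 1 - z $ 1) + (x $ 2 - z $ 2) * (x $ 2 - z $ 2))"
    by (intro Ck_add Ck_mult Ck_nth_diff)
  then show ?thesis
    by (simp add: norm_plane) (simp add: power2_eq_square)
qed

lemma Ck_inverse:
  assumes "\<And>x. f x \<noteq> 0"
  shows "Ck k f \<Longrightarrow> Ck k (\<lambda>x. inverse (f x))"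
proof (induction k)
  case 0 then show ?case using assms by (auto intro!: continuous_intros)
next
  case (Suc k)
  have "Ck k (\<lambda>x. inverse (f x))"
    using Suc Ck_SucD by blast
  then have c: "Ck k (\<lambda>x. (-1) * ((inverse (f x) * inverse (f x)) * grad f x $ i))" for i
    using Suc.prems by (intro Ck_mult Ck_const) auto
  have d: "GDERIV (\<lambda>x. inverse (f x)) x :> - (inverse (f x))\<^sup>2 *\<^sub>R grad f x" for x
    using Suc.prems assms by (intro GDERIV_inverse) auto
  show ?case
  proof (rule Ck_SucI[OF d])
    show "Ck k (\<lambda>x. (- (inverse (f x))\<^sup>2 *\<^sub>R grad f x) $ i)" for i
      using c[of i] by (simp add: power2_eq_square)
  qed
qed

text \<open>The classical flat functions \<open>exp (- 1 / t) / t ^ m\<close>, extended by zero. The exponent \<open>m\<close> makes the family closed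
  under differentiation up to linear combinations, so that smoothness of every \<open>flat m \<circ> f\<close> follows by one
  induction on the order.\<close>

definition flat :: "nat \<Rightarrow> real \<Rightarrow> real" where
  "flat m t = (if t \<le> 0 then 0 else exp (- 1 / t) / t ^ m)"

lemma flat_nonneg: "0 \<le> flat m t"
  by (simp add: flat_def)

lemma flat_pos: "0 < t \<Longrightarrow> 0 < flat m t"
  by (simp add: flat_def)

lemma flat_nonpos_arg: "t \<le> 0 \<Longrightarrow> flat m t = 0"
  by (simp add: flat_def)

lemma tendsto_flat_0: "((\<lambda>t. flat m t) \<longlongrightarrow> 0) (at 0)"
proof -
  have l: "((\<lambda>t. flat m t) \<longlongrightarrow> 0) (at_left 0)"
    by (rule Lim_transform_eventually[OF tendsto_const])
       (auto simp: eventually_at_filter flat_def)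
  have "((\<lambda>t. (inverse t) ^ m / exp (inverse t)) \<longlongrightarrow> (0::real)) (at_right 0)"
    using filterlim_compose[OF tendsto_power_div_exp_0 filterlim_inverse_at_top_right] .
  then have r: "((\<lambda>t. flat m t) \<longlongrightarrow> 0) (at_right 0)"
    by (rule Lim_transform_eventually)
       (auto simp: eventually_at_filter flat_def field_simps exp_minus)
  show ?thesis
    using l r filterlim_split_at by blast
qed

lemma DERIV_flat: "DERIV (flat m) t :> flat (m + 2) t - real m * flat (m + 1) t"
proof -
  consider "t < 0" | "t = 0" | "t > 0" by linarith
  then show ?thesis
  proof cases
    case 1
    have "DERIV (\<lambda>t. 0) t :> (0::real)" by simp
    then have "DERIV (flat m) t :> 0"
      by (rule has_field_derivative_transform_within_open[of _ _ _ "{..<0}"])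
         (use 1 in \<open>auto simp: flat_def\<close>)
    then show ?thesis using 1 by (simp add: flat_def)
  next
    case 2
    have "((\<lambda>h. (flat m (0 + h) - flat m 0) / h) \<longlongrightarrow> 0) (at 0)"
      by (rule Lim_transform_eventually[OF tendsto_flat_0[of "m + 1"]])
         (auto simp: flat_def eventually_at_filter)
    then have "DERIV (flat m) 0 :> 0"
      unfolding DERIV_def .
    then show ?thesis using 2 by (simp add: flat_def)
  next
    case 3
    have e: "DERIV (\<lambda>t. exp (- 1 / t) / t ^ m) t :>
        (exp (- 1 / t) * (1 / t\<^sup>2) * t ^ m - exp (- 1 / t) * (real m * t ^ (m - 1))) / (t ^ m * t ^ m)"
      using 3 by (auto intro!: derivative_eq_intros simp: power2_eq_square)
    have d: "DERIV (\<lambda>t. exp (- 1 / t) / t ^ m) t :> flat (m + 2) t - real m * flat (m + 1) t"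
      using e
    proof (rule DERIV_cong)
      show "(exp (- 1 / t) * (1 / t\<^sup>2) * t ^ m - exp (- 1 / t) * (real m * t ^ (m - 1))) / (t ^ m * t ^ m)
        = flat (m + 2) t - real m * flat (m + 1) t"
        using 3 by (cases m) (simp_all add: flat_def field_simps power2_eq_square)
    qed
    show ?thesis
      by (rule has_field_derivative_transform_within_open[OF d, of "{0<..}"])
         (use 3 in \<open>auto simp: flat_def\<close>)
  qed
qed

lemma Ck_flat: "Ck k f \<Longrightarrow> Ck k (\<lambda>x. flat m (f x))"
proof (induction k arbitrary: m)
  case 0
  have "continuous_on UNIV (flat m)"
    by (meson DERIV_flat DERIV_isCont continuous_at_imp_continuous_on)
  then show ?case
    using 0 continuous_on_compose2[of UNIV "flat m" UNIV f] by simp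
next
  case (Suc k)
  have "Ck k f" using Suc.prems Ck_SucD by blast
  then have c: "Ck k (\<lambda>x. (flat (m + 2) (f x) - real m * flat (m + 1) (f x)) * grad f x $ i)" for i
    using Suc.prems by (intro Ck_mult Ck_diff Ck_cmult Suc.IH) auto
  have d: "GDERIV (\<lambda>x. flat m (f x)) x :>
      (flat (m + 2) (f x) - real m * flat (m + 1) (f x)) *\<^sub>R grad f x" for x
    using Suc.prems by (intro GDERIV_DERIV_compose[OF _ DERIV_flat]) auto
  show ?case
  proof (rule Ck_SucI[OF d])
    show "Ck k (\<lambda>x. ((flat (m + 2) (f x) - real m * flat (m + 1) (f x)) *\<^sub>R grad f x) $ i)" for i
      using c[of i] by simp
  qed
qed

text \<open>A smooth transition from \<open>0\<close> on \<open>t \<le> 0\<close> to \<open>1\<close> on \<open>t \<ge> 1\<close>, the source of all cut-offs below.\<close>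

definition step :: "real \<Rightarrow> real" where
  "step t = flat 0 t * inverse (flat 0 t + flat 0 (1 - t))"

definition step_deriv :: "real \<Rightarrow> real" where
  "step_deriv t = (flat 2 t * flat 0 (1 - t) + flat 0 t * flat 2 (1 - t)) / (flat 0 t + flat 0 (1 - t))\<^sup>2"

lemma step_denom_pos: "0 < flat 0 t + flat 0 (1 - t)"
  using flat_nonneg[of 0 t] flat_nonneg[of 0 "1 - t"] flat_pos[of t 0] flat_pos[of "1 - t" 0]
  by linarith

lemma step_le_0 [simp]: "t \<le> 0 \<Longrightarrow> step t = 0" "t \<le> 0 \<Longrightarrow> step_deriv t = 0"
  by (simp_all add: step_def step_deriv_def flat_nonpos_arg)

lemma step_ge_1 [simp]: "1 \<le> t \<Longrightarrow> step t = 1" "1 \<le> t \<Longrightarrow> step_deriv t = 0"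
  using flat_pos[of t 0] by (simp_all add: step_def step_deriv_def flat_nonpos_arg)

lemma step_bounds: "0 \<le> step t" "step t \<le> 1"
  using step_denom_pos[of t] flat_nonneg[of 0 t] flat_nonneg[of 0 "1 - t"]
  by (auto simp: step_def divide_inverse[symmetric])

lemma DERIV_step: "DERIV step t :> step_deriv t"
proof -
  have a: "DERIV (flat 0) t :> flat 2 t" for t
    using DERIV_flat[of 0 t] by (simp add: numeral_2_eq_2)
  have "DERIV (\<lambda>t. 1 - t) t :> -1"
    by (auto intro!: derivative_eq_intros)
  then have b: "DERIV (\<lambda>t. flat 0 (1 - t)) t :> - flat 2 (1 - t)"
    using DERIV_chain2[where f="flat 0" and g="\<lambda>t. 1 - t" and x=t and s=UNIV, OF a[of "1 - t"], of "-1"]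
    by simp
  have ne: "flat 0 t + flat 0 (1 - t) \<noteq> 0"
    using step_denom_pos[of t] by simp
  have quot: "p' * inverse (p + r) + - (inverse (p + r) * (p' - r') * inverse (p + r)) * p
      = (p' * r + p * r') / (p + r)\<^sup>2" if "p + r \<noteq> 0" for p r p' r' :: real
  proof -
    have "p' * inverse (p + r) = p' * (p + r) / (p + r)\<^sup>2"
      using that by (simp add: power2_eq_square divide_inverse)
    moreover have "- (inverse (p + r) * (p' - r') * inverse (p + r)) * p = - ((p' - r') * p) / (p + r)\<^sup>2"
      by (simp add: power2_eq_square divide_inverse mult_ac)
    moreover have "p' * (p + r) - (p' - r') * p = p' * r + p * r'"
      by (simp add: algebra_simps)
    ultimately show ?thesis
      by (metis add_divide_distrib uminus_add_conv_diff add.commute)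
  qed
  have "DERIV (\<lambda>t. flat 0 t + flat 0 (1 - t)) t :> flat 2 t - flat 2 (1 - t)"
    using DERIV_add[OF a b] by simp
  from DERIV_mult[OF a DERIV_inverse_fun[OF this ne]] show ?thesis
    unfolding step_def[abs_def] step_deriv_def quot[OF ne, symmetric] by (simp add: mult_ac)
qed

lemma step_deriv_bound: "\<exists>C>0. \<forall>t. \<bar>step_deriv t\<bar> \<le> C"
proof -
  have c: "continuous_on A (\<lambda>t. flat m (h t))" if "continuous_on A h" for A m and h :: "real \<Rightarrow> real"
  proof -
    have "continuous_on UNIV (flat m)"
      by (meson DERIV_flat DERIV_isCont continuous_at_imp_continuous_on)
    then show ?thesis
      using continuous_on_compose2 that by blast
  qed
  have ne: "flat 0 t + flat 0 (1 - t) \<noteq> 0" for t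
    using step_denom_pos[of t] by simp
  have "continuous_on {0..1} step_deriv"
    unfolding step_deriv_def[abs_def] by (intro continuous_intros c) (simp add: ne)
  then have "bounded (step_deriv ` {0..1})"
    by (meson compact_Icc compact_continuous_image compact_imp_bounded)
  then obtain C where C: "C > 0" "\<forall>t\<in>{0..1}. \<bar>step_deriv t\<bar> \<le> C"
    by (auto simp: bounded_pos)
  have "\<bar>step_deriv t\<bar> \<le> C" for t
    using C by (cases "t \<in> {0..1}") auto
  then show ?thesis using C by blast
qed

lemma Ck_step: "Ck k f \<Longrightarrow> Ck k (\<lambda>x. step (f x))"
proof -
  assume f: "Ck k f"
  have "flat 0 (f x) + flat 0 (1 - f x) \<noteq> 0" for x
    using step_denom_pos[of "f x"] by simp
  then show ?thesis
    unfolding step_def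
    by (intro Ck_mult Ck_inverse Ck_add Ck_flat Ck_diff Ck_const f)
qed

section \<open>Test functions\<close>

lemma test_funI:
  assumes "\<And>k. Ck k \<phi>" "compact K" "K \<subseteq> \<Omega>" "\<And>x. x \<notin> K \<Longrightarrow> \<phi> x = 0"
  shows "test_fun \<Omega> \<phi>"
proof -
  have "{x. \<phi> x \<noteq> 0} \<subseteq> K"
    using assms(4) by blast
  then have "closure {x. \<phi> x \<noteq> 0} \<subseteq> K"
    using compact_imp_closed[OF assms(2)] by (rule closure_minimal)
  then have "compactly_in {x. \<phi> x \<noteq> 0} \<Omega>"
    using assms(2,3) compact_closure bounded_subset compact_imp_bounded closure_subset
    unfolding compactly_in_def by (meson subset_trans)
  then show ?thesis
    using assms(1) by (simp add: test_fun_def)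
qed

lemma test_fun_Ck: "test_fun \<Omega> \<phi> \<Longrightarrow> Ck k \<phi>"
  by (simp add: test_fun_def)

lemma test_fun_GDERIV: "test_fun \<Omega> \<phi> \<Longrightarrow> GDERIV \<phi> x :> grad \<phi> x"
  using test_fun_Ck[of \<Omega> \<phi> "Suc 0"] by simp

lemma test_fun_supportE:
  assumes "test_fun \<Omega> \<phi>"
  obtains K where "compact K" "K \<subseteq> \<Omega>" "\<And>x. x \<notin> K \<Longrightarrow> \<phi> x = 0" "\<And>x. x \<notin> K \<Longrightarrow> grad \<phi> x = 0"
proof -
  define K where "K = closure {x. \<phi> x \<noteq> 0}"
  have K: "compact K" "K \<subseteq> \<Omega>"
    using assms by (auto simp: test_fun_def compactly_in_def K_def)
  have z: "\<phi> x = 0" if "x \<notin> K" for x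
    using that closure_subset[of "{x. \<phi> x \<noteq> 0}"] by (auto simp: K_def)
  have "grad \<phi> x = 0" if "x \<notin> K" for x
  proof (rule GDERIV_imp_grad)
    have "open (- K)"
      using K by (simp add: compact_imp_closed open_Compl)
    moreover have "((\<lambda>x. 0) has_derivative (\<lambda>h. 0)) (at x)" by simp
    ultimately have "(\<phi> has_derivative (\<lambda>h. 0)) (at x)"
      using has_derivative_transform_within_open[of "\<lambda>x. 0" "\<lambda>h. 0" x UNIV "- K" \<phi>] that z by auto
    then show "GDERIV \<phi> x :> 0" by (simp add: gderiv_def)
  qed
  then show thesis using that K z by blast
qed

lemma test_fun_mono: "test_fun \<Omega> \<phi> \<Longrightarrow> \<Omega> \<subseteq> \<Omega>' \<Longrightarrow> test_fun \<Omega>' \<phi>"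
  by (auto simp: test_fun_def compactly_in_def)

lemma test_fun_partial: "test_fun \<Omega> \<phi> \<Longrightarrow> test_fun \<Omega> (\<lambda>x. grad \<phi> x $ i)"
proof -
  assume t: "test_fun \<Omega> \<phi>"
  obtain K where K: "compact K" "K \<subseteq> \<Omega>" "\<And>x. x \<notin> K \<Longrightarrow> grad \<phi> x = 0"
    using test_fun_supportE[OF t] by metis
  have 1: "Ck k (\<lambda>x. grad \<phi> x $ i)" for k
    using test_fun_Ck[OF t, of "Suc k"] by simp
  have 2: "grad \<phi> x $ i = 0" if "x \<notin> K" for x
    using K(3)[OF that] by simp
  show ?thesis
    by (rule test_funI[OF 1 K(1,2) 2])
qed

lemma continuous_grad: "test_fun \<Omega> \<phi> \<Longrightarrow> continuous_on UNIV (grad \<phi>)"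
proof -
  assume t: "test_fun \<Omega> \<phi>"
  have "continuous_on UNIV (\<lambda>x. \<chi> i. grad \<phi> x $ i)"
    by (intro continuous_on_vec_lambda Ck_imp_continuous[of 0] test_fun_Ck[OF test_fun_partial[OF t]])
  then show ?thesis by simp
qed

lemma test_fun_continuous: "test_fun \<Omega> \<phi> \<Longrightarrow> continuous_on UNIV \<phi>"
  using Ck_imp_continuous test_fun_Ck by blast

lemma test_fun_diff: "test_fun \<Omega> \<phi> \<Longrightarrow> test_fun \<Omega> \<psi> \<Longrightarrow> test_fun \<Omega> (\<lambda>x. \<phi> x - \<psi> x)"
proof -
  assume t: "test_fun \<Omega> \<phi>" "test_fun \<Omega> \<psi>"
  obtain K L where K: "compact K" "K \<subseteq> \<Omega>" "\<And>x. x \<notin> K \<Longrightarrow> \<phi> x = 0"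
    and L: "compact L" "L \<subseteq> \<Omega>" "\<And>x. x \<notin> L \<Longrightarrow> \<psi> x = 0"
    using test_fun_supportE[OF t(1)] test_fun_supportE[OF t(2)] by metis
  show ?thesis
    by (rule test_funI[of _ "K \<union> L"]) (use K L test_fun_Ck[OF t(1)] test_fun_Ck[OF t(2)] in \<open>auto intro!: Ck_diff\<close>)
qed

lemma test_fun_cmult: "test_fun \<Omega> \<phi> \<Longrightarrow> test_fun \<Omega> (\<lambda>x. c * \<phi> x)"
proof -
  assume t: "test_fun \<Omega> \<phi>"
  obtain K where K: "compact K" "K \<subseteq> \<Omega>" "\<And>x. x \<notin> K \<Longrightarrow> \<phi> x = 0"
    using test_fun_supportE[OF t] by metis
  show ?thesis
    by (rule test_funI[of _ K]) (use K test_fun_Ck[OF t] in \<open>auto intro!: Ck_cmult\<close>)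
qed

lemma grad_test_cmult: "test_fun \<Omega> \<phi> \<Longrightarrow> grad (\<lambda>x. c * \<phi> x) x = c *\<^sub>R grad \<phi> x"
  using GDERIV_mult[OF GDERIV_const test_fun_GDERIV, of \<Omega> \<phi> c x] by (intro GDERIV_imp_grad) simp

lemma test_fun_add: "test_fun \<Omega> \<phi> \<Longrightarrow> test_fun \<Omega> \<psi> \<Longrightarrow> test_fun \<Omega> (\<lambda>x. \<phi> x + \<psi> x)"
  using test_fun_diff[of \<Omega> \<phi> "\<lambda>x. (-1) * \<psi> x"] test_fun_cmult[of \<Omega> \<psi> "-1"] by simp

lemma grad_test_add:
  "test_fun \<Omega> \<phi> \<Longrightarrow> test_fun \<Omega>' \<psi> \<Longrightarrow> grad (\<lambda>x. \<phi> x + \<psi> x) x = grad \<phi> x + grad \<psi> x"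
  by (intro GDERIV_imp_grad GDERIV_add test_fun_GDERIV)

lemma GDERIV_affine:
  assumes "GDERIV f (c *\<^sub>R (x - z)) :> d"
  shows "GDERIV (\<lambda>x. f (c *\<^sub>R (x - z))) x :> c *\<^sub>R d"
proof -
  have "((\<lambda>x. c *\<^sub>R (x - z)) has_derivative (\<lambda>h. c *\<^sub>R h)) (at x)"
    by (auto intro!: derivative_eq_intros)
  then show ?thesis
    using diff_chain_at[of "\<lambda>x. c *\<^sub>R (x - z)" _ x f] assms
    by (force simp: gderiv_def o_def inner_commute)
qed

lemma Ck_affine: "Ck k f \<Longrightarrow> Ck k (\<lambda>x. f (c *\<^sub>R (x - z)))"
proof (induction k arbitrary: f)
  case 0
  then show ?case
    by (auto intro!: continuous_on_compose2[of UNIV f] continuous_intros)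
next
  case (Suc k)
  show ?case
    by (rule Ck_SucI[OF GDERIV_affine]) (use Suc in \<open>auto intro!: Ck_cmult Suc.IH\<close>)
qed

lemma test_fun_affine:
  assumes t: "test_fun UNIV \<phi>" and "c \<noteq> 0"
  shows "test_fun UNIV (\<lambda>x. \<phi> (c *\<^sub>R (x - z)))"
    and "grad (\<lambda>x. \<phi> (c *\<^sub>R (x - z))) x = c *\<^sub>R grad \<phi> (c *\<^sub>R (x - z))"
proof -
  obtain K where K: "compact K" "\<And>x. x \<notin> K \<Longrightarrow> \<phi> x = 0"
    using test_fun_supportE[OF t] by metis
  have 1: "compact ((\<lambda>y. z + inverse c *\<^sub>R y) ` K)"
    by (intro compact_continuous_image continuous_intros K)
  have 2: "\<phi> (c *\<^sub>R (x - z)) = 0" if "x \<notin> (\<lambda>y. z + inverse c *\<^sub>R y) ` K" for x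
  proof (rule K(2))
    show "c *\<^sub>R (x - z) \<notin> K"
    proof
      assume "c *\<^sub>R (x - z) \<in> K"
      then have "z + inverse c *\<^sub>R (c *\<^sub>R (x - z)) \<in> (\<lambda>y. z + inverse c *\<^sub>R y) ` K" by blast
      then show False using that \<open>c \<noteq> 0\<close> by simp
    qed
  qed
  show "test_fun UNIV (\<lambda>x. \<phi> (c *\<^sub>R (x - z)))"
    by (rule test_funI[OF Ck_affine[OF test_fun_Ck[OF t]] 1]) (use 2 in auto)
  show "grad (\<lambda>x. \<phi> (c *\<^sub>R (x - z))) x = c *\<^sub>R grad \<phi> (c *\<^sub>R (x - z))"
    by (intro GDERIV_imp_grad GDERIV_affine test_fun_GDERIV[OF t])
qed

text \<open>The mean value theorem, applied once in each direction, expresses the second difference through one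
  mixed derivative. The second difference is symmetric in the two directions, which gives Schwarz's theorem below.\<close>

lemma mixed_difference:
  assumes t: "test_fun \<Omega> \<phi>" and h: "0 < h"
  obtains s s' where "0 \<le> s" "s \<le> h" "0 \<le> s'" "s' \<le> h"
    "\<phi> (x + h *\<^sub>R axis i 1 + h *\<^sub>R axis j 1) - \<phi> (x + h *\<^sub>R axis i 1) - \<phi> (x + h *\<^sub>R axis j 1) + \<phi> x
      = h\<^sup>2 * grad (\<lambda>x. grad \<phi> x $ i) (x + s *\<^sub>R axis i 1 + s' *\<^sub>R axis j 1) $ j"
proof -
  have line: "DERIV (\<lambda>s. \<psi> (y + s *\<^sub>R axis k 1)) s :> grad \<psi> (y + s *\<^sub>R axis k 1) $ k"
    if "test_fun \<Omega> \<psi>" for \<psi> y k s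
  proof -
    have "((\<lambda>s. y + s *\<^sub>R axis k 1) has_derivative (\<lambda>h. h *\<^sub>R axis k 1)) (at s)"
      by (auto intro!: derivative_eq_intros)
    from diff_chain_at[OF this test_fun_GDERIV[OF that, unfolded gderiv_def]]
    show ?thesis
      by (simp add: has_field_derivative_def o_def inner_axis' mult_commute_abs)
  qed
  have "\<exists>s>0. s < h \<and>
      (\<phi> ((x + h *\<^sub>R axis j 1) + h *\<^sub>R axis i 1) - \<phi> (x + h *\<^sub>R axis i 1))
      - (\<phi> ((x + h *\<^sub>R axis j 1) + 0 *\<^sub>R axis i 1) - \<phi> (x + 0 *\<^sub>R axis i 1))
      = (h - 0) * (grad \<phi> ((x + h *\<^sub>R axis j 1) + s *\<^sub>R axis i 1) $ i - grad \<phi> (x + s *\<^sub>R axis i 1) $ i)"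
    by (rule MVT2[OF h, of "\<lambda>s. \<phi> ((x + h *\<^sub>R axis j 1) + s *\<^sub>R axis i 1) - \<phi> (x + s *\<^sub>R axis i 1)"])
      (rule DERIV_diff[OF line[OF t] line[OF t]])
  then obtain s where s: "0 < s" "s < h" and 1:
      "(\<phi> ((x + h *\<^sub>R axis j 1) + h *\<^sub>R axis i 1) - \<phi> (x + h *\<^sub>R axis i 1))
      - (\<phi> (x + h *\<^sub>R axis j 1) - \<phi> x)
      = h * (grad \<phi> ((x + h *\<^sub>R axis j 1) + s *\<^sub>R axis i 1) $ i - grad \<phi> (x + s *\<^sub>R axis i 1) $ i)"
    by auto
  have "\<exists>s'>0. s' < h \<and>
      grad \<phi> ((x + s *\<^sub>R axis i 1) + h *\<^sub>R axis j 1) $ i - grad \<phi> ((x + s *\<^sub>R axis i 1) + 0 *\<^sub>R axis j 1) $ i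
      = (h - 0) * grad (\<lambda>x. grad \<phi> x $ i) ((x + s *\<^sub>R axis i 1) + s' *\<^sub>R axis j 1) $ j"
    by (rule MVT2[OF h, of "\<lambda>r. grad \<phi> ((x + s *\<^sub>R axis i 1) + r *\<^sub>R axis j 1) $ i"])
      (rule line[OF test_fun_partial[OF t]])
  then obtain s' where s': "0 < s'" "s' < h" and 2:
      "grad \<phi> ((x + s *\<^sub>R axis i 1) + h *\<^sub>R axis j 1) $ i - grad \<phi> (x + s *\<^sub>R axis i 1) $ i
      = h * grad (\<lambda>x. grad \<phi> x $ i) ((x + s *\<^sub>R axis i 1) + s' *\<^sub>R axis j 1) $ j"
    by auto
  show thesis
    by (rule that[of s s']) (use s s' 1 2 in \<open>simp_all add: add_ac power2_eq_square\<close>)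
qed

lemma mixed_partials_commute:
  assumes t: "test_fun \<Omega> \<phi>"
  shows "grad (\<lambda>x. grad \<phi> x $ i) x $ j = grad (\<lambda>x. grad \<phi> x $ j) x $ i"
proof -
  define h where "h n = inverse (real (Suc n))" for n
  have h: "h n > 0" for n by (simp add: h_def)
  have h0: "h \<longlonglongrightarrow> 0" unfolding h_def by (rule LIMSEQ_inverse_real_of_nat)
  define \<Delta> where "\<Delta> n = (\<phi> (x + h n *\<^sub>R axis i 1 + h n *\<^sub>R axis j 1) - \<phi> (x + h n *\<^sub>R axis i 1)
      - \<phi> (x + h n *\<^sub>R axis j 1) + \<phi> x) / (h n)\<^sup>2" for n
  have lim: "(\<lambda>n. \<Delta> n) \<longlonglongrightarrow> grad (\<lambda>x. grad \<phi> x $ i) x $ j"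
    if "\<And>n. \<exists>s s'. 0 \<le> s \<and> s \<le> h n \<and> 0 \<le> s' \<and> s' \<le> h n \<and>
       \<Delta> n = grad (\<lambda>x. grad \<phi> x $ i) (x + s *\<^sub>R axis i 1 + s' *\<^sub>R axis j 1) $ j" for i j :: 2
  proof -
    have "\<forall>n. \<exists>p. 0 \<le> fst p \<and> fst p \<le> h n \<and> 0 \<le> snd p \<and> snd p \<le> h n \<and>
       \<Delta> n = grad (\<lambda>x. grad \<phi> x $ i) (x + fst p *\<^sub>R axis i 1 + snd p *\<^sub>R axis j 1) $ j"
    proof
      fix n
      from that[of n] obtain s s' where "0 \<le> s \<and> s \<le> h n \<and> 0 \<le> s' \<and> s' \<le> h n \<and>
         \<Delta> n = grad (\<lambda>x. grad \<phi> x $ i) (x + s *\<^sub>R axis i 1 + s' *\<^sub>R axis j 1) $ j"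
        by blast
      then show "\<exists>p. 0 \<le> fst p \<and> fst p \<le> h n \<and> 0 \<le> snd p \<and> snd p \<le> h n \<and>
         \<Delta> n = grad (\<lambda>x. grad \<phi> x $ i) (x + fst p *\<^sub>R axis i 1 + snd p *\<^sub>R axis j 1) $ j"
        by (intro exI[of _ "(s, s')"]) simp
    qed
    from choice[OF this] obtain p where
      p: "\<forall>n. 0 \<le> fst (p n) \<and> fst (p n) \<le> h n \<and> 0 \<le> snd (p n) \<and> snd (p n) \<le> h n \<and>
       \<Delta> n = grad (\<lambda>x. grad \<phi> x $ i) (x + fst (p n) *\<^sub>R axis i 1 + snd (p n) *\<^sub>R axis j 1) $ j" ..
    define s s' where "s n = fst (p n)" and "s' n = snd (p n)" for n
    have s: "0 \<le> s n \<and> s n \<le> h n \<and> 0 \<le> s' n \<and> s' n \<le> h n \<and>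
       \<Delta> n = grad (\<lambda>x. grad \<phi> x $ i) (x + s n *\<^sub>R axis i 1 + s' n *\<^sub>R axis j 1) $ j" for n
      using p unfolding s_def s'_def by blast
    have "s \<longlonglongrightarrow> 0" "s' \<longlonglongrightarrow> 0"
      using s by (auto intro!: tendsto_sandwich[OF _ _ tendsto_const h0])
    then have "(\<lambda>n. x + s n *\<^sub>R axis i 1 + s' n *\<^sub>R axis j 1) \<longlonglongrightarrow> x + 0 *\<^sub>R axis i 1 + 0 *\<^sub>R axis j 1"
      by (intro tendsto_intros)
    then have l: "(\<lambda>n. x + s n *\<^sub>R axis i 1 + s' n *\<^sub>R axis j 1) \<longlonglongrightarrow> x" by simp
    have "isCont (\<lambda>x. grad (\<lambda>x. grad \<phi> x $ i) x $ j) x"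
      using test_fun_continuous[OF test_fun_partial[OF test_fun_partial[OF t]]]
      by (simp add: continuous_on_eq_continuous_at)
    from isCont_tendsto_compose[OF this l] show ?thesis
      using s by simp
  qed
  have 1: "\<Delta> \<longlonglongrightarrow> grad (\<lambda>x. grad \<phi> x $ i) x $ j"
  proof (rule lim)
    show "\<exists>s s'. 0 \<le> s \<and> s \<le> h n \<and> 0 \<le> s' \<and> s' \<le> h n \<and>
       \<Delta> n = grad (\<lambda>x. grad \<phi> x $ i) (x + s *\<^sub>R axis i 1 + s' *\<^sub>R axis j 1) $ j" for n
    proof -
      obtain s s' where st: "0 \<le> s" "s \<le> h n" "0 \<le> s'" "s' \<le> h n" and
        "\<phi> (x + h n *\<^sub>R axis i 1 + h n *\<^sub>R axis j 1) - \<phi> (x + h n *\<^sub>R axis i 1)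
          - \<phi> (x + h n *\<^sub>R axis j 1) + \<phi> x
        = (h n)\<^sup>2 * grad (\<lambda>x. grad \<phi> x $ i) (x + s *\<^sub>R axis i 1 + s' *\<^sub>R axis j 1) $ j"
        by (rule mixed_difference[OF t h[of n], of x i j])
      then have "\<Delta> n = grad (\<lambda>x. grad \<phi> x $ i) (x + s *\<^sub>R axis i 1 + s' *\<^sub>R axis j 1) $ j"
        using h[of n] by (simp add: \<Delta>_def)
      then show ?thesis
        using st by (intro exI[of _ s] exI[of _ s'] conjI)
    qed
  qed
  have 2: "\<Delta> \<longlonglongrightarrow> grad (\<lambda>x. grad \<phi> x $ j) x $ i"
  proof (rule lim)
    show "\<exists>s s'. 0 \<le> s \<and> s \<le> h n \<and> 0 \<le> s' \<and> s' \<le> h n \<and>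
       \<Delta> n = grad (\<lambda>x. grad \<phi> x $ j) (x + s *\<^sub>R axis j 1 + s' *\<^sub>R axis i 1) $ i" for n
    proof -
      obtain s s' where st: "0 \<le> s" "s \<le> h n" "0 \<le> s'" "s' \<le> h n" and
        *: "\<phi> (x + h n *\<^sub>R axis j 1 + h n *\<^sub>R axis i 1) - \<phi> (x + h n *\<^sub>R axis j 1)
          - \<phi> (x + h n *\<^sub>R axis i 1) + \<phi> x
        = (h n)\<^sup>2 * grad (\<lambda>x. grad \<phi> x $ j) (x + s *\<^sub>R axis j 1 + s' *\<^sub>R axis i 1) $ i"
        by (rule mixed_difference[OF t h[of n], of x j i])
      have eq: "x + h n *\<^sub>R axis i 1 + h n *\<^sub>R axis j 1 = x + h n *\<^sub>R axis j 1 + h n *\<^sub>R axis i 1"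
        by (simp add: add_ac)
      have "\<phi> (x + h n *\<^sub>R axis i 1 + h n *\<^sub>R axis j 1) - \<phi> (x + h n *\<^sub>R axis i 1)
          - \<phi> (x + h n *\<^sub>R axis j 1) + \<phi> x
        = (h n)\<^sup>2 * grad (\<lambda>x. grad \<phi> x $ j) (x + s *\<^sub>R axis j 1 + s' *\<^sub>R axis i 1) $ i"
        unfolding eq using * by linarith
      then have "\<Delta> n = grad (\<lambda>x. grad \<phi> x $ j) (x + s *\<^sub>R axis j 1 + s' *\<^sub>R axis i 1) $ i"
        using h[of n] by (simp add: \<Delta>_def)
      then show ?thesis
        using st by (intro exI[of _ s] exI[of _ s'] conjI)
    qed
  qed
  show ?thesis using 1 2 LIMSEQ_unique by blast
qed

section \<open>Integration by parts\<close>

lemma compact_support_integrable: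
  fixes f :: "plane \<Rightarrow> 'b::euclidean_space"
  assumes "continuous_on UNIV f" "compact K" "\<And>x. x \<notin> K \<Longrightarrow> f x = 0"
  shows "integrable lborel f"
proof -
  have "integrable lborel (\<lambda>x. indicator K x *\<^sub>R f x)"
    using assms by (intro borel_integrable_compact) (auto intro: continuous_on_subset)
  moreover have "(\<lambda>x. indicator K x *\<^sub>R f x) = f"
    using assms(3) by (auto simp: indicator_def fun_eq_iff)
  ultimately show ?thesis by simp
qed

text \<open>The integral of \<open>f (x + t e) - f x\<close> vanishes by translation invariance of the Lebesgue measure. Dividing by \<open>t\<close> and
  letting \<open>t \<rightarrow> 0\<close> under the integral, with the Lipschitz bound of \<open>f\<close> as a majorant, gives the claim.
  This is the source of every integration by parts.\<close>

lemma integral_gradient_zero: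
  fixes f :: "plane \<Rightarrow> real"
  assumes f: "\<And>x. GDERIV f x :> g x" and g: "continuous_on UNIV g"
    and K: "compact K" "\<And>x. x \<notin> K \<Longrightarrow> f x = 0" "\<And>x. x \<notin> K \<Longrightarrow> g x = 0"
  shows "integral\<^sup>L lborel g = 0"
proof -
  have fc: "continuous_on UNIV f" using f GDERIV_imp_continuous by blast
  have fi: "integrable lborel f" using compact_support_integrable[OF fc K(1,2)] .
  have gi: "integrable lborel g" using compact_support_integrable[OF g K(1,3)] .
  have fm: "f \<in> borel_measurable borel" using fc borel_measurable_continuous_onI by blast
  have gm: "g \<in> borel_measurable borel" using g borel_measurable_continuous_onI by blast
  have "bounded (g ` K)"
    using K g by (meson compact_continuous_image compact_imp_bounded continuous_on_subset subset_UNIV)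
  then obtain M where M: "M > 0" "\<And>x. x \<in> K \<Longrightarrow> norm (g x) \<le> M"
    by (auto simp: bounded_pos)
  have M': "norm (g x) \<le> M" for x
    using M K(3)[of x] by (cases "x \<in> K") auto
  \<comment> \<open>The difference quotients with step at most \<open>1\<close> vanish outside of the ball of radius \<open>B + 1\<close>.\<close>
  obtain B where B: "B > 0" "K \<subseteq> cball 0 B"
    using compact_imp_bounded[OF K(1)] bounded_subset_cball by (metis mem_cball subset_eq not_less
      dual_order.strict_trans1 less_eq_real_def bounded_pos mem_cball_0)
  have lip: "\<bar>f y - f x\<bar> \<le> M * norm (y - x)" for x y
  proof -
    have "norm (f y - f x) \<le> M * norm (y - x)"
    proof (rule differentiable_bound[where S=UNIV and f'="\<lambda>x h. h \<bullet> g x"])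
      show "onorm (\<lambda>h. h \<bullet> g x) \<le> M" for x
      proof (rule onorm_le)
        fix h
        have "norm (h \<bullet> g x) \<le> norm h * norm (g x)" by (simp add: Cauchy_Schwarz_ineq2)
        also have "\<dots> \<le> norm h * M" using M' by (intro mult_left_mono) auto
        finally show "norm (h \<bullet> g x) \<le> M * norm h" by (simp add: mult.commute)
      qed
      show "(f has_derivative (\<lambda>h. h \<bullet> g x)) (at x within UNIV)" for x
        using f by (simp add: gderiv_def)
    qed auto
    then show ?thesis by simp
  qed
  have "integral\<^sup>L lborel (\<lambda>x. g x \<bullet> e) = 0" if e: "norm e = 1" for e
  proof -
    define t where "t n = inverse (real (Suc n))" for n
    have t: "0 < t n" "t n \<le> 1" for n by (auto simp: t_def field_simps)
    have t0: "t \<longlonglongrightarrow> 0" unfolding t_def by (rule LIMSEQ_inverse_real_of_nat)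
    define q where "q n x = (f (x + t n *\<^sub>R e) - f x) / t n" for n x
    have shift: "integrable lborel (\<lambda>x. f (x + t n *\<^sub>R e))" "(\<integral>x. f (x + t n *\<^sub>R e) \<partial>lborel) = integral\<^sup>L lborel f" for n
    proof -
      have d: "distr lborel borel ((+) (t n *\<^sub>R e)) = lborel" by (rule lborel_distr_plus)
      show "integrable lborel (\<lambda>x. f (x + t n *\<^sub>R e))"
        using fi fm integrable_distr_eq[of "(+) (t n *\<^sub>R e)" lborel borel f] by (simp add: d add.commute)
      show "(\<integral>x. f (x + t n *\<^sub>R e) \<partial>lborel) = integral\<^sup>L lborel f"
        using fm integral_distr[of "(+) (t n *\<^sub>R e)" lborel borel f] by (simp add: d add.commute)
    qed
    have q0: "integral\<^sup>L lborel (q n) = 0" for n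
      unfolding q_def using fi shift[of n] by simp
    have "(\<lambda>n. integral\<^sup>L lborel (q n)) \<longlonglongrightarrow> integral\<^sup>L lborel (\<lambda>x. g x \<bullet> e)"
    proof (rule integral_dominated_convergence[where w="\<lambda>x. M * indicator (cball 0 (B + 1)) x"])
      show "integrable lborel (\<lambda>x. M * indicat_real (cball (0::plane) (B + 1)) x)"
        using emeasure_lborel_cball_finite[of "0::plane" "B + 1"]
        by (intro integrable_mult_right integrable_real_indicator) (auto simp: infinity_ennreal_def)
      show "AE x in lborel. (\<lambda>n. q n x) \<longlonglongrightarrow> g x \<bullet> e"
      proof (rule AE_I2)
        fix x
        have "((\<lambda>s. x + s *\<^sub>R e) has_derivative (\<lambda>h. h *\<^sub>R e)) (at 0)"
          by (auto intro!: derivative_eq_intros)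
        moreover have "(f has_derivative (\<lambda>h. h \<bullet> g x)) (at (x + 0 *\<^sub>R e))"
          using f by (simp add: gderiv_def)
        ultimately have "((f \<circ> (\<lambda>s. x + s *\<^sub>R e)) has_derivative ((\<lambda>h. h \<bullet> g x) \<circ> (\<lambda>h. h *\<^sub>R e))) (at 0)"
          by (rule diff_chain_at)
        then have "DERIV (\<lambda>s. f (x + s *\<^sub>R e)) 0 :> g x \<bullet> e"
          by (simp add: has_field_derivative_def o_def inner_commute mult_commute_abs)
        then have "((\<lambda>s. (f (x + s *\<^sub>R e) - f x) / s) \<longlongrightarrow> g x \<bullet> e) (at 0)"
          by (simp add: DERIV_def)
        moreover have "filterlim t (at 0) sequentially"
          using t0 t unfolding filterlim_at by (auto intro!: always_eventually simp: less_imp_neq[symmetric])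
        ultimately show "(\<lambda>n. q n x) \<longlonglongrightarrow> g x \<bullet> e"
          unfolding q_def by (rule filterlim_compose)
      qed
      show "AE x in lborel. norm (q n x) \<le> M * indicator (cball 0 (B + 1)) x" for n
      proof (rule AE_I2)
        fix x
        show "norm (q n x) \<le> M * indicator (cball 0 (B + 1)) x"
        proof (cases "x \<in> cball 0 (B + 1)")
          case True
          have "\<bar>f (x + t n *\<^sub>R e) - f x\<bar> \<le> M * t n"
            using lip[of "x + t n *\<^sub>R e" x] e t[of n] by simp
          then show ?thesis using True t[of n] by (simp add: q_def field_simps)
        next
          case False
          have "norm x - t n \<le> norm (x + t n *\<^sub>R e)"
            using norm_diff_ineq[of x "t n *\<^sub>R e"] e t[of n] by simp
          then have "x \<notin> K" "x + t n *\<^sub>R e \<notin> K"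
            using False B(2) t[of n] by fastforce+
          then show ?thesis using False K(2) by (simp add: q_def)
        qed
      qed
    qed (use fm gm in \<open>auto simp: q_def[abs_def] intro!: borel_measurable_inner\<close>)
    moreover have "(\<lambda>n. integral\<^sup>L lborel (q n)) \<longlonglongrightarrow> 0"
      by (simp add: q0)
    ultimately show ?thesis using LIMSEQ_unique by blast
  qed
  then have "integral\<^sup>L lborel g \<bullet> e = 0" if "e \<in> Basis" for e
    using gi that by (simp add: integral_inner_left)
  then show ?thesis by (simp add: euclidean_eq_iff[of "integral\<^sup>L lborel g"])
qed

section \<open>Square integrable functions\<close>

definition square_integrable :: "('a::euclidean_space \<Rightarrow> 'b::euclidean_space) \<Rightarrow> bool" where
  "square_integrable f \<longleftrightarrow> f \<in> borel_measurable lborel \<and> integrable lborel (\<lambda>x. (norm (f x))\<^sup>2)"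

lemma square_integrableD:
  "square_integrable f \<Longrightarrow> f \<in> borel_measurable lborel"
  "square_integrable f \<Longrightarrow> integrable lborel (\<lambda>x. (norm (f x))\<^sup>2)"
  by (auto simp: square_integrable_def)

lemma square_integrable_bound:
  assumes "square_integrable f" "g \<in> borel_measurable lborel" "AE x in lborel. norm (g x) \<le> C * norm (f x)"
  shows "square_integrable g"
proof -
  have "integrable lborel (\<lambda>x. C\<^sup>2 * (norm (f x))\<^sup>2)"
    using assms(1) by (intro integrable_mult_right square_integrableD)
  then have "integrable lborel (\<lambda>x. (norm (g x))\<^sup>2)"
  proof (rule Bochner_Integration.integrable_bound)
    show "AE x in lborel. norm ((norm (g x))\<^sup>2) \<le> norm (C\<^sup>2 * (norm (f x))\<^sup>2)"
      using assms(3)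
    proof eventually_elim
      case (elim x)
      then have "(norm (g x))\<^sup>2 \<le> (C * norm (f x))\<^sup>2" by (intro power_mono) auto
      then show ?case by (simp add: power_mult_distrib)
    qed
  qed (use assms(2) in simp)
  then show ?thesis using assms(2) by (simp add: square_integrable_def)
qed

lemma norm_add_power2_le: "(norm (a + b))\<^sup>2 \<le> 2 * (norm a)\<^sup>2 + 2 * (norm (b::'a::real_inner))\<^sup>2"
proof -
  have "(norm (a + b))\<^sup>2 + (norm (a - b))\<^sup>2 = 2 * (norm a)\<^sup>2 + 2 * (norm b)\<^sup>2"
    by (simp add: power2_norm_eq_inner algebra_simps inner_commute)
  then show ?thesis using zero_le_power2[of "norm (a - b)"] by linarith
qed

lemma square_integrable_add:
  assumes "square_integrable f" "square_integrable g"
  shows "square_integrable (\<lambda>x. f x + g x)"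
proof -
  have [measurable]: "f \<in> borel_measurable lborel" "g \<in> borel_measurable lborel"
    using assms by (auto simp: square_integrable_def)
  have "integrable lborel (\<lambda>x. 2 * (norm (f x))\<^sup>2 + 2 * (norm (g x))\<^sup>2)"
    using assms by (intro Bochner_Integration.integrable_add integrable_mult_right square_integrableD)
  then have "integrable lborel (\<lambda>x. (norm (f x + g x))\<^sup>2)"
    by (rule Bochner_Integration.integrable_bound) (auto intro: norm_add_power2_le order_trans)
  then show ?thesis by (simp add: square_integrable_def)
qed

lemma square_integrable_scaleR: "square_integrable f \<Longrightarrow> square_integrable (\<lambda>x. c *\<^sub>R f x)"
  by (rule square_integrable_bound[of f _ "\<bar>c\<bar>"]) (auto simp: square_integrable_def)

lemma square_integrable_diff:
  "square_integrable f \<Longrightarrow> square_integrable g \<Longrightarrow> square_integrable (\<lambda>x. f x - g x)"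
  using square_integrable_add[of f "\<lambda>x. (-1) *\<^sub>R g x"] square_integrable_scaleR[of g "-1"] by simp

lemma square_integrable_indicator:
  "A \<in> sets borel \<Longrightarrow> square_integrable f \<Longrightarrow> square_integrable (\<lambda>x. indicator A x *\<^sub>R f x)"
  by (rule square_integrable_bound[of f _ 1]) (auto simp: square_integrable_def indicator_def)

lemma square_integrable_inner:
  assumes "square_integrable f" "square_integrable g"
  shows "integrable lborel (\<lambda>x. f x \<bullet> g x)"
proof -
  have [measurable]: "f \<in> borel_measurable lborel" "g \<in> borel_measurable lborel"
    using assms by (auto simp: square_integrable_def)
  have "integrable lborel (\<lambda>x. (norm (f x))\<^sup>2 + (norm (g x))\<^sup>2)"
    using assms by (intro Bochner_Integration.integrable_add square_integrableD)
  then show ?thesis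
  proof (rule Bochner_Integration.integrable_bound)
    show "AE x in lborel. norm (f x \<bullet> g x) \<le> norm ((norm (f x))\<^sup>2 + (norm (g x))\<^sup>2)"
    proof (rule AE_I2)
      fix x
      have "\<bar>f x \<bullet> g x\<bar> \<le> norm (f x) * norm (g x)" by (rule Cauchy_Schwarz_ineq2)
      also have "\<dots> \<le> (norm (f x))\<^sup>2 + (norm (g x))\<^sup>2"
        using sum_squares_bound[of "norm (f x)" "norm (g x)"] mult_nonneg_nonneg[of "norm (f x)" "norm (g x)"]
        by (simp add: mult.assoc del: mult_nonneg_nonneg)
      finally show "norm (f x \<bullet> g x) \<le> norm ((norm (f x))\<^sup>2 + (norm (g x))\<^sup>2)" by simp
    qed
  qed measurable
qed

lemma square_integrable_imp_set_integrable:
  assumes f: "square_integrable f" and A: "A \<in> sets borel" "emeasure lborel A < \<infinity>"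
  shows "set_integrable lborel A f"
proof -
  have [measurable]: "f \<in> borel_measurable lborel" using f by (simp add: square_integrable_def)
  have "integrable lborel (\<lambda>x. indicator A x + (norm (f x))\<^sup>2)"
    using A f by (intro Bochner_Integration.integrable_add square_integrableD integrable_real_indicator) auto
  then show ?thesis
    unfolding set_integrable_def
  proof (rule Bochner_Integration.integrable_bound)
    have "norm y \<le> 1 + (norm y)\<^sup>2" for y :: 'b
    proof -
      have "2 * norm y \<le> (norm y)\<^sup>2 + 1" using sum_squares_bound[of "norm y" 1] by simp
      then show ?thesis using norm_ge_zero[of y] by linarith
    qed
    then show "AE x in lborel. norm (indicat_real A x *\<^sub>R f x) \<le> norm (indicator A x + (norm (f x))\<^sup>2)"
      by (intro AE_I2) (auto simp: indicator_def)
  qed (use A in measurable)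
qed

text \<open>The quadratic polynomial \<open>t \<mapsto> \<integral> |f - t g|\<^sup>2\<close> is nonnegative.\<close>

lemma integral_Cauchy_Schwarz:
  assumes f: "square_integrable f" and g: "square_integrable g"
  shows "\<bar>\<integral>x. f x \<bullet> g x \<partial>lborel\<bar> \<le> sqrt (\<integral>x. (norm (f x))\<^sup>2 \<partial>lborel) * sqrt (\<integral>x. (norm (g x))\<^sup>2 \<partial>lborel)"
proof -
  let ?A = "\<integral>x. (norm (f x))\<^sup>2 \<partial>lborel" and ?B = "\<integral>x. (norm (g x))\<^sup>2 \<partial>lborel"
    and ?C = "\<integral>x. f x \<bullet> g x \<partial>lborel"
  have quad: "0 \<le> ?A - 2 * t * ?C + t\<^sup>2 * ?B" for t
  proof -
    have "0 \<le> (\<integral>x. (norm (f x - t *\<^sub>R g x))\<^sup>2 \<partial>lborel)" by simp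
    also have "\<dots> = (\<integral>x. (norm (f x))\<^sup>2 - (2 * t) * (f x \<bullet> g x) + t\<^sup>2 * (norm (g x))\<^sup>2 \<partial>lborel)"
      by (intro Bochner_Integration.integral_cong refl)
         (unfold power2_norm_eq_inner, simp add: inner_diff_left inner_diff_right inner_commute
            power2_eq_square algebra_simps)
    also have "\<dots> = ?A - 2 * t * ?C + t\<^sup>2 * ?B"
      using square_integrable_inner[OF f g] square_integrableD(2)[OF f] square_integrableD(2)[OF g]
      by simp
    finally show ?thesis .
  qed
  have B: "0 \<le> ?B" by simp
  have "?C\<^sup>2 \<le> ?A * ?B"
  proof (cases "?B = 0")
    case True
    have "?C = 0"
    proof (rule ccontr)
      assume "?C \<noteq> 0"
      then show False using quad[of "(?A + 1) / (2 * ?C)"] True by (simp add: field_simps)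
    qed
    then show ?thesis using True by simp
  next
    case False
    then have "?B > 0" using B by linarith
    then have "0 \<le> (?A - 2 * (?C / ?B) * ?C + (?C / ?B)\<^sup>2 * ?B) * ?B"
      using quad[of "?C / ?B"] by (intro mult_nonneg_nonneg) auto
    also have "\<dots> = ?A * ?B - ?C\<^sup>2"
      using \<open>?B > 0\<close> by (simp add: field_simps power2_eq_square)
    finally show ?thesis by simp
  qed
  then have "sqrt (?C\<^sup>2) \<le> sqrt (?A * ?B)" by (rule real_sqrt_le_mono)
  then show ?thesis by (simp add: real_sqrt_mult)
qed

lemma continuous_compact_support_square_integrable:
  fixes f :: "plane \<Rightarrow> 'b::euclidean_space"
  assumes "continuous_on UNIV f" "compact K" "\<And>x. x \<notin> K \<Longrightarrow> f x = 0"
  shows "square_integrable f"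
proof -
  have "integrable lborel (\<lambda>x. (norm (f x))\<^sup>2)"
    by (rule compact_support_integrable[OF _ assms(2)])
       (use assms(1,3) in \<open>auto intro!: continuous_intros\<close>)
  then show ?thesis
    using assms(1) borel_measurable_continuous_onI[of f] by (simp add: square_integrable_def)
qed

lemma square_integrable_test_fun:
  assumes "test_fun \<Omega> \<phi>"
  shows "square_integrable \<phi>" "square_integrable (grad \<phi>)"
proof -
  obtain K where K: "compact K" "\<And>x. x \<notin> K \<Longrightarrow> \<phi> x = 0" "\<And>x. x \<notin> K \<Longrightarrow> grad \<phi> x = 0"
    using test_fun_supportE[OF assms] by metis
  show "square_integrable \<phi>"
    by (rule continuous_compact_support_square_integrable[OF test_fun_continuous[OF assms] K(1,2)])
  show "square_integrable (grad \<phi>)"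
    by (rule continuous_compact_support_square_integrable[OF continuous_grad[OF assms] K(1,3)])
qed

section \<open>Functions with vanishing integrals over discs\<close>

text \<open>By Vitali's covering theorem an open set is, up to a null set, a countable disjoint union of closed discs.\<close>

lemma integral_open_eq_0_if_discs:
  fixes F :: "plane \<Rightarrow> 'b::euclidean_space"
  assumes F: "integrable lborel F" and S: "open S"
    and z: "\<And>z r. r > 0 \<Longrightarrow> cball z r \<subseteq> S \<Longrightarrow> (LINT x:cball z r|lborel. F x) = 0"
  shows "(LINT x:S|lborel. F x) = 0"
proof -
  define K where "K = {(z, r). 0 < r \<and> cball z r \<subseteq> S}"
  obtain C where C: "countable C" "C \<subseteq> K"
    "pairwise (\<lambda>i j. disjnt (cball (fst i) (snd i)) (cball (fst j) (snd j))) C"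
    "negligible (S - (\<Union>i\<in>C. cball (fst i) (snd i)))"
  proof (rule Vitali_covering_theorem_cballs[of K snd S fst])
    fix x and d :: real assume "x \<in> S" "0 < d"
    then obtain e where e: "e > 0" "cball x e \<subseteq> S" using S open_contains_cball by blast
    then have "(x, min e (d / 2)) \<in> K" "x \<in> cball x (min e (d / 2))" "min e (d / 2) < d"
      using \<open>0 < d\<close> by (auto simp: K_def)
    then show "\<exists>i. i \<in> K \<and> x \<in> cball (fst i) (snd i) \<and> snd i < d"
      by (intro exI[of _ "(x, min e (d / 2))"]) auto
  next
    fix i assume "i \<in> K"
    then show "0 < snd i" by (auto simp: K_def)
  qed (rule that)
  \<comment> \<open>Countable additivity is used for families indexed by the naturals; unused indices get the empty set.\<close>
  define A where "A n = (if n \<in> to_nat_on C ` C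
    then cball (fst (from_nat_into C n)) (snd (from_nat_into C n)) else {})" for n
  have inj: "inj_on (to_nat_on C) C" using C(1) by (rule inj_on_to_nat_on)
  have mem: "from_nat_into C n \<in> C" "to_nat_on C (from_nat_into C n) = n" if "n \<in> to_nat_on C ` C" for n
    using that C(1) by auto
  have "(\<Union>n. A n) = (\<Union>n\<in>to_nat_on C ` C. cball (fst (from_nat_into C n)) (snd (from_nat_into C n)))"
    by (auto simp: A_def split: if_splits)
  also have "\<dots> = (\<Union>i\<in>C. cball (fst i) (snd i))"
    using C(1) by simp
  finally have U: "(\<Union>n. A n) = (\<Union>i\<in>C. cball (fst i) (snd i))" .
  have disj: "A m \<inter> A n = {}" if "m \<noteq> n" for m n
  proof (cases "m \<in> to_nat_on C ` C \<and> n \<in> to_nat_on C ` C")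
    case True
    then have "from_nat_into C m \<noteq> from_nat_into C n" using mem(2) that by metis
    then show ?thesis
      using True pairwiseD[OF C(3)] mem(1) unfolding A_def disjnt_def by simp
  qed (auto simp: A_def)
  have meas: "A n \<in> sets lborel" for n by (simp add: A_def)
  have Uset: "(\<Union>n. A n) \<in> sets lborel" using meas by blast
  have "(LINT x:S|lborel. F x) = (LINT x:(\<Union>n. A n)|lborel. F x)"
  proof (rule set_integral_cong_set)
    have "S - (\<Union>n. A n) \<in> null_sets lebesgue"
      using C(4) U by (simp add: negligible_iff_null_sets)
    then have "AE x in lebesgue. x \<notin> S - (\<Union>n. A n)" by (rule AE_not_in)
    then have "AE x in lborel. x \<notin> S - (\<Union>n. A n)" by (simp add: AE_completion_iff)
    moreover have "cball (fst i) (snd i) \<subseteq> S" if "i \<in> C" for i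
      using subsetD[OF C(2) that] by (auto simp: K_def)
    then have "(\<Union>n. A n) \<subseteq> S" unfolding U by blast
    ultimately show "AE x in lborel. (x \<in> (\<Union>n. A n)) = (x \<in> S)"
      by (auto elim: eventually_mono)
  qed (use F S Uset in \<open>auto simp: set_borel_measurable_def\<close>)
  also have "\<dots> = (\<Sum>n. (LINT x:A n|lborel. F x))"
    using F Uset by (intro lebesgue_integral_countable_add meas disj)
      (auto simp: set_integrable_def intro!: integrable_mult_indicator)
  finally have sum: "(LINT x:S|lborel. F x) = (\<Sum>n. (LINT x:A n|lborel. F x))" .
  have "(LINT x:A n|lborel. F x) = 0" for n
  proof (cases "n \<in> to_nat_on C ` C")
    case True
    then have "from_nat_into C n \<in> K" using mem C(2) by blast
    then show ?thesis using True z by (auto simp: A_def K_def split: prod.splits)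
  qed (simp add: A_def set_lebesgue_integral_def)
  then show ?thesis using sum by simp
qed

text \<open>Almost every value of \<open>F\<close> is the limit of the averages of \<open>F\<close> over squares with a corner at that point. These averages vanish,
  since squares are open sets up to null sets.\<close>

lemma AE_eq_0_if_discs_integrable:
  fixes F :: "plane \<Rightarrow> 'b::euclidean_space"
  assumes F: "integrable lborel F" and S: "open S"
    and z: "\<And>z r. r > 0 \<Longrightarrow> cball z r \<subseteq> S \<Longrightarrow> (LINT x:cball z r|lborel. F x) = 0"
  shows "AE x in lborel. x \<in> S \<longrightarrow> F x = 0"
proof -
  have si: "set_integrable lborel A F" if "A \<in> sets borel" for A
    using F that by (auto simp: set_integrable_def intro!: integrable_mult_indicator)
  have box: "integral (cbox a b) F = 0" if "cbox a b \<subseteq> S" for a b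
  proof -
    have "integral (cbox a b) F = (LINT x:cbox a b|lborel. F x)"
      using si by (simp add: set_borel_integral_eq_integral)
    also have "\<dots> = (LINT x:box a b|lborel. F x)"
    proof (rule set_integral_cong_set)
      have "cbox a b - box a b \<in> null_sets lebesgue"
        using negligible_frontier_interval[of a b] by (simp add: negligible_iff_null_sets)
      then have "AE x in lebesgue. x \<notin> cbox a b - box a b" by (rule AE_not_in)
      then have "AE x in lborel. x \<notin> cbox a b - box a b" by (simp add: AE_completion_iff)
      then show "AE x in lborel. (x \<in> box a b) = (x \<in> cbox a b)"
        using box_subset_cbox[of a b] by (auto elim!: eventually_mono)
    qed (use F in \<open>auto simp: set_borel_measurable_def\<close>)
    also have "\<dots> = 0"
    proof (rule integral_open_eq_0_if_discs[OF F open_box])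
      fix z r assume "0 < (r::real)" "cball z r \<subseteq> box a b"
      then show "(LINT x:cball z r|lborel. F x) = 0"
        using z[of r z] box_subset_cbox[of a b] \<open>cbox a b \<subseteq> S\<close> by blast
    qed
    finally show ?thesis .
  qed
  have "F integrable_on cbox a b" for a b
    using integrable_on_lborel[OF F] integrable_on_subcbox by blast
  from integrable_ccontinuous_explicit[OF this] obtain N where N: "negligible N"
    "\<And>x e. \<lbrakk>x \<notin> N; 0 < e\<rbrakk> \<Longrightarrow> \<exists>d>0. \<forall>h. 0 < h \<and> h < d \<longrightarrow>
        norm (integral (cbox x (x + h *\<^sub>R One)) F /\<^sub>R h ^ DIM(plane) - F x) < e"
    by blast
  have "F x = 0" if x: "x \<in> S" "x \<notin> N" for x
  proof (rule ccontr)
    assume "F x \<noteq> 0"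
    then obtain d where d: "d > 0" "\<And>h. 0 < h \<Longrightarrow> h < d \<Longrightarrow>
        norm (integral (cbox x (x + h *\<^sub>R One)) F /\<^sub>R h ^ DIM(plane) - F x) < norm (F x)"
      using N(2)[OF x(2), of "norm (F x)"] by auto
    obtain e where e: "e > 0" "ball x e \<subseteq> S" using S x(1) openE by blast
    define h where "h = min (d / 2) (e / (2 * norm (One::plane)))"
    have nO: "norm (One::plane) > 0" by (simp add: One_non_0)
    have h: "0 < h" "h < d" "h * norm (One::plane) < e"
      using d(1) e(1) nO by (auto simp: h_def min_def field_simps)
    have "cbox x (x + h *\<^sub>R One) \<subseteq> S"
    proof
      fix y assume y: "y \<in> cbox x (x + h *\<^sub>R One)"
      have "norm (y - x) \<le> norm (h *\<^sub>R (One::plane))"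
      proof (rule norm_le_componentwise)
        fix b :: plane assume b: "b \<in> Basis"
        show "\<bar>(y - x) \<bullet> b\<bar> \<le> \<bar>(h *\<^sub>R One) \<bullet> b\<bar>"
          using y b h(1) by (auto simp: mem_box inner_diff_left inner_add_left dest!: bspec)
      qed
      then have "dist x y < e" using h by (simp add: dist_norm norm_minus_commute)
      then show "y \<in> S" using e(2) by auto
    qed
    then show False using d(2)[OF h(1,2)] box by simp
  qed
  then have "AE x in lebesgue. x \<in> S \<longrightarrow> F x = 0"
    using N(1) AE_not_in[of N lebesgue] by (auto simp: negligible_iff_null_sets elim!: eventually_mono)
  then show ?thesis by (simp add: AE_completion_iff)
qed

text \<open>A locally integrable function is integrable on every closed disc in its domain; countably many open discs with
  closure in \<open>\<Omega>\<close> cover \<open>\<Omega>\<close>.\<close>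

lemma AE_eq_0_if_discs:
  fixes f :: "plane \<Rightarrow> 'b::euclidean_space"
  assumes f: "locally_integrable \<Omega> f" and \<Omega>: "open \<Omega>"
    and z: "\<And>z r. r > 0 \<Longrightarrow> cball z r \<subseteq> \<Omega> \<Longrightarrow> (LINT x:cball z r|lborel. f x) = 0"
  shows "AE x in lborel. x \<in> \<Omega> \<longrightarrow> f x = 0"
proof -
  define \<F> where "\<F> = {ball z r | z r. 0 < r \<and> cball z r \<subseteq> \<Omega>}"
  have "\<Union>\<F> = \<Omega>"
  proof
    show "\<Omega> \<subseteq> \<Union>\<F>"
    proof
      fix x assume "x \<in> \<Omega>"
      then obtain e where "e > 0" "cball x e \<subseteq> \<Omega>" using \<Omega> open_contains_cball by blast
      then show "x \<in> \<Union>\<F>" unfolding \<F>_def by (intro UnionI[of "ball x e"]) auto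
    qed
  qed (auto simp: \<F>_def)
  moreover have "\<And>S. S \<in> \<F> \<Longrightarrow> open S" by (auto simp: \<F>_def)
  ultimately obtain \<F>' where F': "\<F>' \<subseteq> \<F>" "countable \<F>'" "\<Union>\<F>' = \<Omega>"
    using Lindelof by metis
  have "AE x in lborel. x \<in> S \<longrightarrow> f x = 0" if S: "S \<in> \<F>'" for S
  proof -
    obtain w \<rho> where w: "S = ball w \<rho>" "0 < \<rho>" "cball w \<rho> \<subseteq> \<Omega>"
      using S F'(1) by (auto simp: \<F>_def)
    define F where "F x = indicat_real (cball w \<rho>) x *\<^sub>R f x" for x
    have F: "integrable lborel F"
      using f w(3) unfolding locally_integrable_def set_integrable_def F_def[abs_def] by simp
    have "AE x in lborel. x \<in> S \<longrightarrow> F x = 0"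
    proof (rule AE_eq_0_if_discs_integrable[OF F])
      fix z r assume zr: "0 < (r::real)" "cball z r \<subseteq> S"
      then have sub: "cball z r \<subseteq> cball w \<rho>" using w(1) ball_subset_cball by blast
      have "(LINT x:cball z r|lborel. F x) = (LINT x:cball z r|lborel. f x)"
        unfolding set_lebesgue_integral_def
        by (intro Bochner_Integration.integral_cong) (use sub in \<open>auto simp: F_def indicator_def\<close>)
      then show "(LINT x:cball z r|lborel. F x) = 0"
        using z[OF zr(1)] sub w(3) by (metis subset_trans)
    qed (simp add: w)
    then show ?thesis by eventually_elim (use w in \<open>auto simp: F_def\<close>)
  qed
  then have "AE x in lborel. \<forall>S\<in>\<F>'. x \<in> S \<longrightarrow> f x = 0"
    by (intro iffD2[OF AE_ball_countable[OF F'(2)]] ballI)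
  then show ?thesis using F'(3) by (auto elim!: eventually_mono)
qed

section \<open>Bump functions and the fundamental lemma of the calculus of variations\<close>

text \<open>A compact disc has positive distance from the complement of an open set containing it.\<close>

lemma cball_dilation_subset_open:
  assumes "open \<Omega>" "cball z r \<subseteq> \<Omega>" "0 < (r::real)"
  obtains c where "1 < c" "cball z (r * c) \<subseteq> (\<Omega> :: plane set)"
proof (cases "\<Omega> = UNIV")
  case True
  then show thesis using that[of 2] by auto
next
  case False
  then have ne: "- \<Omega> \<noteq> {}" by blast
  have "setdist (cball z r) (- \<Omega>) > 0"
    using assms ne by (subst setdist_gt_0_compact_closed) (auto simp: closed_Compl)
  then obtain d where d: "0 < d" "d < setdist (cball z r) (- \<Omega>)" using dense by blast
  show thesis
  proof (rule that[of "1 + d / r"])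
    show "cball z (r * (1 + d / r)) \<subseteq> \<Omega>"
    proof (rule ccontr)
      assume "\<not> ?thesis"
      moreover have "r * (1 + d / r) = r + d" using assms(3) by (simp add: field_simps)
      ultimately obtain y where y: "dist z y \<le> r + d" "y \<notin> \<Omega>" by (metis mem_cball subsetI)
      then have yz: "dist z y > r" using assms(2) by (metis mem_cball not_less subsetD)
      define x where "x = z + (r / dist z y) *\<^sub>R (y - z)"
      have "0 < dist z y" using yz assms(3) by linarith
      then have "y \<noteq> z" by auto
      then have "dist z x = r" using yz assms(3) by (simp add: x_def dist_norm norm_minus_commute)
      moreover have "dist x y = dist z y - r"
      proof -
        have "y - x = (1 - r / dist z y) *\<^sub>R (y - z)" by (simp add: x_def algebra_simps)
        then have "dist x y = \<bar>1 - r / dist z y\<bar> * dist z y"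
          by (metis dist_commute dist_norm norm_scaleR)
        moreover have "\<bar>1 - r / dist z y\<bar> = 1 - r / dist z y"
          using yz \<open>0 < dist z y\<close> by simp
        moreover have "(1 - r / dist z y) * dist z y = dist z y - r"
          using \<open>0 < dist z y\<close> by (simp add: left_diff_distrib del: zero_less_dist_iff)
        ultimately show ?thesis by simp
      qed
      ultimately have "setdist (cball z r) (- \<Omega>) \<le> dist z y - r"
        using y setdist_le_dist[of x "cball z r" y "- \<Omega>"] by auto
      then show False using d y by linarith
    qed
  qed (use d assms in auto)
qed

text \<open>The squared distance \<open>s\<close> to the centre, in units of the radius, is polynomial, so \<open>step (1 - n (s - 1))\<close> is smooth; it
  equals one on the disc and vanishes where \<open>s \<ge> 1 + 1 / n\<close>.\<close>

lemma bump_functions: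
  assumes "open \<Omega>" "cball z r \<subseteq> \<Omega>" "0 < r"
  obtains \<phi> where "\<And>n::nat. test_fun \<Omega> (\<phi> n)" "\<And>n x. \<bar>\<phi> n x\<bar> \<le> 1"
    "\<And>x. (\<lambda>n. \<phi> n x) \<longlonglongrightarrow> indicator (cball z r) x"
    "\<exists>K. compact K \<and> K \<subseteq> \<Omega> \<and> (\<forall>n x. x \<notin> K \<longrightarrow> \<phi> n x = 0)"
proof -
  obtain c where c: "1 < c" "cball z (r * c) \<subseteq> \<Omega>"
    by (rule cball_dilation_subset_open[OF assms])
  \<comment> \<open>With slope at least \<open>N\<close> all the bump functions vanish outside of the disc of radius \<open>r c\<close>.\<close>
  define N where "N = 1 / (c\<^sup>2 - 1)"
  have cc: "c\<^sup>2 > 1" using c by (simp add: one_less_power)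
  have N: "N > 0" using cc by (simp add: N_def)
  define s where "s x = (norm (x - z))\<^sup>2 / r\<^sup>2" for x
  define \<phi> where "\<phi> n x = step (1 - (N + real n) * (s x - 1))" for n x
  have out: "\<phi> n x = 0" if "x \<notin> cball z (r * c)" for n x
  proof -
    have "r * c < norm (x - z)" using that by (simp add: dist_norm norm_minus_commute)
    then have "(r * c)\<^sup>2 < (norm (x - z))\<^sup>2"
      using assms c by (intro power_strict_mono) auto
    then have sc: "c\<^sup>2 < s x" using assms by (simp add: s_def field_simps power_mult_distrib)
    have "1 = N * (c\<^sup>2 - 1)" using cc by (simp add: N_def)
    also have "\<dots> \<le> (N + real n) * (s x - 1)"
      using N sc cc by (intro mult_mono) auto
    finally show ?thesis by (simp add: \<phi>_def)
  qed
  have t: "test_fun \<Omega> (\<phi> n)" for n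
  proof (rule test_funI[OF _ compact_cball c(2) out])
    have "Ck k (\<lambda>x. 1 - (N + real n) * ((1 / r\<^sup>2) * (norm (x - z))\<^sup>2 - 1))" for k
      by (intro Ck_diff Ck_const Ck_cmult Ck_norm_power2)
    then show "Ck k (\<phi> n)" for k
      unfolding \<phi>_def[abs_def] s_def by (intro Ck_step) simp
  qed
  have lim: "(\<lambda>n. \<phi> n x) \<longlonglongrightarrow> indicator (cball z r) x" for x
  proof (cases "x \<in> cball z r")
    case True
    then have "(norm (x - z))\<^sup>2 \<le> r\<^sup>2"
      using assms by (intro power_mono) (auto simp: dist_norm norm_minus_commute)
    then have "s x \<le> 1" using assms by (simp add: s_def)
    then have "(N + real n) * (s x - 1) \<le> 0" for n
      using N by (intro mult_nonneg_nonpos) auto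
    then show ?thesis using True by (simp add: \<phi>_def)
  next
    case False
    then have "r\<^sup>2 < (norm (x - z))\<^sup>2"
      using assms by (intro power_strict_mono) (auto simp: dist_norm norm_minus_commute)
    then have s: "1 < s x" using assms by (simp add: s_def)
    obtain m :: nat where m: "1 / (s x - 1) < real m" using reals_Archimedean2 by blast
    have "\<phi> n x = 0" if "m \<le> n" for n
    proof -
      have "1 / (s x - 1) \<le> N + real n" using m that N by linarith
      then have "1 \<le> (N + real n) * (s x - 1)" using s by (simp add: field_simps)
      then show ?thesis by (simp add: \<phi>_def)
    qed
    then have "eventually (\<lambda>n. \<phi> n x = 0) sequentially" by (auto simp: eventually_sequentially)
    then show ?thesis using False by (simp add: tendsto_eventually)
  qed
  have "\<bar>\<phi> n x\<bar> \<le> 1" for n x using step_bounds by (simp add: \<phi>_def abs_le_iff minus_le_iff order_trans[of _ 0])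
  moreover have "\<exists>K. compact K \<and> K \<subseteq> \<Omega> \<and> (\<forall>n x. x \<notin> K \<longrightarrow> \<phi> n x = 0)"
    using out c(2) by (intro exI[of _ "cball z (r * c)"]) auto
  ultimately show thesis
    using t lim by (intro that[of \<phi>])
qed

text \<open>Inserting the bump functions of a disc and passing to the limit shows that the integral of \<open>f\<close> over the disc is zero.\<close>

lemma fundamental_lemma:
  fixes f :: "plane \<Rightarrow> 'b::euclidean_space"
  assumes f: "locally_integrable \<Omega> f" and \<Omega>: "open \<Omega>"
    and z: "\<And>\<phi>. test_fun \<Omega> \<phi> \<Longrightarrow> (LINT x:\<Omega>|lborel. \<phi> x *\<^sub>R f x) = 0"
  shows "AE x in lborel. x \<in> \<Omega> \<longrightarrow> f x = 0"
proof (rule AE_eq_0_if_discs[OF f \<Omega>])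
  fix z and r :: real assume r: "0 < r" "cball z r \<subseteq> \<Omega>"
  obtain \<phi> where \<phi>: "\<And>n::nat. test_fun \<Omega> (\<phi> n)" "\<And>n x. \<bar>\<phi> n x\<bar> \<le> 1"
    "\<And>x. (\<lambda>n. \<phi> n x) \<longlonglongrightarrow> indicator (cball z r) x"
    "\<exists>K. compact K \<and> K \<subseteq> \<Omega> \<and> (\<forall>n x. x \<notin> K \<longrightarrow> \<phi> n x = 0)"
    by (rule bump_functions[OF \<Omega> r(2,1)]) (rule that; assumption)
  then obtain K where K: "compact K" "K \<subseteq> \<Omega>" "\<And>n x. x \<notin> K \<Longrightarrow> \<phi> n x = 0" by blast
  have fK: "integrable lborel (\<lambda>x. indicat_real K x *\<^sub>R f x)"
    using f K unfolding locally_integrable_def set_integrable_def by blast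
  have eq: "(LINT x:\<Omega>|lborel. \<phi> n x *\<^sub>R f x) = (\<integral>x. \<phi> n x *\<^sub>R (indicat_real K x *\<^sub>R f x) \<partial>lborel)" for n
    unfolding set_lebesgue_integral_def
    by (intro Bochner_Integration.integral_cong) (use K in \<open>auto simp: indicator_def\<close>)
  have sub: "cball z r \<subseteq> K"
  proof
    fix x assume "x \<in> cball z r"
    then have "(\<lambda>n. \<phi> n x) \<longlonglongrightarrow> 1" using \<phi>(3)[of x] by simp
    then show "x \<in> K" using K(3)[of x] LIMSEQ_unique[of "\<lambda>n. \<phi> n x" 0 1] by fastforce
  qed
  have "(\<lambda>n. \<integral>x. \<phi> n x *\<^sub>R (indicat_real K x *\<^sub>R f x) \<partial>lborel) \<longlonglongrightarrow>
        (\<integral>x. indicat_real (cball z r) x *\<^sub>R (indicat_real K x *\<^sub>R f x) \<partial>lborel)"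
  proof (rule integral_dominated_convergence[where w="\<lambda>x. norm (indicat_real K x *\<^sub>R f x)"])
    show "AE x in lborel. (\<lambda>n. \<phi> n x *\<^sub>R indicat_real K x *\<^sub>R f x) \<longlonglongrightarrow>
        indicat_real (cball z r) x *\<^sub>R indicat_real K x *\<^sub>R f x"
      using \<phi>(3) by (intro AE_I2 tendsto_scaleR tendsto_const)
    show "AE x in lborel. norm (\<phi> n x *\<^sub>R indicat_real K x *\<^sub>R f x) \<le> norm (indicat_real K x *\<^sub>R f x)" for n
      by (intro AE_I2, subst norm_scaleR, intro mult_left_le_one_le norm_ge_zero abs_ge_zero \<phi>(2))
    show "(\<lambda>x. \<phi> n x *\<^sub>R indicat_real K x *\<^sub>R f x) \<in> borel_measurable lborel" for n
      by (rule borel_measurable_scaleR[OF _ borel_measurable_integrable[OF fK]])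
         (simp add: borel_measurable_continuous_onI[OF test_fun_continuous[OF \<phi>(1)]])
    show "(\<lambda>x. indicat_real (cball z r) x *\<^sub>R indicat_real K x *\<^sub>R f x) \<in> borel_measurable lborel"
      by (rule borel_measurable_scaleR[OF _ borel_measurable_integrable[OF fK]])
         (rule borel_measurable_indicator, simp)
  qed (rule integrable_norm[OF fK])
  moreover have "(\<integral>x. \<phi> n x *\<^sub>R (indicat_real K x *\<^sub>R f x) \<partial>lborel) = 0" for n
    using z[OF \<phi>(1)[of n]] unfolding eq .
  ultimately have "(\<integral>x. indicat_real (cball z r) x *\<^sub>R (indicat_real K x *\<^sub>R f x) \<partial>lborel) = 0"
    by (simp add: LIMSEQ_const_iff)
  moreover have "(\<lambda>x. indicat_real (cball z r) x *\<^sub>R (indicat_real K x *\<^sub>R f x)) = (\<lambda>x. indicat_real (cball z r) x *\<^sub>R f x)"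
    using sub by (auto simp: indicator_def fun_eq_iff)
  ultimately show "(LINT x:cball z r|lborel. f x) = 0"
    by (simp add: set_lebesgue_integral_def)
qed

section \<open>Weak gradients\<close>

lemma test_fun_mult_integrable:
  assumes f: "locally_integrable \<Omega> f" and t: "test_fun \<Omega> \<phi>"
  shows "integrable lborel (\<lambda>x. indicat_real \<Omega> x *\<^sub>R (\<phi> x *\<^sub>R f x))"
proof -
  obtain K where K: "compact K" "K \<subseteq> \<Omega>" "\<And>x. x \<notin> K \<Longrightarrow> \<phi> x = 0"
    using test_fun_supportE[OF t] by metis
  have "bounded (\<phi> ` K)"
    using K test_fun_continuous[OF t]
    by (meson compact_continuous_image compact_imp_bounded continuous_on_subset subset_UNIV)
  then obtain M where M: "M > 0" "\<And>x. x \<in> K \<Longrightarrow> norm (\<phi> x) \<le> M" by (auto simp: bounded_pos)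
  have bd: "norm (\<phi> x) \<le> M" for x using M K(3)[of x] by (cases "x \<in> K") auto
  have fK: "integrable lborel (\<lambda>x. indicat_real K x *\<^sub>R f x)"
    using f K unfolding locally_integrable_def set_integrable_def by blast
  have "integrable lborel (\<lambda>x. \<phi> x *\<^sub>R (indicat_real K x *\<^sub>R f x))"
  proof (rule Bochner_Integration.integrable_bound)
    show "integrable lborel (\<lambda>x. M * norm (indicat_real K x *\<^sub>R f x))"
      by (intro integrable_mult_right integrable_norm fK)
    show "(\<lambda>x. \<phi> x *\<^sub>R (indicat_real K x *\<^sub>R f x)) \<in> borel_measurable lborel"
      by (rule borel_measurable_scaleR[OF _ borel_measurable_integrable[OF fK]])
         (simp add: borel_measurable_continuous_onI[OF test_fun_continuous[OF t]])
    show "AE x in lborel. norm (\<phi> x *\<^sub>R (indicat_real K x *\<^sub>R f x)) \<le> norm (M * norm (indicat_real K x *\<^sub>R f x))"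
    proof (rule AE_I2)
      fix x
      have "norm (\<phi> x *\<^sub>R (indicat_real K x *\<^sub>R f x)) = norm (\<phi> x) * norm (indicat_real K x *\<^sub>R f x)"
        by (subst norm_scaleR) simp
      also have "\<dots> \<le> M * norm (indicat_real K x *\<^sub>R f x)"
        using bd by (intro mult_right_mono) auto
      also have "\<dots> = norm (M * norm (indicat_real K x *\<^sub>R f x))"
        using M(1) by (simp add: abs_mult)
      finally show "norm (\<phi> x *\<^sub>R (indicat_real K x *\<^sub>R f x)) \<le> norm (M * norm (indicat_real K x *\<^sub>R f x))" .
    qed
  qed
  moreover have "(\<lambda>x. \<phi> x *\<^sub>R (indicat_real K x *\<^sub>R f x)) = (\<lambda>x. indicat_real \<Omega> x *\<^sub>R (\<phi> x *\<^sub>R f x))"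
    using K(2,3) by (auto simp: indicator_def fun_eq_iff)
  ultimately show ?thesis by simp
qed

lemma integrable_vector_iff:
  fixes f :: "'a \<Rightarrow> plane"
  shows "integrable M f \<longleftrightarrow> (\<forall>i. integrable M (\<lambda>x. f x $ i))"
proof
  assume "integrable M f"
  then show "\<forall>i. integrable M (\<lambda>x. f x $ i)"
    using integrable_bounded_linear[OF bounded_linear_vec_nth] by blast
next
  assume "\<forall>i. integrable M (\<lambda>x. f x $ i)"
  then have "integrable M (\<lambda>x. f x $ 1 *\<^sub>R axis 1 1 + f x $ 2 *\<^sub>R axis 2 1 :: plane)"
    by (intro Bochner_Integration.integrable_add integrable_scaleR_left) auto
  moreover have "y $ 1 *\<^sub>R axis 1 1 + y $ 2 *\<^sub>R axis 2 1 = y" for y :: plane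
    by (simp add: vec_eq_iff forall_2 axis_def)
  ultimately show "integrable M f" by simp
qed

lemma mult_grad_integrable:
  assumes f: "locally_integrable \<Omega> u" and t: "test_fun \<Omega> \<phi>"
  shows "integrable lborel (\<lambda>x. indicat_real \<Omega> x *\<^sub>R (u x *\<^sub>R grad \<phi> x))"
  unfolding integrable_vector_iff
proof
  fix i
  have "integrable lborel (\<lambda>x. indicat_real \<Omega> x *\<^sub>R (grad \<phi> x $ i *\<^sub>R u x))"
    by (rule test_fun_mult_integrable[OF f test_fun_partial[OF t]])
  then show "integrable lborel (\<lambda>x. (indicat_real \<Omega> x *\<^sub>R (u x *\<^sub>R grad \<phi> x)) $ i)"
    by (simp add: mult_ac)
qed

lemma locally_integrable_diff:
  "locally_integrable \<Omega> f \<Longrightarrow> locally_integrable \<Omega> g \<Longrightarrow> locally_integrable \<Omega> (\<lambda>x. f x - g x)"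
  unfolding locally_integrable_def by (auto intro: set_integral_diff)

lemma integral_grad_test: 
  assumes "test_fun \<Omega> \<phi>" shows "integral\<^sup>L lborel (grad \<phi>) = 0"
proof -
  obtain K where K: "compact K" "\<And>x. x \<notin> K \<Longrightarrow> \<phi> x = 0" "\<And>x. x \<notin> K \<Longrightarrow> grad \<phi> x = 0"
    using test_fun_supportE[OF assms] by metis
  show ?thesis
    by (rule integral_gradient_zero[OF test_fun_GDERIV[OF assms] continuous_grad[OF assms] K])
qed

lemma set_integral_grad_test_fun:
  assumes "test_fun \<Omega> \<phi>"
  shows "(LINT x:\<Omega>|lborel. c *\<^sub>R grad \<phi> x) = 0"
proof -
  obtain K where K: "K \<subseteq> \<Omega>" "\<And>x. x \<notin> K \<Longrightarrow> grad \<phi> x = 0"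
    using test_fun_supportE[OF assms] by metis
  have "(LINT x:\<Omega>|lborel. c *\<^sub>R grad \<phi> x) = (\<integral>x. c *\<^sub>R grad \<phi> x \<partial>lborel)"
    unfolding set_lebesgue_integral_def
    by (intro Bochner_Integration.integral_cong) (use K in \<open>auto simp: indicator_def\<close>)
  then show ?thesis by (simp add: integral_grad_test[OF assms])
qed

lemma has_weak_grad_diff:
  assumes u: "has_weak_grad \<Omega> u g" and v: "has_weak_grad \<Omega> v h"
  shows "has_weak_grad \<Omega> (\<lambda>x. u x - v x) (\<lambda>x. g x - h x)"
  unfolding has_weak_grad_def
proof (intro conjI allI impI)
  note l = u[unfolded has_weak_grad_def] v[unfolded has_weak_grad_def]
  show "locally_integrable \<Omega> (\<lambda>x. u x - v x)" "locally_integrable \<Omega> (\<lambda>x. g x - h x)"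
    using l by (auto intro!: locally_integrable_diff)
  fix \<phi> assume t: "test_fun \<Omega> \<phi>"
  have lu: "locally_integrable \<Omega> u" "locally_integrable \<Omega> v" "locally_integrable \<Omega> g" "locally_integrable \<Omega> h"
    using l by auto
  have 1: "(LINT x:\<Omega>|lborel. (u x - v x) *\<^sub>R grad \<phi> x)
      = (LINT x:\<Omega>|lborel. u x *\<^sub>R grad \<phi> x) - (LINT x:\<Omega>|lborel. v x *\<^sub>R grad \<phi> x)"
    using mult_grad_integrable[OF lu(1) t] mult_grad_integrable[OF lu(2) t]
    unfolding scaleR_diff_left by (intro set_integral_diff) (simp_all add: set_integrable_def)
  have 2: "(LINT x:\<Omega>|lborel. \<phi> x *\<^sub>R (g x - h x))
      = (LINT x:\<Omega>|lborel. \<phi> x *\<^sub>R g x) - (LINT x:\<Omega>|lborel. \<phi> x *\<^sub>R h x)"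
    using test_fun_mult_integrable[OF lu(3) t] test_fun_mult_integrable[OF lu(4) t]
    unfolding scaleR_diff_right by (intro set_integral_diff) (simp_all add: set_integrable_def)
  show "(LINT x:\<Omega>|lborel. (u x - v x) *\<^sub>R grad \<phi> x) = - (LINT x:\<Omega>|lborel. \<phi> x *\<^sub>R (g x - h x))"
    unfolding 1 2 using l t by simp
qed

text \<open>Allowing \<open>u\<close> and \<open>v\<close> to differ by a constant covers the classes modulo constants as well.\<close>

lemma has_weak_grad_unique:
  assumes u: "has_weak_grad \<Omega> u g" and v: "has_weak_grad \<Omega> v h" and \<Omega>: "open \<Omega>"
    and ae: "AE x in lborel. x \<in> \<Omega> \<longrightarrow> u x - v x = c"
  shows "AE x in lborel. x \<in> \<Omega> \<longrightarrow> g x = h x"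
proof -
  have d: "has_weak_grad \<Omega> (\<lambda>x. u x - v x) (\<lambda>x. g x - h x)" by (rule has_weak_grad_diff[OF u v])
  have "AE x in lborel. x \<in> \<Omega> \<longrightarrow> g x - h x = 0"
  proof (rule fundamental_lemma[OF _ \<Omega>])
    show "locally_integrable \<Omega> (\<lambda>x. g x - h x)" using d by (simp add: has_weak_grad_def)
    fix \<phi> assume t: "test_fun \<Omega> \<phi>"
    have lu: "locally_integrable \<Omega> (\<lambda>x. u x - v x)" using d by (simp add: has_weak_grad_def)
    have "(LINT x:\<Omega>|lborel. (u x - v x) *\<^sub>R grad \<phi> x) = (LINT x:\<Omega>|lborel. c *\<^sub>R grad \<phi> x)"
      unfolding set_lebesgue_integral_def
    proof (rule integral_cong_AE)
      show "(\<lambda>x. indicat_real \<Omega> x *\<^sub>R (u x - v x) *\<^sub>R grad \<phi> x) \<in> borel_measurable lborel"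
        by (rule borel_measurable_integrable[OF mult_grad_integrable[OF lu t]])
      have "grad \<phi> \<in> borel_measurable lborel"
        using borel_measurable_continuous_onI[OF continuous_grad[OF t]] by simp
      moreover have "\<Omega> \<in> sets lborel" using \<Omega> by simp
      ultimately show "(\<lambda>x. indicat_real \<Omega> x *\<^sub>R c *\<^sub>R grad \<phi> x) \<in> borel_measurable lborel"
        by measurable
      show "AE x in lborel. indicat_real \<Omega> x *\<^sub>R (u x - v x) *\<^sub>R grad \<phi> x = indicat_real \<Omega> x *\<^sub>R c *\<^sub>R grad \<phi> x"
        using ae by eventually_elim (auto simp: indicator_def)
    qed
    also have "\<dots> = 0" by (rule set_integral_grad_test_fun[OF t])
    finally show "(LINT x:\<Omega>|lborel. \<phi> x *\<^sub>R (g x - h x)) = 0"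
      using d t by (simp add: has_weak_grad_def)
  qed
  then show ?thesis by eventually_elim simp
qed

text \<open>For a test function \<open>\<phi>\<close> the product \<open>v \<phi>\<close>, extended by zero, is continuously differentiable with compact support on
  the whole plane, and the integral of its gradient is zero.\<close>

lemma has_weak_grad_C1:
  assumes B: "open B" and v: "\<And>x. x \<in> B \<Longrightarrow> GDERIV v x :> g x" and g: "continuous_on B g"
  shows "has_weak_grad B v g"
  unfolding has_weak_grad_def
proof (intro conjI allI impI)
  have vc: "continuous_on B v"
    using v unfolding gderiv_def by (meson continuous_at_imp_continuous_on has_derivative_continuous)
  show lv: "locally_integrable B v" and lg: "locally_integrable B g"
    unfolding locally_integrable_def set_integrable_def
    by (intro allI impI borel_integrable_compact, simp, meson vc g continuous_on_subset)+
  fix \<phi> assume t: "test_fun B \<phi>"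
  obtain K where K: "compact K" "K \<subseteq> B" "\<And>x. x \<notin> K \<Longrightarrow> \<phi> x = 0" "\<And>x. x \<notin> K \<Longrightarrow> grad \<phi> x = 0"
    using test_fun_supportE[OF t] by metis
  have oK: "open (- K)" using K(1) by (simp add: compact_imp_closed open_Compl)
  define h where "h x = (if x \<in> B then v x * \<phi> x else 0)" for x
  define G where "G x = (if x \<in> B then v x *\<^sub>R grad \<phi> x + \<phi> x *\<^sub>R g x else 0)" for x
  have h0: "h x = 0" "G x = 0" if "x \<notin> K" for x using K that by (auto simp: h_def G_def)
  have "integral\<^sup>L lborel G = 0"
  proof (rule integral_gradient_zero[OF _ _ K(1)])
    show "GDERIV h x :> G x" for x
    proof (cases "x \<in> B")
      case True
      have "GDERIV (\<lambda>x. v x * \<phi> x) x :> G x"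
        using GDERIV_mult[OF v[OF True] test_fun_GDERIV[OF t]] True by (simp add: G_def)
      then show ?thesis
        unfolding gderiv_def
        using has_derivative_transform_within_open[of "\<lambda>x. v x * \<phi> x" "\<lambda>k. k \<bullet> G x" x UNIV B h] B True
        by (auto simp: h_def)
    next
      case False
      then have x: "x \<in> - K" using K(2) by blast
      have "((\<lambda>x. 0) has_derivative (\<lambda>k. 0)) (at x)" by simp
      then have "(h has_derivative (\<lambda>k. 0)) (at x)"
        using has_derivative_transform_within_open[of "\<lambda>x. 0" "\<lambda>k. 0" x UNIV "- K" h] oK x h0 by auto
      then show ?thesis using x h0(2)[of x] by (simp add: gderiv_def)
    qed
    have "continuous_on B (\<lambda>x. v x *\<^sub>R grad \<phi> x + \<phi> x *\<^sub>R g x)"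
      using vc g continuous_on_subset[OF test_fun_continuous[OF t], of B]
        continuous_on_subset[OF continuous_grad[OF t], of B]
      by (intro continuous_intros) auto
    then have "continuous_on B G" by (simp add: G_def)
    moreover have "continuous_on (- K) G"
      using h0(2) by (simp cong: continuous_on_cong_simp)
    ultimately have "continuous_on (B \<union> - K) G"
      by (intro continuous_on_open_Un B oK)
    moreover have "B \<union> - K = UNIV" using K(2) by blast
    ultimately show "continuous_on UNIV G" by simp
  qed (use h0 in auto)
  moreover have "integral\<^sup>L lborel G =
      (\<integral>x. indicat_real B x *\<^sub>R (v x *\<^sub>R grad \<phi> x) + indicat_real B x *\<^sub>R (\<phi> x *\<^sub>R g x) \<partial>lborel)"
    by (intro Bochner_Integration.integral_cong) (auto simp: G_def)
  ultimately show "(LINT x:B|lborel. v x *\<^sub>R grad \<phi> x) = - (LINT x:B|lborel. \<phi> x *\<^sub>R g x)"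
    unfolding set_lebesgue_integral_def
    using mult_grad_integrable[OF lv t] test_fun_mult_integrable[OF lg t]
    by (simp add: add_eq_0_iff2)
qed

lemma has_weak_grad_subset:
  assumes u: "has_weak_grad \<Omega> u g" and sub: "B \<subseteq> \<Omega>"
  shows "has_weak_grad B u g"
  unfolding has_weak_grad_def
proof (intro conjI allI impI)
  show "locally_integrable B u" "locally_integrable B g"
    using u sub unfolding has_weak_grad_def locally_integrable_def by blast+
  fix \<phi> assume t: "test_fun B \<phi>"
  obtain K where K: "K \<subseteq> B" "\<And>x. x \<notin> K \<Longrightarrow> \<phi> x = 0" "\<And>x. x \<notin> K \<Longrightarrow> grad \<phi> x = 0"
    using test_fun_supportE[OF t] by metis
  have z: "\<phi> x = 0" "grad \<phi> x = 0" if "x \<notin> B" for x using K that by auto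
  have "(LINT x:B|lborel. u x *\<^sub>R grad \<phi> x) = (LINT x:\<Omega>|lborel. u x *\<^sub>R grad \<phi> x)"
    "(LINT x:B|lborel. \<phi> x *\<^sub>R g x) = (LINT x:\<Omega>|lborel. \<phi> x *\<^sub>R g x)"
    unfolding set_lebesgue_integral_def
    by (intro Bochner_Integration.integral_cong; use z sub in \<open>auto simp: indicator_def\<close>)+
  then show "(LINT x:B|lborel. u x *\<^sub>R grad \<phi> x) = - (LINT x:B|lborel. \<phi> x *\<^sub>R g x)"
    using u test_fun_mono[OF t sub] by (simp add: has_weak_grad_def)
qed

lemma test_fun_has_weak_grad:
  assumes "test_fun \<Omega>' \<phi>" "open \<Omega>"
  shows "has_weak_grad \<Omega> \<phi> (grad \<phi>)"
  by (rule has_weak_grad_C1[OF assms(2) test_fun_GDERIV[OF assms(1)]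
        continuous_on_subset[OF continuous_grad[OF assms(1)] subset_UNIV]])

text \<open>Local integrability only gives measurability on compact subsets. An open set is an increasing union
  of compact sets.\<close>

lemma locally_integrable_measurable:
  fixes f :: "plane \<Rightarrow> 'b::euclidean_space"
  assumes f: "locally_integrable \<Omega> f" and \<Omega>: "open \<Omega>"
  shows "(\<lambda>x. indicat_real \<Omega> x *\<^sub>R f x) \<in> borel_measurable lborel"
proof -
  obtain C where C: "\<And>n. compact (C n)" "\<And>n. C n \<subseteq> \<Omega>" "\<And>n. C n \<subseteq> interior (C (Suc n))" "\<Union>(range C) = \<Omega>"
    using open_Union_compact_subsets[OF \<Omega>] by metis
  have mono: "C m \<subseteq> C n" if "m \<le> n" for m n
    using that by (rule lift_Suc_mono_le[rotated]) (use C(3) interior_subset in blast)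
  show ?thesis
  proof (rule borel_measurable_LIMSEQ_metric)
    show "(\<lambda>x. indicat_real (C n) x *\<^sub>R f x) \<in> borel_measurable lborel" for n
      using f C(1,2)[of n] unfolding locally_integrable_def set_integrable_def
      by (intro borel_measurable_integrable) blast
    show "(\<lambda>n. indicat_real (C n) x *\<^sub>R f x) \<longlonglongrightarrow> indicat_real \<Omega> x *\<^sub>R f x" for x
    proof (cases "x \<in> \<Omega>")
      case True
      then obtain m where "x \<in> C m" using C(4) by blast
      then have "x \<in> C n" if "m \<le> n" for n using mono[OF that] by blast
      then have "eventually (\<lambda>n. indicat_real (C n) x *\<^sub>R f x = indicat_real \<Omega> x *\<^sub>R f x) sequentially"
        using True by (intro eventually_sequentiallyI[of m]) simp
      then show ?thesis by (rule tendsto_eventually)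
    next
      case False
      then have "x \<notin> C n" for n using C(2) by blast
      then show ?thesis using False by simp
    qed
  qed
qed

section \<open>Sobolev functions and their extended gradients\<close>

text \<open>Extension of the weak gradient by zero. All integrals over subsets of \<open>\<Omega>\<close> become integrals over the
  plane, where the gradients of Sobolev functions, test functions and correctors can be combined.\<close>

definition ext_grad :: "plane set \<Rightarrow> (plane \<Rightarrow> real) \<Rightarrow> plane \<Rightarrow> plane" where
  "ext_grad \<Omega> u x = indicat_real \<Omega> x *\<^sub>R wgrad \<Omega> u x"

lemma L2_iff: "f \<in> L2 \<Omega> \<longleftrightarrow> square_integrable (\<lambda>x. indicat_real \<Omega> x *\<^sub>R f x)"
proof -
  have "(\<lambda>x. (norm (indicat_real \<Omega> x *\<^sub>R f x))\<^sup>2) = (\<lambda>x. indicat_real \<Omega> x *\<^sub>R (norm (f x))\<^sup>2)"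
    by (auto simp: indicator_def fun_eq_iff)
  then show ?thesis
    by (simp add: L2_def square_integrable_def set_borel_measurable_def set_integrable_def)
qed

lemma H1_wgrad:
  assumes "u \<in> H1 \<Omega>"
  shows "has_weak_grad \<Omega> u (wgrad \<Omega> u)"
  using assms someI[of "has_weak_grad \<Omega> u"] unfolding H1_def wgrad_def by blast

lemma square_integrable_AE_cong:
  assumes "square_integrable f" "g \<in> borel_measurable lborel" "AE x in lborel. g x = f x"
  shows "square_integrable g"
  by (rule square_integrable_bound[OF assms(1,2), of 1]) (use assms(3) in \<open>auto elim: eventually_mono\<close>)

lemma weak_grad_square_integrable:
  assumes \<Omega>: "open \<Omega>" and g: "has_weak_grad \<Omega> u g" "g \<in> L2 \<Omega>" and h: "has_weak_grad \<Omega> u h"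
  shows "square_integrable (\<lambda>x. indicat_real \<Omega> x *\<^sub>R h x)"
proof (rule square_integrable_AE_cong)
  show "square_integrable (\<lambda>x. indicat_real \<Omega> x *\<^sub>R g x)" using g(2) by (simp add: L2_iff)
  show "(\<lambda>x. indicat_real \<Omega> x *\<^sub>R h x) \<in> borel_measurable lborel"
    using h by (intro locally_integrable_measurable \<Omega>) (simp add: has_weak_grad_def)
  have "AE x in lborel. x \<in> \<Omega> \<longrightarrow> h x = g x"
    by (rule has_weak_grad_unique[OF h g(1) \<Omega>, of 0]) simp
  then show "AE x in lborel. indicat_real \<Omega> x *\<^sub>R h x = indicat_real \<Omega> x *\<^sub>R g x"
    by eventually_elim (auto simp: indicator_def)
qed

lemma ext_grad_square_integrable:
  assumes "open \<Omega>" "u \<in> H1 \<Omega>"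
  shows "square_integrable (ext_grad \<Omega> u)"
proof -
  obtain g where "has_weak_grad \<Omega> u g" "g \<in> L2 \<Omega>" using assms(2) by (auto simp: H1_def)
  then show ?thesis
    using weak_grad_square_integrable[OF assms(1) _ _ H1_wgrad[OF assms(2)]]
    unfolding ext_grad_def[abs_def] by blast
qed

lemma H1_ext_square_integrable: "u \<in> H1 \<Omega> \<Longrightarrow> square_integrable (\<lambda>x. indicat_real \<Omega> x *\<^sub>R u x)"
  by (simp add: H1_def L2_iff)

lemma H1_norm_power2:
  "(H1_norm \<Omega> u)\<^sup>2 = (\<integral>x. (norm (indicat_real \<Omega> x *\<^sub>R u x))\<^sup>2 \<partial>lborel) + (\<integral>x. (norm (ext_grad \<Omega> u x))\<^sup>2 \<partial>lborel)"
proof -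
  have 1: "(LINT x:\<Omega>|lborel. (u x)\<^sup>2) = (\<integral>x. (norm (indicat_real \<Omega> x *\<^sub>R u x))\<^sup>2 \<partial>lborel)"
    unfolding set_lebesgue_integral_def
    by (intro Bochner_Integration.integral_cong) (auto simp: indicator_def)
  have 2: "(LINT x:\<Omega>|lborel. (norm (wgrad \<Omega> u x))\<^sup>2) = (\<integral>x. (norm (ext_grad \<Omega> u x))\<^sup>2 \<partial>lborel)"
    unfolding set_lebesgue_integral_def ext_grad_def
    by (intro Bochner_Integration.integral_cong) (auto simp: indicator_def)
  show ?thesis
    unfolding H1_norm_def 1 2 by (subst real_sqrt_pow2) auto
qed

lemma H1_diff:
  assumes \<Omega>: "open \<Omega>" and u: "u \<in> H1 \<Omega>" and v: "v \<in> H1 \<Omega>"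
  shows "(\<lambda>x. u x - v x) \<in> H1 \<Omega>"
    and "AE x in lborel. ext_grad \<Omega> (\<lambda>x. u x - v x) x = ext_grad \<Omega> u x - ext_grad \<Omega> v x"
proof -
  have wg: "has_weak_grad \<Omega> (\<lambda>x. u x - v x) (\<lambda>x. wgrad \<Omega> u x - wgrad \<Omega> v x)"
    by (intro has_weak_grad_diff H1_wgrad u v)
  have "square_integrable (\<lambda>x. ext_grad \<Omega> u x - ext_grad \<Omega> v x)"
    by (intro square_integrable_diff ext_grad_square_integrable \<Omega> u v)
  then have "(\<lambda>x. wgrad \<Omega> u x - wgrad \<Omega> v x) \<in> L2 \<Omega>"
    by (simp add: L2_iff ext_grad_def scaleR_diff_right)
  moreover have "square_integrable (\<lambda>x. indicat_real \<Omega> x *\<^sub>R u x - indicat_real \<Omega> x *\<^sub>R v x)"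
    by (intro square_integrable_diff H1_ext_square_integrable u v)
  then have "(\<lambda>x. u x - v x) \<in> L2 \<Omega>"
    by (simp add: L2_iff right_diff_distrib)
  ultimately show d: "(\<lambda>x. u x - v x) \<in> H1 \<Omega>"
    using wg by (auto simp: H1_def)
  have "AE x in lborel. x \<in> \<Omega> \<longrightarrow> wgrad \<Omega> (\<lambda>x. u x - v x) x = wgrad \<Omega> u x - wgrad \<Omega> v x"
    by (rule has_weak_grad_unique[OF H1_wgrad[OF d] wg \<Omega>, of 0]) simp
  then show "AE x in lborel. ext_grad \<Omega> (\<lambda>x. u x - v x) x = ext_grad \<Omega> u x - ext_grad \<Omega> v x"
    by eventually_elim (auto simp: ext_grad_def indicator_def)
qed

lemma test_fun_H1:
  assumes \<Omega>: "open \<Omega>" and t: "test_fun \<Omega> \<phi>"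
  shows "\<phi> \<in> H1 \<Omega>" and "AE x in lborel. ext_grad \<Omega> \<phi> x = grad \<phi> x"
proof -
  have wg: "has_weak_grad \<Omega> \<phi> (grad \<phi>)" by (rule test_fun_has_weak_grad[OF t \<Omega>])
  have "\<Omega> \<in> sets borel" using \<Omega> by simp
  then have "\<phi> \<in> L2 \<Omega>" "grad \<phi> \<in> L2 \<Omega>"
    unfolding L2_iff by (intro square_integrable_indicator square_integrable_test_fun[OF t]; simp)+
  then show p: "\<phi> \<in> H1 \<Omega>" using wg by (auto simp: H1_def)
  obtain K where K: "K \<subseteq> \<Omega>" "\<And>x. x \<notin> K \<Longrightarrow> grad \<phi> x = 0"
    using test_fun_supportE[OF t] by metis
  have "AE x in lborel. x \<in> \<Omega> \<longrightarrow> wgrad \<Omega> \<phi> x = grad \<phi> x"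
    by (rule has_weak_grad_unique[OF H1_wgrad[OF p] wg \<Omega>, of 0]) simp
  then show "AE x in lborel. ext_grad \<Omega> \<phi> x = grad \<phi> x"
    by eventually_elim (use K in \<open>auto simp: ext_grad_def indicator_def\<close>)
qed

lemma integral_norm_power2_cong_AE:
  assumes "AE x in lborel. f x = g x" "f \<in> borel_measurable lborel" "g \<in> borel_measurable lborel"
  shows "(\<integral>x. (norm (f x))\<^sup>2 \<partial>lborel) = (\<integral>x. (norm (g x))\<^sup>2 \<partial>lborel)"
  by (rule integral_cong_AE) (use assms in \<open>auto elim: eventually_mono\<close>)

lemma test_fun_H01:
  assumes \<Omega>: "open \<Omega>" and t: "test_fun \<Omega> \<phi>"
  shows "\<phi> \<in> H01 \<Omega>"
proof -
  note p = test_fun_H1[OF assms]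
  have d: "(\<lambda>x. \<phi> x - \<phi> x) \<in> H1 \<Omega>" by (rule H1_diff(1)[OF \<Omega> p(1) p(1)])
  have ae: "AE x in lborel. ext_grad \<Omega> (\<lambda>x. \<phi> x - \<phi> x) x = 0"
    using H1_diff(2)[OF \<Omega> p(1) p(1)] by eventually_elim simp
  have "(\<integral>x. (norm (ext_grad \<Omega> (\<lambda>x. \<phi> x - \<phi> x) x))\<^sup>2 \<partial>lborel) = (\<integral>x. (norm (0::plane))\<^sup>2 \<partial>(lborel::plane measure))"
    by (rule integral_norm_power2_cong_AE[OF ae]) (use square_integrableD(1)[OF ext_grad_square_integrable[OF \<Omega> d]] in auto)
  then have "(H1_norm \<Omega> (\<lambda>x. \<phi> x - \<phi> x))\<^sup>2 = 0" by (simp add: H1_norm_power2)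
  then have "H1_norm \<Omega> (\<lambda>x. \<phi> x - \<phi> x) = 0" by simp
  then show ?thesis
    unfolding H01_def using p(1) t by (auto intro!: exI[of _ "\<lambda>n. \<phi>"])
qed

lemma H01_imp_H1: "u \<in> H01 \<Omega> \<Longrightarrow> u \<in> H1 \<Omega>"
  by (simp add: H01_def)

text \<open>The \<open>H\<^sup>1\<close> norm refers to the chosen weak gradient of the difference \<open>u - \<phi> n\<close>. By uniqueness of weak gradients it is almost
  everywhere the difference of the gradients.\<close>

lemma H01_approx:
  assumes \<Omega>: "open \<Omega>" and u: "u \<in> H01 \<Omega>"
  obtains \<phi> where "\<And>n::nat. test_fun \<Omega> (\<phi> n)"
    "(\<lambda>n. \<integral>x. (norm (ext_grad \<Omega> u x - grad (\<phi> n) x))\<^sup>2 \<partial>lborel) \<longlonglongrightarrow> 0"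
proof -
  from u obtain \<phi> where \<phi>: "\<forall>n::nat. test_fun \<Omega> (\<phi> n)" "(\<lambda>n. H1_norm \<Omega> (\<lambda>x. u x - \<phi> n x)) \<longlonglongrightarrow> 0"
    by (auto simp: H01_def)
  have u1: "u \<in> H1 \<Omega>" using u by (rule H01_imp_H1)
  have t: "test_fun \<Omega> (\<phi> n)" for n using \<phi>(1) by simp
  have eq: "(\<integral>x. (norm (ext_grad \<Omega> u x - grad (\<phi> n) x))\<^sup>2 \<partial>lborel)
      = (\<integral>x. (norm (ext_grad \<Omega> (\<lambda>x. u x - \<phi> n x) x))\<^sup>2 \<partial>lborel)" for n
  proof (rule integral_norm_power2_cong_AE)
    note p = test_fun_H1[OF \<Omega> t[of n]]
    show "AE x in lborel. ext_grad \<Omega> u x - grad (\<phi> n) x = ext_grad \<Omega> (\<lambda>x. u x - \<phi> n x) x"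
      using H1_diff(2)[OF \<Omega> u1 p(1)] p(2) by eventually_elim simp
    show "(\<lambda>x. ext_grad \<Omega> u x - grad (\<phi> n) x) \<in> borel_measurable lborel"
      by (intro square_integrableD(1) square_integrable_diff ext_grad_square_integrable[OF \<Omega> u1]
          square_integrable_test_fun(2)[OF t])
    show "ext_grad \<Omega> (\<lambda>x. u x - \<phi> n x) \<in> borel_measurable lborel"
      by (intro square_integrableD(1) ext_grad_square_integrable \<Omega> H1_diff u1 p(1))
  qed
  have "(\<lambda>n. \<integral>x. (norm (ext_grad \<Omega> (\<lambda>x. u x - \<phi> n x) x))\<^sup>2 \<partial>lborel) \<longlonglongrightarrow> 0"
  proof (rule tendsto_sandwich[OF _ _ tendsto_const])
    show "(\<lambda>n. (H1_norm \<Omega> (\<lambda>x. u x - \<phi> n x))\<^sup>2) \<longlonglongrightarrow> 0"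
      using tendsto_power[OF \<phi>(2), of 2] by simp
  qed (auto simp: H1_norm_power2)
  then show thesis using that[of \<phi>] t eq by simp
qed

text \<open>The differences of the approximating test functions converge, since \<open>|a - b|\<^sup>2 \<le> 2 |a|\<^sup>2 + 2 |b|\<^sup>2\<close> pointwise.\<close>

lemma H01_diff:
  assumes \<Omega>: "open \<Omega>" and u: "u \<in> H01 \<Omega>" and v: "v \<in> H01 \<Omega>"
  shows "(\<lambda>x. u x - v x) \<in> H01 \<Omega>"
proof -
  from u obtain \<phi> where \<phi>: "\<forall>n::nat. test_fun \<Omega> (\<phi> n)" "(\<lambda>n. H1_norm \<Omega> (\<lambda>x. u x - \<phi> n x)) \<longlonglongrightarrow> 0"
    by (auto simp: H01_def)
  from v obtain \<psi> where \<psi>: "\<forall>n::nat. test_fun \<Omega> (\<psi> n)" "(\<lambda>n. H1_norm \<Omega> (\<lambda>x. v x - \<psi> n x)) \<longlonglongrightarrow> 0"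
    by (auto simp: H01_def)
  have u1: "u \<in> H1 \<Omega>" "v \<in> H1 \<Omega>" using u v by (auto intro: H01_imp_H1)
  have tri: "(H1_norm \<Omega> (\<lambda>x. (u x - v x) - (\<phi> n x - \<psi> n x)))\<^sup>2
      \<le> 2 * (H1_norm \<Omega> (\<lambda>x. u x - \<phi> n x))\<^sup>2 + 2 * (H1_norm \<Omega> (\<lambda>x. v x - \<psi> n x))\<^sup>2" for n
  proof -
    let ?a = "\<lambda>x. u x - \<phi> n x" and ?b = "\<lambda>x. v x - \<psi> n x"
    have ab: "?a \<in> H1 \<Omega>" "?b \<in> H1 \<Omega>"
      using \<phi> \<psi> u1 test_fun_H1(1)[OF \<Omega>] by (auto intro!: H1_diff \<Omega>)
    have eq: "(\<lambda>x. (u x - v x) - (\<phi> n x - \<psi> n x)) = (\<lambda>x. ?a x - ?b x)" by (simp add: fun_eq_iff)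
    have bound: "(\<integral>x. (norm (f x))\<^sup>2 \<partial>lborel) \<le> 2 * (\<integral>x. (norm (g x))\<^sup>2 \<partial>lborel) + 2 * (\<integral>x. (norm (h x))\<^sup>2 \<partial>lborel)"
      if sq: "square_integrable f" "square_integrable g" "square_integrable h"
        and ae: "AE x in lborel. f x = g x - h x" for f g h :: "plane \<Rightarrow> 'c::euclidean_space"
    proof -
      have "(\<integral>x. (norm (f x))\<^sup>2 \<partial>lborel) \<le> (\<integral>x. 2 * (norm (g x))\<^sup>2 + 2 * (norm (h x))\<^sup>2 \<partial>lborel)"
      proof (rule integral_mono_AE)
        show "AE x in lborel. (norm (f x))\<^sup>2 \<le> 2 * (norm (g x))\<^sup>2 + 2 * (norm (h x))\<^sup>2"
          using ae
        proof eventually_elim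
          case (elim x)
          show ?case using norm_add_power2_le[of "g x" "- h x"] elim by simp
        qed
      qed (use sq in \<open>auto intro!: square_integrableD\<close>)
      also have "\<dots> = 2 * (\<integral>x. (norm (g x))\<^sup>2 \<partial>lborel) + 2 * (\<integral>x. (norm (h x))\<^sup>2 \<partial>lborel)"
        using sq by (simp add: square_integrableD)
      finally show ?thesis .
    qed
    have "(\<integral>x. (norm (ext_grad \<Omega> (\<lambda>x. ?a x - ?b x) x))\<^sup>2 \<partial>lborel)
      \<le> 2 * (\<integral>x. (norm (ext_grad \<Omega> ?a x))\<^sup>2 \<partial>lborel) + 2 * (\<integral>x. (norm (ext_grad \<Omega> ?b x))\<^sup>2 \<partial>lborel)"
      by (rule bound) (use ab \<Omega> in \<open>auto intro!: ext_grad_square_integrable H1_diff\<close>)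
    moreover have "(\<integral>x. (norm (indicat_real \<Omega> x *\<^sub>R (?a x - ?b x)))\<^sup>2 \<partial>lborel)
      \<le> 2 * (\<integral>x. (norm (indicat_real \<Omega> x *\<^sub>R ?a x))\<^sup>2 \<partial>lborel) + 2 * (\<integral>x. (norm (indicat_real \<Omega> x *\<^sub>R ?b x))\<^sup>2 \<partial>lborel)"
      using ab by (intro bound H1_ext_square_integrable H1_diff(1)[OF \<Omega> ab]) (auto simp: right_diff_distrib)
    moreover have "d + a \<le> 2 * (e + b) + 2 * (k + c)"
      if "a \<le> 2 * b + 2 * c" "d \<le> 2 * e + 2 * k" for a b c d e k :: real
      using add_mono[OF that] by (simp add: algebra_simps)
    ultimately show ?thesis unfolding eq H1_norm_power2 by blast
  qed
  have "(\<lambda>n. (H1_norm \<Omega> (\<lambda>x. (u x - v x) - (\<phi> n x - \<psi> n x)))\<^sup>2) \<longlonglongrightarrow> 0"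
  proof (rule tendsto_sandwich[OF _ _ tendsto_const])
    show "(\<lambda>n. 2 * (H1_norm \<Omega> (\<lambda>x. u x - \<phi> n x))\<^sup>2 + 2 * (H1_norm \<Omega> (\<lambda>x. v x - \<psi> n x))\<^sup>2) \<longlonglongrightarrow> 0"
      using \<phi>(2) \<psi>(2) by (auto intro!: tendsto_eq_intros)
  qed (use tri in auto)
  then have "(\<lambda>n. sqrt ((H1_norm \<Omega> (\<lambda>x. (u x - v x) - (\<phi> n x - \<psi> n x)))\<^sup>2)) \<longlonglongrightarrow> sqrt 0"
    by (rule tendsto_real_sqrt)
  then have "(\<lambda>n. H1_norm \<Omega> (\<lambda>x. (u x - v x) - (\<phi> n x - \<psi> n x))) \<longlonglongrightarrow> 0"
    by (simp add: tendsto_rabs_zero_iff)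
  then show ?thesis
    unfolding H01_def using H1_diff(1)[OF \<Omega> u1] \<phi>(1) \<psi>(1)
    by (auto intro!: exI[of _ "\<lambda>n x. \<phi> n x - \<psi> n x"] test_fun_diff)
qed

section \<open>Dipoles\<close>

text \<open>Rotation by a right angle. Fields orthogonal to all \<open>rot (\<nabla>\<psi>)\<close> are the curl-free ones.\<close>

definition rot :: "plane \<Rightarrow> plane" where
  "rot v = vector [- v $ 2, v $ 1]"

lemma rot_nth [simp]: "rot v $ 1 = - v $ 2" "rot v $ 2 = v $ 1"
  by (simp_all add: rot_def)

lemma inner_plane: "(v::plane) \<bullet> w = v $ 1 * w $ 1 + v $ 2 * w $ 2"
  by (simp add: inner_vec_def sum_2)

lemma norm_rot: "norm (rot v) = norm v"
proof -
  have "(norm (rot v))\<^sup>2 = (norm v)\<^sup>2" by (simp add: norm_plane)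
  then show ?thesis by simp
qed

lemma bounded_linear_rot: "bounded_linear rot"
  by (rule bounded_linear_intro[of _ 1]) (auto simp: vec_eq_iff forall_2 norm_rot)

lemma square_integrable_rot: "square_integrable f \<Longrightarrow> square_integrable (\<lambda>x. rot (f x))"
  using borel_measurable_continuous_on[OF linear_continuous_on[OF bounded_linear_rot], of f lborel]
  by (simp add: square_integrable_def norm_rot)

text \<open>Weak gradients are curl free: the partial derivatives of a test function are test functions, and its mixed
  partial derivatives agree.\<close>

lemma weak_grad_orthogonal_rot_grad:
  assumes u: "has_weak_grad UNIV u g" and t: "test_fun UNIV \<psi>"
  shows "(\<integral>x. g x \<bullet> rot (grad \<psi> x) \<partial>lborel) = 0"
proof -
  have lu: "locally_integrable UNIV u" and lg: "locally_integrable UNIV g"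
    using u by (auto simp: has_weak_grad_def)
  have ibp: "(\<integral>x. u x * grad \<phi> x $ i \<partial>lborel) = - (\<integral>x. \<phi> x * g x $ i \<partial>lborel)"
    and int: "integrable lborel (\<lambda>x. \<phi> x * g x $ i)" if t: "test_fun UNIV \<phi>" for \<phi> i
  proof -
    have 1: "integrable lborel (\<lambda>x. u x *\<^sub>R grad \<phi> x)" using mult_grad_integrable[OF lu t] by simp
    have 2: "integrable lborel (\<lambda>x. \<phi> x *\<^sub>R g x)" using test_fun_mult_integrable[OF lg t] by simp
    have "(\<integral>x. u x *\<^sub>R grad \<phi> x \<partial>lborel) = - (\<integral>x. \<phi> x *\<^sub>R g x \<partial>lborel)"
      using u t by (simp add: has_weak_grad_def set_lebesgue_integral_def)
    then have "(\<integral>x. u x *\<^sub>R grad \<phi> x \<partial>lborel) $ i = - ((\<integral>x. \<phi> x *\<^sub>R g x \<partial>lborel) $ i)"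
      by simp
    then show "(\<integral>x. u x * grad \<phi> x $ i \<partial>lborel) = - (\<integral>x. \<phi> x * g x $ i \<partial>lborel)"
      using integral_bounded_linear[OF bounded_linear_vec_nth 1, of i]
        integral_bounded_linear[OF bounded_linear_vec_nth 2, of i] by simp
    show "integrable lborel (\<lambda>x. \<phi> x * g x $ i)"
      using 2 unfolding integrable_vector_iff by simp
  qed
  have "(\<integral>x. g x \<bullet> rot (grad \<psi> x) \<partial>lborel)
      = (\<integral>x. grad \<psi> x $ 1 * g x $ 2 - grad \<psi> x $ 2 * g x $ 1 \<partial>lborel)"
    by (intro Bochner_Integration.integral_cong) (auto simp: inner_plane mult.commute)
  also have "\<dots> = (\<integral>x. grad \<psi> x $ 1 * g x $ 2 \<partial>lborel) - (\<integral>x. grad \<psi> x $ 2 * g x $ 1 \<partial>lborel)"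
    by (intro Bochner_Integration.integral_diff int test_fun_partial[OF t])
  finally have eq: "(\<integral>x. g x \<bullet> rot (grad \<psi> x) \<partial>lborel) =
      (\<integral>x. grad \<psi> x $ 1 * g x $ 2 \<partial>lborel) - (\<integral>x. grad \<psi> x $ 2 * g x $ 1 \<partial>lborel)" .
  have 1: "(\<integral>x. grad \<psi> x $ 1 * g x $ 2 \<partial>lborel) = - (\<integral>x. u x * grad (\<lambda>x. grad \<psi> x $ 1) x $ 2 \<partial>lborel)"
    using ibp[OF test_fun_partial[OF t], of 1 2] by simp
  have 2: "(\<integral>x. grad \<psi> x $ 2 * g x $ 1 \<partial>lborel) = - (\<integral>x. u x * grad (\<lambda>x. grad \<psi> x $ 2) x $ 1 \<partial>lborel)"
    using ibp[OF test_fun_partial[OF t], of 2 1] by simp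
  show ?thesis unfolding eq 1 2 by (simp add: mixed_partials_commute[OF t, of 1 _ 2])
qed

text \<open>For large \<open>n\<close> this is a smooth, compactly supported version of \<open>min 1 (1 / s)\<close>. The factor \<open>step (n (s - 1))\<close> switches
  the denominator from \<open>1\<close> to \<open>s\<close> between \<open>s = 1\<close> and \<open>s = 1 + 1 / n\<close>; it makes the denominator at least \<open>1\<close> for all real \<open>s\<close>, which
  keeps the quotient smooth. The factor \<open>step (2 - s / n)\<close> cuts off between \<open>n\<close> and \<open>2 n\<close>.\<close>

definition screen :: "real \<Rightarrow> real \<Rightarrow> real" where
  "screen n s = step (2 - s / n) * inverse (1 + (s - 1) * step (n * (s - 1)))"

definition screen_deriv :: "real \<Rightarrow> real \<Rightarrow> real" where
  "screen_deriv n s = - (step_deriv (2 - s / n) / n) * inverse (1 + (s - 1) * step (n * (s - 1)))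
     - step (2 - s / n) * ((step (n * (s - 1)) + (s - 1) * n * step_deriv (n * (s - 1)))
         * (inverse (1 + (s - 1) * step (n * (s - 1))))\<^sup>2)"

text \<open>The derivative of \<open>s \<mapsto> s * screen n s\<close>. For the limit function \<open>min 1 (1 / s)\<close> of \<open>screen\<close> this is the indicator of \<open>s \<le> 1\<close>.\<close>

definition spread :: "real \<Rightarrow> real \<Rightarrow> real" where
  "spread n s = screen n s + s * screen_deriv n s"

text \<open>A linear function on the disc of radius \<open>r\<close>, continued by a screened dipole potential.\<close>

definition dipole :: "real \<Rightarrow> plane \<Rightarrow> real \<Rightarrow> plane \<Rightarrow> plane \<Rightarrow> real" where
  "dipole n z r a x = ((x - z) \<bullet> a) * screen n ((norm (x - z))\<^sup>2 / r\<^sup>2)"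

lemma screen_denom_ge_1:
  assumes "0 < n" shows "1 \<le> 1 + (s - 1) * step (n * (s - 1))"
proof (cases "s \<le> 1")
  case True
  then show ?thesis using assms by (simp add: mult_nonneg_nonpos)
next
  case False
  then show ?thesis using step_bounds(1) by simp
qed

lemma DERIV_screen:
  assumes "0 < n" shows "DERIV (screen n) s :> screen_deriv n s"
proof -
  have ne: "1 + (s - 1) * step (n * (s - 1)) \<noteq> 0" using screen_denom_ge_1[OF assms, of s] by linarith
  have "DERIV (\<lambda>s. 2 - s / n) s :> - (1 / n)"
    using assms by (auto intro!: derivative_eq_intros)
  from DERIV_chain2[OF DERIV_step this]
  have a: "DERIV (\<lambda>s. step (2 - s / n)) s :> - (step_deriv (2 - s / n) / n)" by simp
  have "DERIV (\<lambda>s. n * (s - 1)) s :> n"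
    by (auto intro!: derivative_eq_intros)
  from DERIV_chain2[OF DERIV_step this]
  have "DERIV (\<lambda>s. step (n * (s - 1))) s :> step_deriv (n * (s - 1)) * n" .
  then have b: "DERIV (\<lambda>s. 1 + (s - 1) * step (n * (s - 1))) s :>
      step (n * (s - 1)) + (s - 1) * n * step_deriv (n * (s - 1))"
    by (auto intro!: derivative_eq_intros)
  show ?thesis
    using DERIV_mult[OF a DERIV_inverse_fun[OF b ne]]
    unfolding screen_def[abs_def] screen_deriv_def
    by (simp add: power2_eq_square mult_ac)
qed

lemma Ck_screen: "0 < n \<Longrightarrow> Ck k f \<Longrightarrow> Ck k (\<lambda>x. screen n (f x))"
proof -
  assume n: "0 < n" and f: "Ck k f"
  have ne: "1 + (f x - 1) * step (n * (f x - 1)) \<noteq> 0" for x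
    using screen_denom_ge_1[OF n, of "f x"] by linarith
  have "Ck k (\<lambda>x. step (2 - (1 / n) * f x) * inverse (1 + (f x - 1) * step (n * (f x - 1))))"
    by (intro Ck_mult Ck_inverse Ck_step Ck_add Ck_diff Ck_const Ck_cmult f ne)
  then show ?thesis by (simp add: screen_def)
qed

lemma spread_inside:
  assumes "0 < n" "1 \<le> n" "s \<le> 1"
  shows "screen n s = 1" "screen_deriv n s = 0" "spread n s = 1"
proof -
  have "s / n \<le> 1" using assms by (simp add: field_simps)
  moreover have "n * (s - 1) \<le> 0" using assms by (simp add: mult_nonneg_nonpos)
  ultimately show "screen n s = 1" "screen_deriv n s = 0" "spread n s = 1"
    by (simp_all add: screen_def screen_deriv_def spread_def)
qed

lemma spread_outside:
  assumes "0 < n" "1 + 1 / n \<le> s"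
  shows "spread n s = - (step_deriv (2 - s / n) / n)"
proof -
  have "1 \<le> n * (s - 1)" using assms by (simp add: field_simps)
  then have st: "step (n * (s - 1)) = 1" "step_deriv (n * (s - 1)) = 0" by simp_all
  have "0 < 1 / n" using assms by simp
  then have "s > 0" using assms(2) by linarith
  then show ?thesis
    unfolding spread_def screen_def screen_deriv_def st
    by (simp add: field_simps power2_eq_square)
qed

text \<open>The bound \<open>C / n\<close> in the region \<open>2 \<le> s \<le> 2 n\<close> makes the contribution of the outer cut-off tend to zero in \<open>L\<^sup>2\<close>: its square has
  integral of order \<open>n (C / n)\<^sup>2\<close>.\<close>

lemma spread_bound:
  "\<exists>C>0. \<forall>n\<ge>2. \<forall>s\<ge>0. (\<bar>spread n s\<bar> \<le> C) \<and> (2 \<le> s \<longrightarrow> \<bar>spread n s\<bar> \<le> C / n)"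
proof -
  obtain C where C: "C > 0" "\<And>t. \<bar>step_deriv t\<bar> \<le> C" using step_deriv_bound by blast
  have "\<bar>spread n s\<bar> \<le> 3 + 3 * C \<and> (2 \<le> s \<longrightarrow> \<bar>spread n s\<bar> \<le> (3 + 3 * C) / n)" if n: "2 \<le> n" and s: "0 \<le> s" for n s :: real
  proof -
    consider "s \<le> 1" | "1 < s" "s < 1 + 1 / n" | "1 + 1 / n \<le> s" by linarith
    then show ?thesis
    proof cases
      case 1
      then show ?thesis using spread_inside[of n s] n C by simp
    next
      case 2
      have n1: "1 / n \<le> 1 / 2" using n by simp
      have s2: "s \<le> 3 / 2" using 2 n1 by linarith
      define D where "D = 1 + (s - 1) * step (n * (s - 1))"
      have D: "1 \<le> D" unfolding D_def using screen_denom_ge_1[of n s] n by simp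
      have iD: "0 \<le> inverse D" "inverse D \<le> 1" using D by (auto simp: field_simps)
      have "s / n \<le> 1" using s2 n by (simp add: field_simps)
      then have st: "step (2 - s / n) = 1" "step_deriv (2 - s / n) = 0" by simp_all
      define Y where "Y = step (n * (s - 1)) + (s - 1) * n * step_deriv (n * (s - 1))"
      have "(s - 1) * n \<le> 1" "0 \<le> (s - 1) * n" using 2 n by (auto simp: field_simps)
      then have "\<bar>(s - 1) * n * step_deriv (n * (s - 1))\<bar> \<le> 1 * C"
        unfolding abs_mult using C by (intro mult_mono) auto
      then have Y: "\<bar>Y\<bar> \<le> 1 + C"
        using step_bounds[of "n * (s - 1)"] unfolding Y_def by linarith
      have k: "spread n s = inverse D - s * (Y * (inverse D)\<^sup>2)"
        unfolding spread_def screen_def screen_deriv_def st D_def[symmetric] Y_def[symmetric] by simp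
      have iD2: "(inverse D)\<^sup>2 \<le> 1" using iD by (simp add: power_le_one)
      have "\<bar>s * (Y * (inverse D)\<^sup>2)\<bar> \<le> (3/2) * ((1 + C) * 1)"
        unfolding abs_mult using s s2 Y iD2 C by (intro mult_mono) auto
      moreover have "\<bar>spread n s\<bar> \<le> \<bar>inverse D\<bar> + \<bar>s * (Y * (inverse D)\<^sup>2)\<bar>"
        unfolding k by (rule abs_triangle_ineq4)
      moreover have "\<bar>inverse D\<bar> \<le> 1" using iD by simp
      ultimately have "\<bar>spread n s\<bar> \<le> 1 + (3/2) * ((1 + C) * 1)" by (meson add_mono order_trans)
      also have "\<dots> \<le> 3 + 3 * C" using C(1) by (simp add: field_simps)
      finally have "\<bar>spread n s\<bar> \<le> 3 + 3 * C" .
      then show ?thesis using 2 s2 by simp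
    next
      case 3
      have "\<bar>spread n s\<bar> \<le> C / n"
        using spread_outside[of n s] 3 n C(2)[of "2 - s / n"] by (simp add: abs_divide divide_right_mono)
      moreover have "C / n \<le> (3 + 3 * C) / n" using n C by (intro divide_right_mono) auto
      moreover have "C / n \<le> C / 1" using n C by (intro divide_left_mono) auto
      ultimately show ?thesis using C by auto
    qed
  qed
  then show ?thesis using C(1) by (intro exI[of _ "3 + 3 * C"]) auto
qed

lemma spread_far: "2 \<le> n \<Longrightarrow> 2 * n \<le> s \<Longrightarrow> spread n s = 0"
proof -
  assume n: "2 \<le> n" "2 * n \<le> s"
  have "1 / n \<le> 1" using n by simp
  then have "1 + 1 / n \<le> s" using n by linarith
  moreover have "2 - s / n \<le> 0" using n by (simp add: field_simps)
  ultimately show ?thesis using spread_outside[of n s] n by simp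
qed

lemma spread_limit:
  assumes "0 \<le> s"
  shows "(\<lambda>m. spread (real m + 2) s) \<longlonglongrightarrow> (if s \<le> 1 then 1 else 0)"
proof (cases "s \<le> 1")
  case True
  then show ?thesis using spread_inside(3) by simp
next
  case False
  obtain M :: nat where M: "max s (1 / (s - 1)) < real M" using reals_Archimedean2 by blast
  have "spread (real m + 2) s = 0" if "M \<le> m" for m
  proof -
    have mM: "real M \<le> real m" using that by simp
    have "s \<le> real m + 2" using M mM by linarith
    then have a: "1 \<le> 2 - s / (real m + 2)" by (simp add: field_simps)
    have "1 / (s - 1) \<le> real m + 2" using M mM by linarith
    then have "1 / (real m + 2) \<le> s - 1" using False by (simp add: field_simps)
    then show ?thesis using spread_outside[of "real m + 2" s] a by simp
  qed
  then have "eventually (\<lambda>m. spread (real m + 2) s = 0) sequentially"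
    by (rule eventually_sequentiallyI)
  then show ?thesis using False by (simp add: tendsto_eventually)
qed

lemma GDERIV_screenole:
  assumes "0 < n"
  shows "GDERIV (dipole n z r a) x :> screen n ((norm (x - z))\<^sup>2 / r\<^sup>2) *\<^sub>R a
     + (2 / r\<^sup>2 * ((x - z) \<bullet> a) * screen_deriv n ((norm (x - z))\<^sup>2 / r\<^sup>2)) *\<^sub>R (x - z)"
proof -
  have "((\<lambda>x. (x - z) \<bullet> (x - z) * c) has_derivative (\<lambda>h. h \<bullet> ((2 * c) *\<^sub>R (x - z)))) (at x)" for c
    by (auto intro!: derivative_eq_intros simp: inner_commute algebra_simps)
  from this[of "1 / r\<^sup>2"] have "GDERIV (\<lambda>x. (norm (x - z))\<^sup>2 / r\<^sup>2) x :> (2 / r\<^sup>2) *\<^sub>R (x - z)"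
    by (simp add: gderiv_def power2_norm_eq_inner)
  from GDERIV_mult[OF GDERIV_inner GDERIV_DERIV_compose[OF this DERIV_screen[OF assms]]]
  show ?thesis
    unfolding dipole_def[abs_def] by (rule GDERIV_subst) (simp add: add.commute mult_ac)
qed

lemma test_fun_dipole:
  assumes "0 < n" "0 < r" shows "test_fun UNIV (dipole n z r a)"
proof (rule test_funI[OF _ compact_cball])
  have "Ck k (\<lambda>x. (1 / r\<^sup>2) * (norm (x - z))\<^sup>2)" for k by (intro Ck_cmult Ck_norm_power2)
  then have "Ck k (\<lambda>x. ((x - z) \<bullet> a) * screen n ((1 / r\<^sup>2) * (norm (x - z))\<^sup>2))" for k
    by (rule Ck_mult[OF Ck_inner Ck_screen[OF assms(1)]])
  then show "Ck k (dipole n z r a)" for k by (simp add: dipole_def[abs_def])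
  show "dipole n z r a x = 0" if "x \<notin> cball z (r * sqrt (2 * n))" for x
  proof -
    have "r * sqrt (2 * n) < norm (x - z)" using that by (simp add: dist_norm norm_minus_commute)
    then have "(r * sqrt (2 * n))\<^sup>2 < (norm (x - z))\<^sup>2" using assms by (intro power_strict_mono) auto
    then have "2 * n < (norm (x - z))\<^sup>2 / r\<^sup>2" using assms by (simp add: power_mult_distrib field_simps)
    then have "2 - (norm (x - z))\<^sup>2 / r\<^sup>2 / n \<le> 0" using assms by (simp add: field_simps)
    then show ?thesis by (simp add: dipole_def screen_def)
  qed
qed auto

lemma grad_dipole:
  assumes "0 < n"
  shows "grad (dipole n z r a) x = screen n ((norm (x - z))\<^sup>2 / r\<^sup>2) *\<^sub>R a
     + (2 / r\<^sup>2 * ((x - z) \<bullet> a) * screen_deriv n ((norm (x - z))\<^sup>2 / r\<^sup>2)) *\<^sub>R (x - z)"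
  by (rule GDERIV_imp_grad[OF GDERIV_screenole[OF assms]])

lemma grad_dipole_inside:
  assumes "1 \<le> n" "0 < r" "x \<in> cball z r"
  shows "grad (dipole n z r a) x = a"
proof -
  have "(norm (x - z))\<^sup>2 \<le> r\<^sup>2"
    using assms by (intro power_mono) (auto simp: dist_norm norm_minus_commute)
  then have "(norm (x - z))\<^sup>2 / r\<^sup>2 \<le> 1" using assms by simp
  then show ?thesis
    using grad_dipole[of n z r a x] spread_inside[of n "(norm (x - z))\<^sup>2 / r\<^sup>2"] assms by simp
qed

text \<open>The potential with moment \<open>rot a\<close> is the conjugate of the one with moment \<open>a\<close>. The anisotropic parts of the two gradients combine
  to \<open>|x - z|\<^sup>2 a\<close>, because \<open>x - z\<close> and \<open>rot (x - z)\<close> form an orthogonal basis, and only the isotropic \<open>spread\<close> remains.\<close>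

lemma dipole_conjugate:
  assumes "0 < n" "0 < r"
  shows "grad (dipole n z r a) x - rot (grad (dipole n z r (rot a)) x)
    = (2 * spread n ((norm (x - z))\<^sup>2 / r\<^sup>2)) *\<^sub>R a"
proof -
  define s where "s = (norm (x - z))\<^sup>2 / r\<^sup>2"
  define y where "y = x - z"
  have "(norm y)\<^sup>2 = r\<^sup>2 * s" using assms by (simp add: s_def y_def)
  then have sr: "(y $ 1)\<^sup>2 + (y $ 2)\<^sup>2 = r\<^sup>2 * s" by (simp add: norm_plane)
  define c where "c = 2 / r\<^sup>2 * screen_deriv n s"
  have cs: "c * ((y $ 1)\<^sup>2 + (y $ 2)\<^sup>2) = 2 * s * screen_deriv n s"
    unfolding sr c_def using assms by simp
  have 1: "grad (dipole n z r b) x = screen n s *\<^sub>R b + (c * (y \<bullet> b)) *\<^sub>R y" for b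
    using grad_dipole[OF assms(1), of z r b x] by (simp add: s_def y_def c_def mult_ac)
  have "(c * (y $ 1 * a $ 1 + y $ 2 * a $ 2)) * y $ 1 + (c * (- (y $ 1 * a $ 2) + y $ 2 * a $ 1)) * y $ 2
      = (c * ((y $ 1)\<^sup>2 + (y $ 2)\<^sup>2)) * a $ 1"
    "(c * (y $ 1 * a $ 1 + y $ 2 * a $ 2)) * y $ 2 - (c * (- (y $ 1 * a $ 2) + y $ 2 * a $ 1)) * y $ 1
      = (c * ((y $ 1)\<^sup>2 + (y $ 2)\<^sup>2)) * a $ 2"
    by (simp_all add: algebra_simps power2_eq_square)
  then show ?thesis
    unfolding 1 s_def[symmetric] spread_def vec_eq_iff forall_2 cs
    by (simp add: inner_plane algebra_simps)
qed

lemma flat_measurable [measurable]: "flat m \<in> borel_measurable borel"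
  by (rule borel_measurable_continuous_onI) (meson DERIV_flat DERIV_isCont continuous_at_imp_continuous_on)

lemma step_measurable [measurable]: "step \<in> borel_measurable borel"
  unfolding step_def[abs_def] by measurable

lemma step_deriv_measurable [measurable]: "step_deriv \<in> borel_measurable borel"
  unfolding step_deriv_def[abs_def] by measurable

lemma spread_measurable [measurable]: "spread n \<in> borel_measurable borel"
  unfolding spread_def[abs_def] screen_def screen_deriv_def by measurable

text \<open>A curl-free field does not see the rotated gradient of the conjugate dipole, so that only the isotropic kernel is left, which
  converges to twice the indicator of the disc. Close to the disc dominated convergence applies; further away the
  kernel is small in \<open>L\<^sup>2\<close>.\<close>

lemma integral_dipole_limit:
  assumes e: "square_integrable e"
    and rot: "\<And>\<psi>. test_fun UNIV \<psi> \<Longrightarrow> (\<integral>x. e x \<bullet> rot (grad \<psi> x) \<partial>lborel) = 0"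
    and r: "0 < r"
  shows "(\<lambda>m. \<integral>x. e x \<bullet> grad (dipole (real m + 2) z r a) x \<partial>lborel)
      \<longlonglongrightarrow> 2 * (LINT x:cball z r|lborel. e x \<bullet> a)"
proof -
  have [measurable]: "e \<in> borel_measurable borel" using e by (simp add: square_integrable_def)
  obtain C where C: "C > 0" "\<And>n s. 2 \<le> n \<Longrightarrow> 0 \<le> s \<Longrightarrow> \<bar>spread n s\<bar> \<le> C"
    "\<And>n s. 2 \<le> n \<Longrightarrow> 2 \<le> s \<Longrightarrow> \<bar>spread n s\<bar> \<le> C / n"
  proof -
    obtain C where "C > 0" "\<forall>n\<ge>2. \<forall>s\<ge>0. (\<bar>spread n s\<bar> \<le> C) \<and> (2 \<le> s \<longrightarrow> \<bar>spread n s\<bar> \<le> C / n)"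
      using spread_bound by blast
    then show thesis by (intro that[of C]) auto
  qed
  define s where "s x = (norm (x - z))\<^sup>2 / r\<^sup>2" for x
  have [measurable]: "s \<in> borel_measurable borel" unfolding s_def[abs_def] by measurable
  have s0: "0 \<le> s x" for x by (simp add: s_def)
  have s_le: "s x \<le> t \<longleftrightarrow> x \<in> cball z (r * sqrt t)" if "0 \<le> t" for x t
  proof -
    have "s x \<le> t \<longleftrightarrow> (norm (x - z))\<^sup>2 \<le> (r * sqrt t)\<^sup>2"
      using r that by (simp add: s_def field_simps power_mult_distrib)
    also have "\<dots> \<longleftrightarrow> norm (x - z) \<le> r * sqrt t"
      using r that by (intro abs_le_square_iff[symmetric, THEN trans]) auto
    finally show ?thesis by (simp add: dist_norm norm_minus_commute)
  qed
  define A where "A = cball z (r * sqrt 2)"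
  have A: "x \<in> A \<longleftrightarrow> s x \<le> 2" for x using s_le[of 2 x] by (simp add: A_def)
  \<comment> \<open>The near part and the far part of the kernel are separated at \<open>s = 2\<close>.\<close>
  define k1 where "k1 m x = indicat_real A x * spread (real m + 2) (s x)" for m x
  define k2 where "k2 m x = indicat_real (- A) x * spread (real m + 2) (s x)" for m x
  have [measurable]: "A \<in> sets borel" by (simp add: A_def)
  have [measurable]: "k1 m \<in> borel_measurable borel" "k2 m \<in> borel_measurable borel" for m
    unfolding k1_def[abs_def] k2_def[abs_def] by measurable
  have fin: "emeasure lborel (cball z \<rho>) < \<infinity>" for \<rho> by (rule emeasure_lborel_cball_finite)
  have eA: "set_integrable lborel A e"
    unfolding A_def by (rule square_integrable_imp_set_integrable[OF e _ fin]) simp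
  have int1: "integrable lborel (\<lambda>x. k1 m x * (e x \<bullet> a))"
    and bound1: "\<bar>k1 m x * (e x \<bullet> a)\<bar> \<le> C * norm a * norm (indicat_real A x *\<^sub>R e x)" for m x
  proof -
    show b: "\<bar>k1 m x * (e x \<bullet> a)\<bar> \<le> C * norm a * norm (indicat_real A x *\<^sub>R e x)" for x
    proof -
      have "\<bar>k1 m x\<bar> \<le> C * indicat_real A x"
        using C(2)[of "real m + 2" "s x"] s0[of x] by (auto simp: k1_def indicator_def)
      moreover have "\<bar>e x \<bullet> a\<bar> \<le> norm (e x) * norm a" by (rule Cauchy_Schwarz_ineq2)
      ultimately have "\<bar>k1 m x\<bar> * \<bar>e x \<bullet> a\<bar> \<le> (C * indicat_real A x) * (norm (e x) * norm a)"
        using C(1) by (intro mult_mono) auto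
      then show ?thesis by (simp add: abs_mult mult_ac)
    qed
    show "integrable lborel (\<lambda>x. k1 m x * (e x \<bullet> a))"
    proof (rule Bochner_Integration.integrable_bound)
      show "integrable lborel (\<lambda>x. C * norm a * norm (indicat_real A x *\<^sub>R e x))"
        using eA by (intro integrable_mult_right integrable_norm) (simp add: set_integrable_def)
    qed (use b C(1) in \<open>auto simp: abs_mult\<close>)
  qed
  have lim1: "(\<lambda>m. \<integral>x. k1 m x * (e x \<bullet> a) \<partial>lborel) \<longlonglongrightarrow> (\<integral>x. indicat_real (cball z r) x * (e x \<bullet> a) \<partial>lborel)"
  proof (rule integral_dominated_convergence[where w="\<lambda>x. C * norm a * norm (indicat_real A x *\<^sub>R e x)"])
    show "integrable lborel (\<lambda>x. C * norm a * norm (indicat_real A x *\<^sub>R e x))"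
      using eA by (intro integrable_mult_right integrable_norm) (simp add: set_integrable_def)
    show "AE x in lborel. (\<lambda>m. k1 m x * (e x \<bullet> a)) \<longlonglongrightarrow> indicat_real (cball z r) x * (e x \<bullet> a)"
    proof (rule AE_I2)
      fix x
      have "(\<lambda>m. indicat_real A x * spread (real m + 2) (s x)) \<longlonglongrightarrow> indicat_real A x * (if s x \<le> 1 then 1 else 0)"
        by (intro tendsto_mult tendsto_const spread_limit s0)
      moreover have "indicat_real A x * (if s x \<le> 1 then 1 else 0) = indicat_real (cball z r) x"
        using s_le[of 1 x] A[of x] by (auto simp: indicator_def)
      ultimately show "(\<lambda>m. k1 m x * (e x \<bullet> a)) \<longlonglongrightarrow> indicat_real (cball z r) x * (e x \<bullet> a)"
        unfolding k1_def by (intro tendsto_mult tendsto_const) simp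
    qed
    show "AE x in lborel. norm (k1 m x * (e x \<bullet> a)) \<le> C * norm a * norm (indicat_real A x *\<^sub>R e x)" for m
      using bound1 by (intro AE_I2) simp
    have [measurable]: "cball z r \<in> sets borel" by simp
    show "(\<lambda>x. indicat_real (cball z r) x * (e x \<bullet> a)) \<in> borel_measurable lborel" by measurable
    show "(\<lambda>x. k1 m x * (e x \<bullet> a)) \<in> borel_measurable lborel" for m by measurable
  qed
  define B where "B m = cball z (r * sqrt (2 * (real m + 2)))" for m :: nat
  have [measurable]: "B m \<in> sets borel" for m by (simp add: B_def)
  define \<mu> where "\<mu> = unit_ball_vol 2 * r\<^sup>2 * 2"
  have meas: "measure lborel (B m) = \<mu> * (real m + 2)" for m
    using r content_cball[of "r * sqrt (2 * (real m + 2))" z]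
    by (simp add: B_def \<mu>_def power_mult_distrib mult_ac)
  have k2_bound: "(norm (k2 m x *\<^sub>R a))\<^sup>2 \<le> (C / (real m + 2) * norm a)\<^sup>2 * indicat_real (B m) x" for m x
  proof (cases "x \<in> A \<or> 2 * (real m + 2) \<le> s x")
    case True
    then have "k2 m x = 0" using spread_far[of "real m + 2" "s x"] by (auto simp: k2_def)
    then show ?thesis by simp
  next
    case False
    then have "x \<in> B m" using s_le[of "2 * (real m + 2)" x] by (simp add: B_def)
    moreover have "\<bar>k2 m x\<bar> \<le> C / (real m + 2)"
      using C(3)[of "real m + 2" "s x"] False A[of x] by (simp add: k2_def)
    then have "norm (k2 m x *\<^sub>R a) \<le> C / (real m + 2) * norm a"
      unfolding norm_scaleR by (rule mult_right_mono) simp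
    ultimately show ?thesis by (simp add: power_mono)
  qed
  have iB: "integrable lborel (\<lambda>x. (C / (real m + 2) * norm a)\<^sup>2 * indicat_real (B m) x)" for m
    using fin by (intro integrable_mult_right integrable_real_indicator) (auto simp: B_def infinity_ennreal_def)
  have sq2: "square_integrable (\<lambda>x. k2 m x *\<^sub>R a)" for m
    unfolding square_integrable_def
  proof
    show "(\<lambda>x. k2 m x *\<^sub>R a) \<in> borel_measurable lborel" by measurable
    show "integrable lborel (\<lambda>x. (norm (k2 m x *\<^sub>R a))\<^sup>2)"
      by (rule Bochner_Integration.integrable_bound[OF iB[of m]])
         (use k2_bound[of m] in \<open>auto simp del: norm_scaleR\<close>)
  qed
  define E where "E = sqrt (\<integral>x. (norm (e x))\<^sup>2 \<partial>lborel)"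
  have bound2: "\<bar>\<integral>x. e x \<bullet> (k2 m x *\<^sub>R a) \<partial>lborel\<bar> \<le> E * sqrt ((C * norm a)\<^sup>2 * \<mu> * (1 / (real m + 2)))" for m
  proof -
    have "(\<integral>x. (norm (k2 m x *\<^sub>R a))\<^sup>2 \<partial>lborel) \<le> (\<integral>x. (C / (real m + 2) * norm a)\<^sup>2 * indicat_real (B m) x \<partial>lborel)"
      by (rule integral_mono[OF square_integrableD(2)[OF sq2] iB]) (rule k2_bound)
    also have "\<dots> = (C / (real m + 2) * norm a)\<^sup>2 * (\<mu> * (real m + 2))" by (simp add: meas)
    also have "\<dots> = (C * norm a)\<^sup>2 * \<mu> * (1 / (real m + 2))"
    proof -
      have "(C / t * b)\<^sup>2 * (\<mu> * t) = (C * b)\<^sup>2 * \<mu> * (1 / t)" if "t > 0" for t b :: real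
        using that by (simp add: field_simps power2_eq_square)
      then show ?thesis by simp
    qed
    finally have "sqrt (\<integral>x. (norm (k2 m x *\<^sub>R a))\<^sup>2 \<partial>lborel) \<le> sqrt ((C * norm a)\<^sup>2 * \<mu> * (1 / (real m + 2)))"
      by (rule real_sqrt_le_mono)
    then have "E * sqrt (\<integral>x. (norm (k2 m x *\<^sub>R a))\<^sup>2 \<partial>lborel) \<le> E * sqrt ((C * norm a)\<^sup>2 * \<mu> * (1 / (real m + 2)))"
      by (intro mult_left_mono) (auto simp: E_def)
    then show ?thesis
      using integral_Cauchy_Schwarz[OF e sq2[of m]] unfolding E_def by (rule order_trans[rotated])
  qed
  have "(\<lambda>m. 1 / (real m + 2)) \<longlonglongrightarrow> 0"
    using LIMSEQ_ignore_initial_segment[OF lim_1_over_n[where 'a=real], of 2] by (simp add: add.commute)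
  then have "(\<lambda>m. E * sqrt ((C * norm a)\<^sup>2 * \<mu> * (1 / (real m + 2)))) \<longlonglongrightarrow> E * sqrt ((C * norm a)\<^sup>2 * \<mu> * 0)"
    by (rule tendsto_mult[OF tendsto_const tendsto_real_sqrt[OF tendsto_mult[OF tendsto_const]]])
  then have lim_bound: "(\<lambda>m. E * sqrt ((C * norm a)\<^sup>2 * \<mu> * (1 / (real m + 2)))) \<longlonglongrightarrow> 0" by simp
  have lim2: "(\<lambda>m. \<integral>x. e x \<bullet> (k2 m x *\<^sub>R a) \<partial>lborel) \<longlonglongrightarrow> 0"
  proof (rule Lim_null_comparison[OF _ lim_bound])
    show "eventually (\<lambda>m. norm (\<integral>x. e x \<bullet> (k2 m x *\<^sub>R a) \<partial>lborel)
        \<le> E * sqrt ((C * norm a)\<^sup>2 * \<mu> * (1 / (real m + 2)))) sequentially"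
      by (intro always_eventually allI) (simp only: real_norm_def bound2)
  qed
  have eq: "(\<integral>x. e x \<bullet> grad (dipole (real m + 2) z r a) x \<partial>lborel)
      = 2 * (\<integral>x. k1 m x * (e x \<bullet> a) \<partial>lborel) + 2 * (\<integral>x. e x \<bullet> (k2 m x *\<^sub>R a) \<partial>lborel)" for m
  proof -
    have n: "0 < real m + 2" by simp
    note t = test_fun_dipole[OF n r]
    have sqr: "square_integrable (\<lambda>x. rot (grad (dipole (real m + 2) z r (rot a)) x))"
      by (intro square_integrable_rot square_integrable_test_fun(2)[OF t])
    have "(\<integral>x. e x \<bullet> grad (dipole (real m + 2) z r a) x \<partial>lborel)
       = (\<integral>x. 2 * (k1 m x * (e x \<bullet> a)) + 2 * (e x \<bullet> (k2 m x *\<^sub>R a)) + e x \<bullet> rot (grad (dipole (real m + 2) z r (rot a)) x) \<partial>lborel)"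
    proof (intro Bochner_Integration.integral_cong refl)
      fix x
      have "grad (dipole (real m + 2) z r a) x = (2 * spread (real m + 2) (s x)) *\<^sub>R a + rot (grad (dipole (real m + 2) z r (rot a)) x)"
        using dipole_conjugate[OF n r, of z a x] unfolding s_def by (simp add: algebra_simps)
      moreover have "spread (real m + 2) (s x) = k1 m x + k2 m x"
        by (simp add: k1_def k2_def indicator_def)
      ultimately show "e x \<bullet> grad (dipole (real m + 2) z r a) x
          = 2 * (k1 m x * (e x \<bullet> a)) + 2 * (e x \<bullet> (k2 m x *\<^sub>R a)) + e x \<bullet> rot (grad (dipole (real m + 2) z r (rot a)) x)"
        by (simp add: inner_add_right algebra_simps)
    qed
    also have "\<dots> = 2 * (\<integral>x. k1 m x * (e x \<bullet> a) \<partial>lborel) + 2 * (\<integral>x. e x \<bullet> (k2 m x *\<^sub>R a) \<partial>lborel)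
        + (\<integral>x. e x \<bullet> rot (grad (dipole (real m + 2) z r (rot a)) x) \<partial>lborel)"
      using int1[of m] square_integrable_inner[OF e sq2[of m]] square_integrable_inner[OF e sqr] by simp
    finally show ?thesis using rot[OF t] by simp
  qed
  have "(\<lambda>m. 2 * (\<integral>x. k1 m x * (e x \<bullet> a) \<partial>lborel) + 2 * (\<integral>x. e x \<bullet> (k2 m x *\<^sub>R a) \<partial>lborel))
      \<longlonglongrightarrow> 2 * (\<integral>x. indicat_real (cball z r) x * (e x \<bullet> a) \<partial>lborel) + 2 * 0"
    by (rule tendsto_add[OF tendsto_mult[OF tendsto_const lim1] tendsto_mult[OF tendsto_const lim2]])
  then show ?thesis unfolding eq by (simp add: set_lebesgue_integral_def)
qed

section \<open>Density of gradients of test functions\<close>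

text \<open>Testing with dipoles shows that the mean over every disc vanishes.\<close>

lemma Liouville_div_curl:
  assumes e: "square_integrable e"
    and grad: "\<And>\<phi>. test_fun UNIV \<phi> \<Longrightarrow> (\<integral>x. e x \<bullet> grad \<phi> x \<partial>lborel) = 0"
    and rot: "\<And>\<psi>. test_fun UNIV \<psi> \<Longrightarrow> (\<integral>x. e x \<bullet> rot (grad \<psi> x) \<partial>lborel) = 0"
  shows "AE x in lborel. e x = 0"
proof -
  have si: "set_integrable lborel K e" if "compact K" for K
    using that emeasure_compact_finite[OF that]
    by (intro square_integrable_imp_set_integrable[OF e]) (auto simp: compact_imp_closed)
  have "AE x in lborel. x \<in> UNIV \<longrightarrow> e x = 0"
  proof (rule AE_eq_0_if_discs)
    show "locally_integrable UNIV e" using si by (simp add: locally_integrable_def)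
    fix z and r :: real assume r: "0 < r"
    have "(LINT x:cball z r|lborel. e x) \<bullet> a = 0" for a
    proof -
      have "(LINT x:cball z r|lborel. e x \<bullet> a) = 0"
        using integral_dipole_limit[OF e rot r, of z a] grad[OF test_fun_dipole[OF _ r]]
        by (simp add: LIMSEQ_const_iff)
      moreover have "(LINT x:cball z r|lborel. e x) \<bullet> a = (LINT x:cball z r|lborel. e x \<bullet> a)"
        using si[OF compact_cball, of z r] unfolding set_integrable_def set_lebesgue_integral_def
        by (simp add: integral_inner_left[symmetric])
      ultimately show ?thesis by simp
    qed
    then show "(LINT x:cball z r|lborel. e x) = 0" by (metis inner_eq_zero_iff)
  qed simp
  then show ?thesis by simp
qed

text \<open>Along a subsequence with \<open>\<integral> |d j|\<^sup>2 \<le> 4\<^sup>-\<^sup>j\<close> for the increments \<open>d j\<close>, the series \<open>\<Sum> 2\<^sup>j |d j x|\<^sup>2\<close> is finite almost everywhere, and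
  \<open>|d| \<le> 2\<^sup>-\<^sup>j + 2\<^sup>j |d|\<^sup>2\<close> makes the increments summable there. Fatou's lemma turns pointwise convergence into
  convergence in the mean.\<close>

lemma L2_complete:
  fixes f :: "nat \<Rightarrow> plane \<Rightarrow> 'b::euclidean_space"
  assumes f: "\<And>n. square_integrable (f n)"
    and Cauchy: "\<And>\<delta>. \<delta> > 0 \<Longrightarrow> \<exists>N. \<forall>m\<ge>N. \<forall>n\<ge>N. (\<integral>x. (norm (f m x - f n x))\<^sup>2 \<partial>lborel) < \<delta>"
  obtains g where "square_integrable g" "(\<lambda>n. \<integral>x. (norm (f n x - g x))\<^sup>2 \<partial>lborel) \<longlonglongrightarrow> 0"
proof -
  have [measurable]: "f n \<in> borel_measurable borel" for n using f[of n] by (simp add: square_integrable_def)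
  have fd: "square_integrable (\<lambda>x. f m x - f n x)" for m n by (intro square_integrable_diff f)
  have "\<forall>j. \<exists>N. \<forall>m\<ge>N. \<forall>n\<ge>N. (\<integral>x. (norm (f m x - f n x))\<^sup>2 \<partial>lborel) < (1/4)^j"
    using Cauchy by simp
  then obtain N where N: "\<And>j m n. N j \<le> m \<Longrightarrow> N j \<le> n \<Longrightarrow> (\<integral>x. (norm (f m x - f n x))\<^sup>2 \<partial>lborel) < (1/4)^j"
    using choice[of "\<lambda>j N. \<forall>m\<ge>N. \<forall>n\<ge>N. (\<integral>x. (norm (f m x - f n x))\<^sup>2 \<partial>lborel) < (1/4)^j"] by blast
  define k where "k j = (\<Sum>i\<le>j. N i)" for j
  have kN: "N j \<le> k j" for j unfolding k_def by (rule member_le_sum) auto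
  have kmono: "k j \<le> k (Suc j)" for j by (simp add: k_def)
  have kge: "N i \<le> k j" if "i \<le> j" for i j unfolding k_def using that by (intro member_le_sum) auto
  define d where "d j x = f (k (Suc j)) x - f (k j) x" for j x
  have [measurable]: "d j \<in> borel_measurable borel" for j unfolding d_def[abs_def] by measurable
  have sqd: "square_integrable (d j)" for j unfolding d_def[abs_def] by (rule fd)
  have dj: "(\<integral>x. (norm (d j x))\<^sup>2 \<partial>lborel) \<le> (1/4)^j" for j
    using N[of j "k (Suc j)" "k j"] kN[of j] kmono[of j] by (simp add: d_def less_imp_le)
  have nnd: "(\<integral>\<^sup>+x. ennreal (2 ^ j * (norm (d j x))\<^sup>2) \<partial>lborel) \<le> ennreal ((1/2)^j)" for j
  proof -
    have "(\<integral>\<^sup>+x. ennreal (2 ^ j * (norm (d j x))\<^sup>2) \<partial>lborel) = ennreal (\<integral>x. 2 ^ j * (norm (d j x))\<^sup>2 \<partial>lborel)"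
      by (intro nn_integral_eq_integral integrable_mult_right square_integrableD(2)[OF sqd]) auto
    also have "(\<integral>x. 2 ^ j * (norm (d j x))\<^sup>2 \<partial>lborel) \<le> 2 ^ j * (1/4)^j"
      using dj[of j] by simp
    also have "\<dots> = (1/2)^j" by (simp add: power_mult_distrib[symmetric])
    finally show ?thesis by (simp add: ennreal_leI)
  qed
  have "(\<integral>\<^sup>+x. (\<Sum>j. ennreal (2 ^ j * (norm (d j x))\<^sup>2)) \<partial>lborel) = (\<Sum>j. \<integral>\<^sup>+x. ennreal (2 ^ j * (norm (d j x))\<^sup>2) \<partial>lborel)"
    by (rule nn_integral_suminf) measurable
  also have "\<dots> \<le> (\<Sum>j. ennreal ((1/2)^j))" by (intro suminf_le nnd) auto
  also have "\<dots> = ennreal (\<Sum>j. (1/2)^j)" by (rule suminf_ennreal2) (auto intro: summable_geometric)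
  also have "\<dots> < \<infinity>" by simp
  finally have "(\<integral>\<^sup>+x. (\<Sum>j. ennreal (2 ^ j * (norm (d j x))\<^sup>2)) \<partial>lborel) \<noteq> \<infinity>" by simp
  then have "AE x in lborel. (\<Sum>j. ennreal (2 ^ j * (norm (d j x))\<^sup>2)) \<noteq> \<infinity>"
    by (intro nn_integral_PInf_AE) measurable
  then have conv: "AE x in lborel. convergent (\<lambda>j. f (k j) x)"
  proof eventually_elim
    case (elim x)
    have "summable (\<lambda>j. 2 ^ j * (norm (d j x))\<^sup>2)"
      using elim by (intro summable_suminf_not_top) auto
    moreover have "summable (\<lambda>j. (1/2::real)^j)" by (rule summable_geometric) simp
    ultimately have "summable (\<lambda>j. (1/2)^j + 2 ^ j * (norm (d j x))\<^sup>2)" by (intro summable_add)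
    then have "summable (\<lambda>j. norm (d j x))"
    proof (rule summable_comparison_test'[of _ 0])
      fix j :: nat
      have "0 \<le> (1 - 2 ^ j * norm (d j x))\<^sup>2" by simp
      then have "2 * (2 ^ j * norm (d j x)) \<le> 1 + (2 ^ j * norm (d j x))\<^sup>2" by (simp add: power2_diff)
      then have "2 ^ j * norm (d j x) \<le> 1 + (2 ^ j * norm (d j x))\<^sup>2"
        using zero_le_mult_iff[of "2 ^ j" "norm (d j x)"] by (smt (verit) norm_ge_zero zero_le_power)
      then have "(1/2)^j * (2 ^ j * norm (d j x)) \<le> (1/2)^j * (1 + (2 ^ j * norm (d j x))\<^sup>2)"
        by (intro mult_left_mono) auto
      moreover have "(1/2)^j * (2 ^ j * norm (d j x)) = norm (d j x)"
        by (simp add: power_one_over)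
      moreover have "(1/2)^j * (1 + (2 ^ j * norm (d j x))\<^sup>2) = (1/2)^j + 2 ^ j * (norm (d j x))\<^sup>2"
        by (simp add: power_one_over field_simps power2_eq_square)
      ultimately show "norm (norm (d j x)) \<le> (1/2)^j + 2 ^ j * (norm (d j x))\<^sup>2" by simp
    qed
    then have "summable (\<lambda>j. d j x)" by (rule summable_norm_cancel)
    then have "convergent (\<lambda>j. \<Sum>i<j. d i x)" by (simp add: summable_iff_convergent)
    moreover have "(\<Sum>i<j. d i x) = f (k j) x - f (k 0) x" for j
      using sum_lessThan_telescope[of "\<lambda>i. f (k i) x" j] by (simp add: d_def)
    ultimately have "convergent (\<lambda>j. (f (k j) x - f (k 0) x) + f (k 0) x)"
      by (intro convergent_add convergent_const) simp
    then show ?case by simp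
  qed
  define g where "g x = lim (\<lambda>j. f (k j) x)" for x
  have gm [measurable]: "g \<in> borel_measurable borel" unfolding g_def[abs_def] by measurable
  have lim: "AE x in lborel. (\<lambda>j. f (k j) x) \<longlonglongrightarrow> g x"
    using conv by eventually_elim (simp add: g_def convergent_LIMSEQ_iff)
  have est: "(\<integral>\<^sup>+x. ennreal ((norm (f n x - g x))\<^sup>2) \<partial>lborel) \<le> ennreal ((1/4)^i)" if n: "N i \<le> n" for n i
  proof -
    have "(\<integral>\<^sup>+x. ennreal ((norm (f n x - g x))\<^sup>2) \<partial>lborel)
        = (\<integral>\<^sup>+x. liminf (\<lambda>j. ennreal ((norm (f n x - f (k j) x))\<^sup>2)) \<partial>lborel)"
    proof (rule nn_integral_cong_AE)
      show "AE x in lborel. ennreal ((norm (f n x - g x))\<^sup>2) = liminf (\<lambda>j. ennreal ((norm (f n x - f (k j) x))\<^sup>2))"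
        using lim
      proof eventually_elim
        case (elim x)
        have "(\<lambda>j. ennreal ((norm (f n x - f (k j) x))\<^sup>2)) \<longlonglongrightarrow> ennreal ((norm (f n x - g x))\<^sup>2)"
          by (intro tendsto_ennrealI tendsto_intros elim)
        then show ?case by (rule lim_imp_Liminf[OF sequentially_bot, symmetric])
      qed
    qed
    also have "\<dots> \<le> liminf (\<lambda>j. \<integral>\<^sup>+x. ennreal ((norm (f n x - f (k j) x))\<^sup>2) \<partial>lborel)"
      by (rule nn_integral_liminf) measurable
    also have "\<dots> \<le> limsup (\<lambda>j. \<integral>\<^sup>+x. ennreal ((norm (f n x - f (k j) x))\<^sup>2) \<partial>lborel)"
      by (rule Liminf_le_Limsup) simp
    also have "\<dots> \<le> ennreal ((1/4)^i)"
    proof (rule Limsup_bounded)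
      show "eventually (\<lambda>j. (\<integral>\<^sup>+x. ennreal ((norm (f n x - f (k j) x))\<^sup>2) \<partial>lborel) \<le> ennreal ((1/4)^i)) sequentially"
      proof (rule eventually_sequentiallyI)
        fix j assume "i \<le> j"
        then have "(\<integral>x. (norm (f n x - f (k j) x))\<^sup>2 \<partial>lborel) < (1/4)^i"
          using N[OF n kge] by blast
        moreover have "(\<integral>\<^sup>+x. ennreal ((norm (f n x - f (k j) x))\<^sup>2) \<partial>lborel) = ennreal (\<integral>x. (norm (f n x - f (k j) x))\<^sup>2 \<partial>lborel)"
          by (intro nn_integral_eq_integral square_integrableD(2)[OF fd]) auto
        ultimately show "(\<integral>\<^sup>+x. ennreal ((norm (f n x - f (k j) x))\<^sup>2) \<partial>lborel) \<le> ennreal ((1/4)^i)"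
          by (simp add: ennreal_leI)
      qed
    qed
    finally show ?thesis .
  qed
  have sq: "square_integrable (\<lambda>x. f n x - g x)" if "N 0 \<le> n" for n
    unfolding square_integrable_def
  proof
    show "(\<lambda>x. f n x - g x) \<in> borel_measurable lborel" by measurable
    show "integrable lborel (\<lambda>x. (norm (f n x - g x))\<^sup>2)"
    proof (rule integrableI_bounded)
      have "(\<integral>\<^sup>+x. ennreal (norm ((norm (f n x - g x))\<^sup>2)) \<partial>lborel) \<le> ennreal ((1/4)^0)"
        using est[OF that] by simp
      also have "\<dots> < \<infinity>" by simp
      finally show "(\<integral>\<^sup>+x. ennreal (norm ((norm (f n x - g x))\<^sup>2)) \<partial>lborel) < \<infinity>" .
    qed measurable
  qed
  have "square_integrable (\<lambda>x. f (N 0) x - (f (N 0) x - g x))"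
    by (intro square_integrable_diff f sq) simp
  then have gsq: "square_integrable g" by simp
  have bound: "(\<integral>x. (norm (f n x - g x))\<^sup>2 \<partial>lborel) \<le> (1/4)^i" if "N i \<le> n" for n i
  proof -
    have "ennreal (\<integral>x. (norm (f n x - g x))\<^sup>2 \<partial>lborel) \<le> ennreal ((1/4)^i)"
      using est[OF that] nn_integral_eq_integral[OF square_integrableD(2)[OF square_integrable_diff[OF f[of n] gsq]]]
      by simp
    then show ?thesis by simp
  qed
  have "(\<lambda>n. \<integral>x. (norm (f n x - g x))\<^sup>2 \<partial>lborel) \<longlonglongrightarrow> 0"
  proof (rule LIMSEQ_I)
    fix r :: real assume "0 < r"
    then obtain i where i: "(1/4)^i < r" using real_arch_pow_inv[of r "1/4"] by auto
    show "\<exists>no. \<forall>n\<ge>no. norm ((\<integral>x. (norm (f n x - g x))\<^sup>2 \<partial>lborel) - 0) < r"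
      using bound[of i] i by (intro exI[of _ "N i"]) (auto intro: le_less_trans)
  qed
  then show thesis using gsq that by blast
qed

lemma integral_inner_tendsto:
  assumes f: "\<And>n. square_integrable (f n)" and e: "square_integrable e" and v: "square_integrable v"
    and lim: "(\<lambda>n. \<integral>x. (norm (f n x - e x))\<^sup>2 \<partial>lborel) \<longlonglongrightarrow> 0"
  shows "(\<lambda>n::nat. \<integral>x. f n x \<bullet> v x \<partial>lborel) \<longlonglongrightarrow> (\<integral>x. e x \<bullet> v x \<partial>lborel)"
proof -
  have "(\<lambda>n. (\<integral>x. f n x \<bullet> v x \<partial>lborel) - (\<integral>x. e x \<bullet> v x \<partial>lborel)) \<longlonglongrightarrow> 0"
  proof (rule Lim_null_comparison)
    show "(\<lambda>n. sqrt (\<integral>x. (norm (f n x - e x))\<^sup>2 \<partial>lborel) * sqrt (\<integral>x. (norm (v x))\<^sup>2 \<partial>lborel)) \<longlonglongrightarrow> 0"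
      using tendsto_mult[OF tendsto_real_sqrt[OF lim] tendsto_const] by simp
    have "\<bar>(\<integral>x. f n x \<bullet> v x \<partial>lborel) - (\<integral>x. e x \<bullet> v x \<partial>lborel)\<bar>
        \<le> sqrt (\<integral>x. (norm (f n x - e x))\<^sup>2 \<partial>lborel) * sqrt (\<integral>x. (norm (v x))\<^sup>2 \<partial>lborel)" for n
    proof -
      have "(\<integral>x. f n x \<bullet> v x \<partial>lborel) - (\<integral>x. e x \<bullet> v x \<partial>lborel) = (\<integral>x. (f n x - e x) \<bullet> v x \<partial>lborel)"
        using square_integrable_inner[OF f v] square_integrable_inner[OF e v] by (simp add: inner_diff_left)
      then show ?thesis using integral_Cauchy_Schwarz[OF square_integrable_diff[OF f e] v] by simp
    qed
    then show "eventually (\<lambda>n. norm ((\<integral>x. f n x \<bullet> v x \<partial>lborel) - (\<integral>x. e x \<bullet> v x \<partial>lborel))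
        \<le> sqrt (\<integral>x. (norm (f n x - e x))\<^sup>2 \<partial>lborel) * sqrt (\<integral>x. (norm (v x))\<^sup>2 \<partial>lborel)) sequentially"
      by simp
  qed
  then show ?thesis by (simp add: LIM_zero_iff)
qed

text \<open>A minimising sequence for the distance of \<open>h\<close> to the gradients of test functions is Cauchy by the parallelogram identity. The limit \<open>e\<close>
  of the residuals is orthogonal to all gradients of test functions by minimality, and curl free like \<open>h\<close> and the
  gradients, hence zero.\<close>

lemma curl_free_approx:
  assumes h: "square_integrable h"
    and rot: "\<And>\<psi>. test_fun UNIV \<psi> \<Longrightarrow> (\<integral>x. h x \<bullet> rot (grad \<psi> x) \<partial>lborel) = 0"
    and \<delta>: "0 < \<delta>"
  obtains \<phi> where "test_fun UNIV \<phi>" "(\<integral>x. (norm (h x - grad \<phi> x))\<^sup>2 \<partial>lborel) < \<delta>"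
proof -
  define Q where "Q \<phi> = (\<integral>x. (norm (h x - grad \<phi> x))\<^sup>2 \<partial>lborel)" for \<phi>
  define S where "S = Q ` {\<phi>. test_fun UNIV \<phi>}"
  have zero: "test_fun UNIV (\<lambda>x. 0)"
    by (rule test_funI[of _ "{}"]) (auto simp: Ck_const)
  have S: "S \<noteq> {}" "bdd_below S"
    using zero by (auto simp: S_def Q_def bdd_below_def intro!: exI[of _ 0])
  define D where "D = Inf S"
  have DQ: "D \<le> Q \<phi>" if "test_fun UNIV \<phi>" for \<phi>
    unfolding D_def using that S(2) by (intro cInf_lower) (auto simp: S_def)
  have "\<exists>\<phi>. test_fun UNIV \<phi> \<and> Q \<phi> < D + 1 / real (Suc n)" for n
  proof -
    have "Inf S < D + 1 / real (Suc n)" by (simp add: D_def)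
    then obtain q where "q \<in> S" "q < D + 1 / real (Suc n)" using cInf_lessD[OF S(1)] by blast
    then show ?thesis by (auto simp: S_def)
  qed
  then have "\<forall>n. \<exists>\<phi>. test_fun UNIV \<phi> \<and> Q \<phi> < D + 1 / real (Suc n)" by blast
  from choice[OF this] obtain \<phi> where t: "\<And>n. test_fun UNIV (\<phi> n)" and Q: "\<And>n. Q (\<phi> n) < D + 1 / real (Suc n)"
    by blast
  define f where "f n x = h x - grad (\<phi> n) x" for n x
  have f: "square_integrable (f n)" for n
    unfolding f_def[abs_def] by (intro square_integrable_diff h square_integrable_test_fun(2)[OF t])
  have Qf: "Q (\<phi> n) = (\<integral>x. (norm (f n x))\<^sup>2 \<partial>lborel)" for n by (simp add: Q_def f_def)
  have par: "(\<integral>x. (norm (f m x - f n x))\<^sup>2 \<partial>lborel) \<le> 2 / real (Suc m) + 2 / real (Suc n)" for m n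
  proof -
    define \<eta> where "\<eta> x = (1/2) * \<phi> m x + (1/2) * \<phi> n x" for x
    have \<eta>: "test_fun UNIV \<eta>" unfolding \<eta>_def[abs_def] by (intro test_fun_add test_fun_cmult t)
    have g\<eta>: "grad \<eta> x = (1/2) *\<^sub>R grad (\<phi> m) x + (1/2) *\<^sub>R grad (\<phi> n) x" for x
      unfolding \<eta>_def[abs_def]
      by (subst grad_test_add[OF test_fun_cmult[OF t] test_fun_cmult[OF t]]) (simp only: grad_test_cmult[OF t])
    have pt: "(norm (f m x - f n x))\<^sup>2 = 2 * (norm (f m x))\<^sup>2 + 2 * (norm (f n x))\<^sup>2 - 4 * (norm (h x - grad \<eta> x))\<^sup>2" for x
    proof -
      have "2 *\<^sub>R (h x - grad \<eta> x) = f m x + f n x"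
        by (simp add: g\<eta> f_def algebra_simps scaleR_2)
      then have "4 * (norm (h x - grad \<eta> x))\<^sup>2 = (norm (f m x + f n x))\<^sup>2"
        by (metis (no_types, opaque_lifting) norm_scaleR power_mult_distrib abs_numeral four_x_squared)
      then show ?thesis by (simp add: power2_norm_eq_inner algebra_simps inner_commute)
    qed
    have "(\<integral>x. (norm (f m x - f n x))\<^sup>2 \<partial>lborel) = 2 * Q (\<phi> m) + 2 * Q (\<phi> n) - 4 * Q \<eta>"
      unfolding pt Qf Q_def[of \<eta>]
      using square_integrableD(2)[OF f[of m]] square_integrableD(2)[OF f[of n]]
        square_integrableD(2)[OF square_integrable_diff[OF h square_integrable_test_fun(2)[OF \<eta>]]]
      by simp
    also have "\<dots> \<le> 2 * (D + 1 / real (Suc m)) + 2 * (D + 1 / real (Suc n)) - 4 * D"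
      using Q[of m] Q[of n] DQ[OF \<eta>] by (intro diff_mono add_mono mult_left_mono) auto
    finally show ?thesis by (simp add: algebra_simps)
  qed
  obtain e where e: "square_integrable e" "(\<lambda>n. \<integral>x. (norm (f n x - e x))\<^sup>2 \<partial>lborel) \<longlonglongrightarrow> 0"
  proof (rule L2_complete[OF f])
    fix \<delta> :: real assume \<delta>: "0 < \<delta>"
    obtain N :: nat where N: "4 / \<delta> < real N" using reals_Archimedean2 by blast
    have small: "2 / real (Suc m) < \<delta> / 2" if "N \<le> m" for m
    proof -
      have "4 / \<delta> < real (Suc m)" using N that by simp
      then show ?thesis using \<delta> by (simp add: field_simps)
    qed
    have "(\<integral>x. (norm (f m x - f n x))\<^sup>2 \<partial>lborel) < \<delta>" if "N \<le> m" "N \<le> n" for m n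
      using par[of m n] small[OF that(1)] small[OF that(2)] by linarith
    then show "\<exists>N. \<forall>m\<ge>N. \<forall>n\<ge>N. (\<integral>x. (norm (f m x - f n x))\<^sup>2 \<partial>lborel) < \<delta>" by blast
  qed (rule that)
  have "AE x in lborel. e x = 0"
  proof (rule Liouville_div_curl[OF e(1)])
    fix \<psi> assume \<psi>: "test_fun UNIV \<psi>"
    let ?g = "grad \<psi>"
    have g: "square_integrable ?g" by (rule square_integrable_test_fun(2)[OF \<psi>])
    define I where "I n = (\<integral>x. f n x \<bullet> ?g x \<partial>lborel)" for n
    define E where "E = (\<integral>x. e x \<bullet> ?g x \<partial>lborel)"
    define B where "B = (\<integral>x. (norm (?g x))\<^sup>2 \<partial>lborel)"
    have lim: "I \<longlonglongrightarrow> E"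
      unfolding I_def[abs_def] E_def by (rule integral_inner_tendsto[OF f e(1) g e(2)])
    \<comment> \<open>Minimality of the distance, tested by varying \<open>\<phi> n\<close> in direction \<open>\<psi>\<close>.\<close>
    have var: "2 * s * I n \<le> 1 / real (Suc n) + s\<^sup>2 * B" for s n
    proof -
      have \<eta>: "test_fun UNIV (\<lambda>x. \<phi> n x + s * \<psi> x)" by (intro test_fun_add test_fun_cmult t \<psi>)
      have g\<eta>: "grad (\<lambda>x. \<phi> n x + s * \<psi> x) x = grad (\<phi> n) x + s *\<^sub>R ?g x" for x
        by (subst grad_test_add[OF t test_fun_cmult[OF \<psi>]]) (simp add: grad_test_cmult[OF \<psi>])
      have pt: "(norm (h x - (grad (\<phi> n) x + s *\<^sub>R ?g x)))\<^sup>2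
          = (norm (f n x))\<^sup>2 - 2 * s * (f n x \<bullet> ?g x) + s\<^sup>2 * (norm (?g x))\<^sup>2" for x
      proof -
        have "h x - (grad (\<phi> n) x + s *\<^sub>R ?g x) = f n x - s *\<^sub>R ?g x" by (simp add: f_def)
        then show ?thesis
          by (simp only: power2_norm_eq_inner) (simp add: inner_diff_left inner_diff_right inner_commute power2_eq_square algebra_simps)
      qed
      have "Q (\<lambda>x. \<phi> n x + s * \<psi> x) = Q (\<phi> n) - 2 * s * I n + s\<^sup>2 * B"
        unfolding Q_def[of "\<lambda>x. \<phi> n x + s * \<psi> x"] g\<eta> pt Qf I_def B_def
        using square_integrableD(2)[OF f[of n]] square_integrableD(2)[OF g] square_integrable_inner[OF f[of n] g]
        by simp
      then show ?thesis using DQ[OF \<eta>] Q[of n] by linarith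
    qed
    have "2 * s * E \<le> s\<^sup>2 * B" for s
    proof (rule LIMSEQ_le)
      show "(\<lambda>n. 2 * s * I n) \<longlonglongrightarrow> 2 * s * E" by (intro tendsto_intros lim)
      have "(\<lambda>n. 1 / real (Suc n)) \<longlonglongrightarrow> 0" using LIMSEQ_inverse_real_of_nat by (simp add: inverse_eq_divide)
      then have "(\<lambda>n. 1 / real (Suc n) + s\<^sup>2 * B) \<longlonglongrightarrow> 0 + s\<^sup>2 * B" by (intro tendsto_add tendsto_const)
      then show "(\<lambda>n. 1 / real (Suc n) + s\<^sup>2 * B) \<longlonglongrightarrow> s\<^sup>2 * B" by simp
    qed (use var in blast)
    \<comment> \<open>The choice \<open>s = E / (B + 1)\<close> also works when \<open>B = 0\<close>.\<close>
    from this[of "E / (B + 1)"] have *: "2 * (E / (B + 1)) * E \<le> (E / (B + 1))\<^sup>2 * B" .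
    have B: "0 \<le> B" by (simp add: B_def)
    have "2 * E\<^sup>2 * (B + 1) \<le> E\<^sup>2 * B"
    proof -
      have "2 * E\<^sup>2 * c \<le> E\<^sup>2 * B" if c: "0 < c" "2 * (E / c) * E \<le> (E / c)\<^sup>2 * B" for c
      proof -
        have "2 * (E / c) * E * c\<^sup>2 \<le> (E / c)\<^sup>2 * B * c\<^sup>2" using c by (intro mult_right_mono) auto
        then show ?thesis using c(1) by (simp add: power2_eq_square mult_ac)
      qed
      then show ?thesis using * B by simp
    qed
    then have "E\<^sup>2 * (B + 2) \<le> 0" by (simp add: algebra_simps)
    then have "E\<^sup>2 \<le> 0" using B by (simp add: mult_le_0_iff)
    then show "(\<integral>x. e x \<bullet> grad \<psi> x \<partial>lborel) = 0" by (simp add: E_def)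
  next
    fix \<psi> assume \<psi>: "test_fun UNIV \<psi>"
    have r: "square_integrable (\<lambda>x. rot (grad \<psi> x))"
      by (intro square_integrable_rot square_integrable_test_fun(2)[OF \<psi>])
    have "(\<lambda>n. \<integral>x. f n x \<bullet> rot (grad \<psi> x) \<partial>lborel) \<longlonglongrightarrow> (\<integral>x. e x \<bullet> rot (grad \<psi> x) \<partial>lborel)"
      by (rule integral_inner_tendsto[OF f e(1) r e(2)])
    moreover have "(\<integral>x. f n x \<bullet> rot (grad \<psi> x) \<partial>lborel) = 0" for n
    proof -
      have "(\<integral>x. grad (\<phi> n) x \<bullet> rot (grad \<psi> x) \<partial>lborel) = 0"
        by (rule weak_grad_orthogonal_rot_grad[OF test_fun_has_weak_grad[OF t open_UNIV] \<psi>])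
      then show ?thesis
        unfolding f_def inner_diff_left
        using rot[OF \<psi>] square_integrable_inner[OF h r] square_integrable_inner[OF square_integrable_test_fun(2)[OF t[of n]] r]
        by simp
    qed
    ultimately show "(\<integral>x. e x \<bullet> rot (grad \<psi> x) \<partial>lborel) = 0"
      by (simp add: LIMSEQ_const_iff)
  qed
  then have "(\<integral>x. (norm (f n x - e x))\<^sup>2 \<partial>lborel) = Q (\<phi> n)" for n
    unfolding Qf
    by (intro integral_norm_power2_cong_AE square_integrableD(1) square_integrable_diff f e(1)) (auto elim: eventually_mono)
  then have "(\<lambda>n. Q (\<phi> n)) \<longlonglongrightarrow> 0" using e(2) by simp
  then have "eventually (\<lambda>n. Q (\<phi> n) < \<delta>) sequentially" using \<delta> by (rule order_tendstoD)
  then obtain n where "Q (\<phi> n) < \<delta>" by (auto simp: eventually_sequentially)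
  then show thesis using that t unfolding Q_def by blast
qed

section \<open>The material law\<close>

lemma BH_curve_DERIV:
  assumes N1: "cond_N1 \<nu> \<nu>0" and s: "0 < s"
  shows "DERIV (\<lambda>t. \<nu> t * t) s :> deriv_half (\<lambda>t. \<nu> t * t) s"
    and "deriv_half (\<lambda>t. \<nu> t * t) s = \<nu> s + deriv_half \<nu> s * s"
proof -
  have at: "at s within {0..} = at s" using s by (intro at_within_interior) simp
  have "\<nu> differentiable (at s)"
    using N1 s unfolding cond_N1_def by (simp add: at[symmetric])
  then have d: "DERIV \<nu> s :> deriv_half \<nu> s"
    unfolding deriv_half_def at using vector_derivative_works has_real_derivative_iff_has_vector_derivative by blast
  have D: "DERIV (\<lambda>t. \<nu> t * t) s :> \<nu> s + deriv_half \<nu> s * s"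
    using d by (auto intro!: derivative_eq_intros)
  then have "vector_derivative (\<lambda>t. \<nu> t * t) (at s) = \<nu> s + deriv_half \<nu> s * s"
    by (intro vector_derivative_at) (simp add: has_real_derivative_iff_has_vector_derivative)
  then show e: "deriv_half (\<lambda>t. \<nu> t * t) s = \<nu> s + deriv_half \<nu> s * s"
    by (simp add: deriv_half_def at)
  show "DERIV (\<lambda>t. \<nu> t * t) s :> deriv_half (\<lambda>t. \<nu> t * t) s" using D by (simp only: e)
qed

text \<open>The mean value theorem for \<open>t \<mapsto> \<nu> t * t\<close>, whose derivative lies between \<open>m\<close> and \<open>\<nu>0\<close>.\<close>

lemma BH_curve_bounds:
  assumes N1: "cond_N1 \<nu> \<nu>0"
  obtains m where "0 < m" "m \<le> \<nu>0" "\<And>s. 0 \<le> s \<Longrightarrow> m \<le> \<nu> s" "\<And>s. 0 \<le> s \<Longrightarrow> \<nu> s \<le> \<nu>0"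
    "\<And>s. 0 \<le> s \<Longrightarrow> 0 < \<nu> s + deriv_half \<nu> s * s"
    "\<And>a b. 0 \<le> a \<Longrightarrow> 0 \<le> b \<Longrightarrow> m * (a - b)\<^sup>2 \<le> (\<nu> a * a - \<nu> b * b) * (a - b)"
    "\<And>a b. 0 \<le> a \<Longrightarrow> 0 \<le> b \<Longrightarrow> \<bar>\<nu> a * a - \<nu> b * b\<bar> \<le> \<nu>0 * \<bar>a - b\<bar>"
proof -
  from N1 obtain m where m: "m > 0" "\<And>s. s \<ge> 0 \<Longrightarrow> m \<le> \<nu> s" "\<And>s. s \<ge> 0 \<Longrightarrow> \<nu> s \<le> \<nu>0"
    "\<And>s. s \<ge> 0 \<Longrightarrow> m \<le> deriv_half (\<lambda>t. \<nu> t * t) s" "\<And>s. s \<ge> 0 \<Longrightarrow> deriv_half (\<lambda>t. \<nu> t * t) s \<le> \<nu>0"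
    unfolding cond_N1_def by blast
  have mean: "m * (a - b) \<le> \<nu> a * a - \<nu> b * b \<and> \<nu> a * a - \<nu> b * b \<le> \<nu>0 * (a - b)" if ba: "0 \<le> b" "b < a" for a b
  proof -
    have "\<nu> differentiable (at t within {0..})" if "0 \<le> t" for t
      using N1 that unfolding cond_N1_def by simp
    then have "continuous_on {0..} \<nu>"
      by (simp add: continuous_on_eq_continuous_within differentiable_imp_continuous_within)
    then have cont: "continuous_on {b..a} (\<lambda>t. \<nu> t * t)"
      using ba by (intro continuous_intros) (auto intro: continuous_on_subset)
    have "\<exists>l z. b < z \<and> z < a \<and> DERIV (\<lambda>t. \<nu> t * t) z :> l \<and> \<nu> a * a - \<nu> b * b = (a - b) * l"
    proof (rule MVT[OF ba(2) cont])
      fix x assume "b < x" "x < a"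
      then have "DERIV (\<lambda>t. \<nu> t * t) x :> deriv_half (\<lambda>t. \<nu> t * t) x"
        using BH_curve_DERIV(1)[OF N1, of x] ba(1) by simp
      then show "(\<lambda>t. \<nu> t * t) differentiable (at x)" using real_differentiable_def by blast
    qed
    then obtain l z where z: "b < z" "z < a" "DERIV (\<lambda>t. \<nu> t * t) z :> l" "\<nu> a * a - \<nu> b * b = (a - b) * l"
      by blast
    have "l = deriv_half (\<lambda>t. \<nu> t * t) z"
      using BH_curve_DERIV(1)[OF N1, of z] z ba DERIV_unique by force
    then have "m \<le> l" "l \<le> \<nu>0" using m(4,5)[of z] z ba by auto
    then show ?thesis using z(4) ba by (simp add: mult.commute mult_left_mono)
  qed
  show thesis
  proof (rule that[OF m(1)])
    show "m \<le> \<nu>0" using m(2,3)[of 0] by simp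
    show "0 < \<nu> s + deriv_half \<nu> s * s" if "0 \<le> s" for s
      using m(1) m(2)[of s] m(4)[of s] BH_curve_DERIV(2)[OF N1, of s] that
      by (cases "s = 0") auto
    fix a b :: real assume ab: "0 \<le> a" "0 \<le> b"
    consider "a = b" | "b < a" | "a < b" by linarith
    then show "m * (a - b)\<^sup>2 \<le> (\<nu> a * a - \<nu> b * b) * (a - b)"
    proof cases
      case 2
      then show ?thesis using mean[OF ab(2) 2]
        by (simp add: power2_eq_square mult.assoc[symmetric] mult_right_mono)
    next
      case 3
      then have "m * (b - a) * (b - a) \<le> (\<nu> b * b - \<nu> a * a) * (b - a)"
        using mean[OF ab(1) 3] by (intro mult_right_mono) auto
      then show ?thesis by (simp add: power2_eq_square algebra_simps)
    qed simp
    show "\<bar>\<nu> a * a - \<nu> b * b\<bar> \<le> \<nu>0 * \<bar>a - b\<bar>"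
    proof (cases rule: linorder_cases[of a b])
      case less
      have "0 \<le> m * (b - a)" using m(1) less by simp
      then show ?thesis using mean[OF ab(1) less] less by (simp add: abs_if)
    next
      case greater
      have "0 \<le> m * (a - b)" using m(1) greater by simp
      then show ?thesis using mean[OF ab(2) greater] greater by (simp add: abs_if)
    qed simp
  qed (use m in auto)
qed

text \<open>With \<open>a = |V|\<close>, \<open>b = |W|\<close> and \<open>d = a b - V \<cdot> W \<ge> 0\<close> all quantities split into a radial and an angular part:
  \<open>|V - W|\<^sup>2 = (a - b)\<^sup>2 + 2 d\<close>, \<open>(T V - T W) \<cdot> (V - W) = (\<nu> a a - \<nu> b b) (a - b) + (\<nu> a + \<nu> b) d\<close> and
  \<open>|T V - T W|\<^sup>2 = (\<nu> a a - \<nu> b b)\<^sup>2 + 2 \<nu> a \<nu> b d\<close>. The radial parts are controlled by the derivative of \<open>\<nu> t t\<close> and the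
  angular ones by \<open>\<nu>\<close> itself.\<close>

lemma T_op_monotone_Lipschitz:
  assumes N1: "cond_N1 \<nu> \<nu>0"
  obtains m where "0 < m" "m \<le> \<nu>0"
    "\<And>V W. m * (norm (V - W))\<^sup>2 \<le> (T_op \<nu> V - T_op \<nu> W) \<bullet> (V - W)"
    "\<And>V W. norm (T_op \<nu> V - T_op \<nu> W) \<le> \<nu>0 * norm (V - W)"
proof -
  obtain m where m: "0 < m" "m \<le> \<nu>0" "\<And>s. 0 \<le> s \<Longrightarrow> m \<le> \<nu> s" "\<And>s. 0 \<le> s \<Longrightarrow> \<nu> s \<le> \<nu>0"
    "\<And>a b. 0 \<le> a \<Longrightarrow> 0 \<le> b \<Longrightarrow> m * (a - b)\<^sup>2 \<le> (\<nu> a * a - \<nu> b * b) * (a - b)"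
    "\<And>a b. 0 \<le> a \<Longrightarrow> 0 \<le> b \<Longrightarrow> \<bar>\<nu> a * a - \<nu> b * b\<bar> \<le> \<nu>0 * \<bar>a - b\<bar>"
    by (rule BH_curve_bounds[OF N1]) (rule that; assumption)
  show thesis
  proof (rule that[OF m(1,2)])
    fix V W :: plane
    define a b d where "a = norm V" and "b = norm W" and "d = a * b - V \<bullet> W"
    have ab: "0 \<le> a" "0 \<le> b" by (simp_all add: a_def b_def)
    have VW: "V \<bullet> W = a * b - d" "W \<bullet> V = a * b - d" "V \<bullet> V = a\<^sup>2" "W \<bullet> W = b\<^sup>2"
      by (simp_all add: d_def a_def b_def inner_commute power2_norm_eq_inner)
    have d: "0 \<le> d" unfolding d_def a_def b_def using norm_cauchy_schwarz[of V W] by simp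
    have nd: "(norm (V - W))\<^sup>2 = (a - b)\<^sup>2 + 2 * d"
      unfolding power2_norm_eq_inner by (simp add: inner_diff_left inner_diff_right VW power2_eq_square algebra_simps)
    have T: "T_op \<nu> V = \<nu> a *\<^sub>R V" "T_op \<nu> W = \<nu> b *\<^sub>R W" by (simp_all add: T_op_def a_def b_def)
    have e1: "(T_op \<nu> V - T_op \<nu> W) \<bullet> (V - W) = (\<nu> a * a - \<nu> b * b) * (a - b) + (\<nu> a + \<nu> b) * d"
      unfolding T by (simp add: inner_diff_left inner_diff_right VW power2_eq_square algebra_simps)
    have "(2 * m) * d \<le> (\<nu> a + \<nu> b) * d"
      using m(3)[OF ab(1)] m(3)[OF ab(2)] d by (intro mult_right_mono) auto
    then show "m * (norm (V - W))\<^sup>2 \<le> (T_op \<nu> V - T_op \<nu> W) \<bullet> (V - W)"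
      unfolding e1 nd using m(5)[OF ab] by (simp add: algebra_simps)
    have e2: "(norm (T_op \<nu> V - T_op \<nu> W))\<^sup>2 = (\<nu> a * a - \<nu> b * b)\<^sup>2 + 2 * (\<nu> a * \<nu> b * d)"
      unfolding T power2_norm_eq_inner by (simp add: inner_diff_left inner_diff_right VW power2_eq_square algebra_simps)
    have "(\<nu> a * a - \<nu> b * b)\<^sup>2 \<le> (\<nu>0 * \<bar>a - b\<bar>)\<^sup>2"
      using m(6)[OF ab] by (metis abs_ge_zero power2_abs power_mono)
    moreover have "\<nu> a * \<nu> b * d \<le> \<nu>0 * \<nu>0 * d"
      using m(3,4)[OF ab(1)] m(3,4)[OF ab(2)] m(1) d by (intro mult_right_mono mult_mono) auto
    ultimately have "(norm (T_op \<nu> V - T_op \<nu> W))\<^sup>2 \<le> (\<nu>0 * norm (V - W))\<^sup>2"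
      unfolding e2 power_mult_distrib nd by (simp add: power2_eq_square algebra_simps)
    then show "norm (T_op \<nu> V - T_op \<nu> W) \<le> \<nu>0 * norm (V - W)"
      by (rule power2_le_imp_le) (use m in auto)
  qed
qed

lemma mat_mult_vec: "(mat k :: real^2^2) *v v = k *\<^sub>R v"
  by (simp add: vec_eq_iff forall_2 matrix_vector_mult_def mat_def sum_2)

lemma DT_mult:
  "DT \<nu> U *v v = \<nu> (norm U) *\<^sub>R v + (deriv_half \<nu> (norm U) / norm U * (U \<bullet> v)) *\<^sub>R U"
proof (cases "U = 0")
  case True
  then show ?thesis by (simp add: DT_def mat_mult_vec)
next
  case False
  have "outer U U *v v = (U \<bullet> v) *\<^sub>R U"
    by (simp add: vec_eq_iff forall_2 matrix_vector_mult_def outer_def sum_2 inner_plane algebra_simps)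
  then show ?thesis
    using False by (simp add: DT_def matrix_vector_mult_add_rdistrib mat_mult_vec scaleR_matrix_vector_assoc[symmetric])
qed

lemma DT_symmetric: "(DT \<nu> U *v v) \<bullet> w = (DT \<nu> U *v w) \<bullet> v"
  unfolding DT_mult inner_add_left inner_scaleR_left by (simp add: inner_commute mult_ac)

lemma DT_eigen: "(DT \<nu> U *v v) \<bullet> U = (\<nu> (norm U) + deriv_half \<nu> (norm U) * norm U) * (v \<bullet> U)"
proof (cases "U = 0")
  case False
  then have "deriv_half \<nu> (norm U) / norm U * (U \<bullet> v) * (norm U)\<^sup>2 = deriv_half \<nu> (norm U) * norm U * (v \<bullet> U)"
    by (simp add: power2_eq_square inner_commute)
  then show ?thesis
    by (simp add: DT_mult inner_add_left algebra_simps flip: power2_norm_eq_inner)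
qed simp

text \<open>In the rotated frame \<open>U\<close> points along the first axis, so only the first diagonal entry contributes.\<close>

lemma pol_matrix_first_axis:
  assumes R: "rotation_matrix R" and U: "U = R *v vector [norm U, 0]"
  shows "U \<bullet> (pol_matrix \<nu> \<nu>0 \<omega> U R *v P)
    = 2 * measure lborel \<omega> * \<nu>0 * ((\<nu> (norm U) - \<nu>0) / (\<nu> (norm U) + deriv_half \<nu> (norm U) * norm U + \<nu>0)) * (U \<bullet> P)"
proof -
  define e where "e = (vector [norm U, 0] :: plane)"
  define m1 m2 where "m1 = (\<nu> (norm U) - \<nu>0) / (\<nu> (norm U) + deriv_half \<nu> (norm U) * norm U + \<nu>0)"
    and "m2 = (\<nu> (norm U) - \<nu>0) / (\<nu> (norm U) + \<nu>0)"
  define Dm where "Dm = (vector [vector [m1, 0], vector [0, m2]] :: real^2^2)"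
  have oR: "transpose R ** R = mat 1" using R by (simp add: rotation_matrix_def orthogonal_matrix)
  have RU: "transpose R *v U = e"
  proof -
    have "transpose R *v U = transpose R *v (R *v e)" using U by (simp add: e_def)
    also have "\<dots> = (transpose R ** R) *v e" by (simp add: matrix_vector_mul_assoc)
    finally show ?thesis by (simp add: oR)
  qed
  have move: "v \<bullet> (R *v w) = (transpose R *v v) \<bullet> w" for v w
    by (metis dot_lmul_matrix transpose_matrix_vector)
  have De: "e \<bullet> (Dm *v w) = m1 * (e \<bullet> w)" for w
    by (simp add: e_def Dm_def inner_plane matrix_vector_mult_def sum_2)
  have "U \<bullet> ((R ** Dm ** transpose R) *v P) = U \<bullet> (R *v (Dm *v (transpose R *v P)))"
    by (simp only: matrix_vector_mul_assoc matrix_mul_assoc)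
  also have "\<dots> = m1 * (e \<bullet> (transpose R *v P))" by (simp only: move RU De)
  also have "e \<bullet> (transpose R *v P) = U \<bullet> P"
    using move[of P e] U by (simp add: e_def inner_commute)
  finally show ?thesis
    unfolding pol_matrix_def Let_def Dm_def m1_def m2_def
    by (simp add: scaleR_matrix_vector_assoc[symmetric] mult_ac)
qed

section \<open>Change of scale\<close>

lemma scale_lborel:
  assumes "(\<epsilon>::real) > 0"
  shows "lborel = density (distr lborel borel (\<lambda>y. x0 + \<epsilon> *\<^sub>R y)) (\<lambda>_::plane. ennreal (\<epsilon>\<^sup>2))"
  using lborel_affine[of \<epsilon> x0] assms by simp

lemma integral_scale:
  fixes f :: "plane \<Rightarrow> 'b::{banach,second_countable_topology}"
  assumes \<epsilon>: "\<epsilon> > 0" and f: "f \<in> borel_measurable borel"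
  shows "(\<integral>x. f ((1 / \<epsilon>) *\<^sub>R (x - x0)) \<partial>lborel) = \<epsilon>\<^sup>2 *\<^sub>R (\<integral>y. f y \<partial>lborel)"
    and "integrable lborel f \<Longrightarrow> integrable lborel (\<lambda>x. f ((1 / \<epsilon>) *\<^sub>R (x - x0)))"
proof -
  let ?g = "\<lambda>x. f ((1 / \<epsilon>) *\<^sub>R (x - x0))"
  have gm [measurable]: "?g \<in> borel_measurable borel" using f by measurable
  have eq: "?g (x0 + \<epsilon> *\<^sub>R y) = f y" for y using \<epsilon> by simp
  have "(\<integral>x. ?g x \<partial>lborel) = (\<integral>x. ?g x \<partial>(density (distr lborel borel (\<lambda>y. x0 + \<epsilon> *\<^sub>R y)) (\<lambda>_. ennreal (\<epsilon>\<^sup>2))))"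
    by (subst scale_lborel[OF \<epsilon>, of x0]) simp
  also have "\<dots> = (\<integral>x. \<epsilon>\<^sup>2 *\<^sub>R ?g x \<partial>(distr lborel borel (\<lambda>y. x0 + \<epsilon> *\<^sub>R y)))"
    by (intro integral_density) auto
  also have "\<dots> = (\<integral>y. \<epsilon>\<^sup>2 *\<^sub>R ?g (x0 + \<epsilon> *\<^sub>R y) \<partial>lborel)"
    by (intro integral_distr) auto
  finally show "(\<integral>x. ?g x \<partial>lborel) = \<epsilon>\<^sup>2 *\<^sub>R (\<integral>y. f y \<partial>lborel)" unfolding eq by simp
  assume fi: "integrable lborel f"
  have "integrable (density (distr lborel borel (\<lambda>y. x0 + \<epsilon> *\<^sub>R y)) (\<lambda>_. ennreal (\<epsilon>\<^sup>2))) ?g"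
    by (subst integrable_density) (auto simp: integrable_distr_eq eq fi)
  then show "integrable lborel ?g" by (subst scale_lborel[OF \<epsilon>, of x0])
qed

lemma square_integrable_scale:
  assumes "\<epsilon> > 0" "square_integrable (f :: plane \<Rightarrow> plane)"
  shows "square_integrable (\<lambda>x. f ((1 / \<epsilon>) *\<^sub>R (x - x0)))"
proof -
  have f [measurable]: "f \<in> borel_measurable borel" using assms(2) by (simp add: square_integrable_def)
  then have "(\<lambda>x. (norm (f x))\<^sup>2) \<in> borel_measurable borel" by measurable
  from integral_scale(2)[OF assms(1) this] square_integrableD(2)[OF assms(2)]
  show ?thesis unfolding square_integrable_def by (simp add: f)
qed

lemma mem_ball_scale:
  assumes "0 < \<epsilon>"
  shows "(1 / \<epsilon>) *\<^sub>R (x - x0) \<in> ball 0 1 \<longleftrightarrow> x \<in> ball (x0::plane) \<epsilon>"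
proof -
  have "norm ((1 / \<epsilon>) *\<^sub>R (x - x0)) = norm (x - x0) / \<epsilon>"
    using assms by (simp only: norm_scaleR) simp
  then show ?thesis using assms by (simp only: mem_ball dist_norm norm_minus_commute[of x0]) simp
qed

lemma scaled_ball: "0 < \<epsilon> \<Longrightarrow> scaled x0 \<epsilon> (ball 0 1) = ball x0 \<epsilon>"
proof -
  assume \<epsilon>: "0 < \<epsilon>"
  have "x \<in> scaled x0 \<epsilon> (ball 0 1)" if "x \<in> ball x0 \<epsilon>" for x
    unfolding scaled_def
  proof (rule image_eqI)
    show "x = x0 + \<epsilon> *\<^sub>R ((1 / \<epsilon>) *\<^sub>R (x - x0))" using \<epsilon> by simp
    show "(1 / \<epsilon>) *\<^sub>R (x - x0) \<in> ball 0 1"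
      using that mem_ball_scale[OF \<epsilon>] by blast
  qed
  then show ?thesis using \<epsilon> by (auto simp: scaled_def dist_norm)
qed

lemma measure_ball_scale:
  assumes "0 < \<epsilon>" shows "measure lborel (ball (x0::plane) \<epsilon>) = \<epsilon>\<^sup>2 * measure lborel (ball (0::plane) 1)"
  using content_ball[of \<epsilon> x0] content_ball[of 1 "0::plane"] assms by simp

section \<open>The quotient space at scale one\<close>

text \<open>The representative chosen by \<open>cgrad\<close> lies in \<open>Hw\<close>, and its chosen weak gradient agrees almost everywhere with a square
  integrable one.\<close>

lemma cgrad_Hquot:
  assumes "X \<in> Hquot"
  shows "\<exists>u. u \<in> Hw \<and> has_weak_grad UNIV u (cgrad X)" and "square_integrable (cgrad X)"
proof -
  from assms obtain v where v: "v \<in> Hw" "X = const_rel `` {v}" by (auto simp: Hquot_def elim: quotientE)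
  have "(v, v) \<in> const_rel" using v by (auto simp: const_rel_def)
  then have "v \<in> X" using v by simp
  then have "(SOME u. u \<in> X) \<in> X" by (rule someI[of "\<lambda>u. u \<in> X"])
  then have u: "(SOME u. u \<in> X) \<in> Hw" using v(2) by (auto simp: const_rel_def)
  then obtain g where g: "has_weak_grad UNIV (SOME u. u \<in> X) g" "g \<in> L2 UNIV" by (auto simp: Hw_def)
  then have wg: "has_weak_grad UNIV (SOME u. u \<in> X) (cgrad X)"
    unfolding cgrad_def wgrad_def by (intro someI[of "has_weak_grad UNIV (SOME u. u \<in> X)"])
  then show "\<exists>u. u \<in> Hw \<and> has_weak_grad UNIV u (cgrad X)" using u by blast
  show "square_integrable (cgrad X)"
    using weak_grad_square_integrable[OF open_UNIV g wg] by simp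
qed

lemma cgrad_orthogonal_rot_grad:
  assumes "X \<in> Hquot" "test_fun UNIV \<psi>"
  shows "(\<integral>x. cgrad X x \<bullet> rot (grad \<psi> x) \<partial>lborel) = 0"
  using cgrad_Hquot(1)[OF assms(1)] weak_grad_orthogonal_rot_grad assms(2) by blast

lemma continuous_weight: "continuous_on UNIV weight"
proof -
  have "sqrt (1 + (norm x)\<^sup>2) * ln (2 + norm x) \<noteq> 0" for x :: plane
  proof -
    have "0 < 1 + (norm x)\<^sup>2" by (simp add: add_pos_nonneg)
    moreover have "0 < ln (2 + norm x)" using norm_ge_zero[of x] by (intro ln_gt_zero) linarith
    ultimately show ?thesis by simp
  qed
  moreover have "2 + norm x \<noteq> 0" for x :: plane using norm_ge_zero[of x] by linarith
  ultimately show ?thesis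
    unfolding weight_def[abs_def] by (intro continuous_intros) auto
qed

text \<open>Test functions lie in the weighted space, as the weight is continuous. This makes them admissible in the problems at scale one.\<close>

lemma test_fun_represents_class:
  assumes t: "test_fun UNIV \<phi>"
  obtains X where "X \<in> Hquot" "AE x in lborel. cgrad X x = grad \<phi> x"
proof -
  obtain K where K: "compact K" "\<And>x. x \<notin> K \<Longrightarrow> \<phi> x = 0" using test_fun_supportE[OF t] by metis
  have "square_integrable (\<lambda>x. weight x * \<phi> x)"
    by (rule continuous_compact_support_square_integrable[OF _ K(1)])
       (use K(2) in \<open>auto intro!: continuous_on_mult continuous_weight test_fun_continuous[OF t]\<close>)
  moreover have "grad \<phi> \<in> L2 UNIV" using square_integrable_test_fun(2)[OF t] by (simp add: L2_iff)
  moreover have wg: "has_weak_grad UNIV \<phi> (grad \<phi>)" by (rule test_fun_has_weak_grad[OF t open_UNIV])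
  ultimately have w: "\<phi> \<in> Hw" by (auto simp: Hw_def L2_iff)
  define X where "X = const_rel `` {\<phi>}"
  have X: "X \<in> Hquot" unfolding X_def Hquot_def using w by (rule quotientI)
  have "(\<phi>, \<phi>) \<in> const_rel" using w by (auto simp: const_rel_def)
  then have "\<phi> \<in> X" by (simp add: X_def)
  then have "(SOME u. u \<in> X) \<in> X" by (rule someI[of "\<lambda>u. u \<in> X"])
  then have "(\<phi>, SOME u. u \<in> X) \<in> const_rel" by (simp add: X_def)
  then obtain c where c: "(SOME u. u \<in> X) \<in> Hw" "AE x in lborel. \<phi> x - (SOME u. u \<in> X) x = c"
    by (auto simp: const_rel_def)
  then have wg2: "has_weak_grad UNIV (SOME u. u \<in> X) (cgrad X)"
    using someI_ex[of "has_weak_grad UNIV (SOME u. u \<in> X)"] unfolding cgrad_def wgrad_def Hw_def by blast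
  have "AE x in lborel. x \<in> UNIV \<longrightarrow> grad \<phi> x = cgrad X x"
    by (rule has_weak_grad_unique[OF wg wg2 open_UNIV, of c]) (use c(2) in simp)
  then have "AE x in lborel. cgrad X x = grad \<phi> x" by (auto elim: eventually_mono)
  then show thesis using that X by blast
qed

section \<open>Comparison with the rescaled corrector\<close>

lemma inner_Young:
  fixes a b :: "'a::real_inner"
  assumes "0 < t" shows "a \<bullet> b \<le> t * (norm a)\<^sup>2 + (norm b)\<^sup>2 / (4 * t)"
proof -
  have "0 \<le> (norm ((2 * t) *\<^sub>R a - b))\<^sup>2" by simp
  also have "\<dots> = 4 * t * (t * (norm a)\<^sup>2 + (norm b)\<^sup>2 / (4 * t) - a \<bullet> b)"
    unfolding power2_norm_eq_inner using assms
    by (simp add: inner_diff_left inner_diff_right inner_commute field_simps power2_eq_square)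
  finally show ?thesis using assms by (simp add: zero_le_mult_iff)
qed

lemma square_integrable_indicator_const:
  assumes "A \<in> sets borel" "emeasure lborel A < \<infinity>"
  shows "square_integrable (\<lambda>x. indicat_real A x *\<^sub>R c)"
  unfolding square_integrable_def
proof
  show "(\<lambda>x. indicat_real A x *\<^sub>R c) \<in> borel_measurable lborel" using assms(1) by measurable
  have "integrable lborel (\<lambda>x. indicat_real A x * (norm c)\<^sup>2)"
    using assms by (intro integrable_mult_left integrable_real_indicator) auto
  moreover have "(\<lambda>x. indicat_real A x * (norm c)\<^sup>2) = (\<lambda>x. (norm (indicat_real A x *\<^sub>R c))\<^sup>2)"
    by (auto simp: indicator_def)
  ultimately show "integrable lborel (\<lambda>x. (norm (indicat_real A x *\<^sub>R c))\<^sup>2)" by simp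
qed

lemma square_integrable_Lipschitz:
  fixes V :: "plane \<Rightarrow> plane" and f :: "plane \<Rightarrow> plane"
  assumes f: "\<And>a b. norm (f a - f b) \<le> L * norm (a - b)" "f \<in> borel_measurable borel"
    and V: "square_integrable V" and A: "A \<in> sets borel" "emeasure lborel A < \<infinity>"
  shows "square_integrable (\<lambda>x. indicat_real A x *\<^sub>R f (U + V x))"
proof -
  have [measurable]: "V \<in> borel_measurable borel" "f \<in> borel_measurable borel" "A \<in> sets borel"
    using V f(2) A(1) by (auto simp: square_integrable_def)
  have "square_integrable (\<lambda>x. indicat_real A x *\<^sub>R (f (U + V x) - f U))"
  proof (rule square_integrable_bound[OF V])
    show "(\<lambda>x. indicat_real A x *\<^sub>R (f (U + V x) - f U)) \<in> borel_measurable lborel" by measurable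
    have "norm (f (U + V x) - f U) \<le> L * norm (V x)" for x using f(1)[of "U + V x" U] by simp
    moreover have "0 \<le> L * norm (V x)" for x
      using norm_ge_zero[of "f (U + V x) - f U"] calculation[of x] by linarith
    ultimately show "AE x in lborel. norm (indicat_real A x *\<^sub>R (f (U + V x) - f U)) \<le> L * norm (V x)"
      by (intro AE_I2) (auto simp: indicator_def)
  qed
  from square_integrable_add[OF this square_integrable_indicator_const[OF A, of "f U"]]
  show ?thesis by (simp add: scaleR_diff_right)
qed

text \<open>The comparison of the perturbed state with the corrector only uses that the law is strongly monotone and
  Lipschitz, the Lipschitz constant being the coefficient \<open>\<nu>0\<close> of the surrounding air.\<close>

locale monotone_law =
  fixes T :: "plane \<Rightarrow> plane" and \<nu>0 m :: real
  assumes m_pos: "0 < m" and m_le: "m \<le> \<nu>0"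
    and mono: "m * (norm (V - W))\<^sup>2 \<le> (T V - T W) \<bullet> (V - W)"
    and Lip: "norm (T V - T W) \<le> \<nu>0 * norm (V - W)"
begin

lemma \<nu>0_pos: "0 < \<nu>0" using m_pos m_le by linarith

text \<open>The excess of the magnetic law over air, so that \<open>flux\<close> below is \<open>\<nu>0 V\<close> outside of the inclusion \<open>A\<close>
  and \<open>T (G + V) - \<nu>0 G\<close> inside of it.\<close>

definition contrast :: "plane \<Rightarrow> plane" where
  "contrast W = T W - \<nu>0 *\<^sub>R W"

lemma contrast_Lip: "norm (contrast V - contrast W) \<le> (2 * \<nu>0) * norm (V - W)"
proof -
  have "contrast V - contrast W = (T V - T W) - \<nu>0 *\<^sub>R (V - W)"
    by (simp add: contrast_def algebra_simps)
  then have "norm (contrast V - contrast W) \<le> norm (T V - T W) + norm (\<nu>0 *\<^sub>R (V - W))"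
    by (simp only: norm_triangle_ineq4)
  then show ?thesis using Lip[of V W] \<nu>0_pos by simp
qed

lemma contrast_measurable [measurable]: "contrast \<in> borel_measurable borel"
proof (rule borel_measurable_continuous_onI)
  have "(2 * \<nu>0)-lipschitz_on UNIV contrast"
    using contrast_Lip \<nu>0_pos by (intro lipschitz_onI) (auto simp: dist_norm)
  then show "continuous_on UNIV contrast" by (rule lipschitz_on_continuous_on)
qed

lemma square_integrable_contrast:
  fixes V :: "plane \<Rightarrow> plane"
  assumes "square_integrable V" "A \<in> sets borel" "emeasure lborel A < \<infinity>"
  shows "square_integrable (\<lambda>x. indicat_real A x *\<^sub>R contrast (U + V x))"
  by (rule square_integrable_Lipschitz[OF contrast_Lip contrast_measurable assms])

definition flux :: "plane set \<Rightarrow> (plane \<Rightarrow> plane) \<Rightarrow> (plane \<Rightarrow> plane) \<Rightarrow> plane \<Rightarrow> plane" where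
  "flux A G V x = \<nu>0 *\<^sub>R V x + indicat_real A x *\<^sub>R contrast (G x + V x)"

lemma square_integrable_flux:
  assumes V: "square_integrable V" and A: "A \<in> sets borel" "emeasure lborel A < \<infinity>"
  shows "square_integrable (flux A (\<lambda>x. U) V)"
    and "square_integrable G \<Longrightarrow> square_integrable (flux A G V)"
proof -
  show "square_integrable (flux A (\<lambda>x. U) V)"
    unfolding flux_def[abs_def]
    by (intro square_integrable_add square_integrable_scaleR square_integrable_contrast V A)
  assume "square_integrable G"
  then have "square_integrable (\<lambda>x. indicat_real A x *\<^sub>R contrast (0 + (G x + V x)))"
    by (intro square_integrable_contrast square_integrable_add V A)
  then show "square_integrable (flux A G V)"
    unfolding flux_def[abs_def] by (intro square_integrable_add square_integrable_scaleR V) simp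
qed

text \<open>Here \<open>V\<close> is the perturbed field, \<open>W\<close> the corrector and \<open>Z\<close> an admissible approximation of \<open>W\<close>. Strong monotonicity bounds
  \<open>m |V - W|\<^sup>2\<close> by the product of the flux difference, at frozen background \<open>U\<close>, with \<open>V - W\<close>. Replacing \<open>U\<close> by \<open>G\<close> and \<open>W\<close> by \<open>Z\<close> costs terms
  that Young's inequality absorbs. Stated pointwise, the last term is the only one that needs the equations.\<close>

lemma Cea_pointwise:
  fixes A :: "plane set" and U :: plane and G V W Z :: "plane \<Rightarrow> plane"
  shows "(m / 2) * (norm (V x - W x))\<^sup>2
     \<le> (4 * \<nu>0\<^sup>2 / m + m) * (indicat_real A x * (norm (U - G x))\<^sup>2)
       + (2 * \<nu>0\<^sup>2 / m) * (norm (Z x - W x))\<^sup>2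
       + (flux A G V x - flux A (\<lambda>x. U) W x) \<bullet> (V x - Z x)"
proof -
  define b where "b = indicat_real A x"
  have b: "b = 0 \<or> b = 1" by (auto simp: b_def indicator_def)
  define E where "E = V x - W x"
  define Y where "Y = Z x - W x"
  define r where "r = b *\<^sub>R (contrast (G x + V x) - contrast (U + V x))"
  define d where "d = \<nu>0 *\<^sub>R E + b *\<^sub>R (contrast (U + V x) - contrast (U + W x))"
  have FF: "flux A G V x - flux A (\<lambda>x. U) W x = d + r"
    by (simp add: flux_def d_def r_def b_def E_def algebra_simps)
  have dE: "m * (norm E)\<^sup>2 \<le> d \<bullet> E" and dn: "norm d \<le> \<nu>0 * norm E"
  proof -
    have d1: "d = T (U + V x) - T (U + W x)" if "b = 1"
      using that by (simp add: d_def E_def contrast_def algebra_simps)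
    have "m * (norm E)\<^sup>2 \<le> \<nu>0 * (norm E)\<^sup>2" using m_le by (intro mult_right_mono) auto
    then show "m * (norm E)\<^sup>2 \<le> d \<bullet> E"
      using b mono[of "U + V x" "U + W x"] d1
      by (auto simp: d_def E_def power2_norm_eq_inner)
    show "norm d \<le> \<nu>0 * norm E"
      using b Lip[of "U + V x" "U + W x"] d1 \<nu>0_pos by (auto simp: d_def E_def)
  qed
  have rn: "norm r \<le> b * (2 * \<nu>0 * norm (U - G x))"
    using b contrast_Lip[of "G x + V x" "U + V x"] by (auto simp: r_def norm_minus_commute)
  have r2: "(norm r)\<^sup>2 \<le> 4 * \<nu>0\<^sup>2 * (b * (norm (U - G x))\<^sup>2)"
  proof -
    have "(norm r)\<^sup>2 \<le> (b * (2 * \<nu>0 * norm (U - G x)))\<^sup>2" using rn by (intro power_mono) auto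
    also have "\<dots> = 4 * \<nu>0\<^sup>2 * (b * (norm (U - G x))\<^sup>2)"
      using b by (auto simp: power_mult_distrib)
    finally show ?thesis .
  qed
  \<comment> \<open>With this weight Young's inequality leaves \<open>m / 4\<close> times \<open>|E|\<^sup>2\<close> from the product with \<open>Y\<close>, as from the one with \<open>r\<close>.\<close>
  define k where "k = m / (8 * \<nu>0\<^sup>2)"
  have k: "0 < k" using m_pos \<nu>0_pos by (simp add: k_def)
  have k2: "2 * k * \<nu>0\<^sup>2 = m / 4" "1 / (4 * k) = 2 * \<nu>0\<^sup>2 / m" "2 * k * (4 * \<nu>0\<^sup>2) = m"
    using m_pos \<nu>0_pos by (simp_all add: k_def field_simps)
  have 1: "E \<bullet> (- r) \<le> (m / 4) * (norm E)\<^sup>2 + (norm r)\<^sup>2 / m"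
    using inner_Young[of "m / 4" E "- r"] m_pos by simp
  have 2: "(d + r) \<bullet> Y \<le> k * (norm (d + r))\<^sup>2 + (norm Y)\<^sup>2 * (1 / (4 * k))"
    using inner_Young[OF k, of "d + r" Y] by simp
  have 3: "k * (norm (d + r))\<^sup>2 \<le> k * (2 * (\<nu>0 * norm E)\<^sup>2 + 2 * (norm r)\<^sup>2)"
  proof (rule mult_left_mono)
    have "(norm d)\<^sup>2 \<le> (\<nu>0 * norm E)\<^sup>2" using dn by (intro power_mono) auto
    then show "(norm (d + r))\<^sup>2 \<le> 2 * (\<nu>0 * norm E)\<^sup>2 + 2 * (norm r)\<^sup>2"
      using norm_add_power2_le[of d r] by linarith
  qed (use k in simp)
  have 4: "k * (2 * (\<nu>0 * norm E)\<^sup>2 + 2 * (norm r)\<^sup>2) = (m / 4) * (norm E)\<^sup>2 + 2 * k * (norm r)\<^sup>2"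
    unfolding k2(1)[symmetric] by (simp add: power_mult_distrib algebra_simps)
  have 5: "(norm r)\<^sup>2 / m + 2 * k * (norm r)\<^sup>2 \<le> (4 * \<nu>0\<^sup>2 / m + m) * (b * (norm (U - G x))\<^sup>2)"
  proof -
    have "(norm r)\<^sup>2 / m + 2 * k * (norm r)\<^sup>2 = (1 / m + 2 * k) * (norm r)\<^sup>2"
      by (simp add: algebra_simps)
    also have "\<dots> \<le> (1 / m + 2 * k) * (4 * \<nu>0\<^sup>2 * (b * (norm (U - G x))\<^sup>2))"
      using r2 k m_pos by (intro mult_left_mono) auto
    also have "\<dots> = (4 * \<nu>0\<^sup>2 / m + 2 * k * (4 * \<nu>0\<^sup>2)) * (b * (norm (U - G x))\<^sup>2)"
      by (simp add: algebra_simps)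
    finally show ?thesis by (simp only: k2(3))
  qed
  have split: "(d + r) \<bullet> (V x - Z x) = d \<bullet> E - E \<bullet> (- r) - (d + r) \<bullet> Y"
    by (simp add: E_def Y_def inner_add_left inner_diff_right inner_diff_left inner_commute algebra_simps)
  have Y: "(norm Y)\<^sup>2 * (1 / (4 * k)) = (2 * \<nu>0\<^sup>2 / m) * (norm Y)\<^sup>2"
    unfolding k2(2) by (rule mult.commute)
  have "(m / 2) * (norm E)\<^sup>2 = m * (norm E)\<^sup>2 - (m / 4) * (norm E)\<^sup>2 - (m / 4) * (norm E)\<^sup>2"
    by (simp add: field_simps)
  then have "(m / 2) * (norm E)\<^sup>2 \<le> ((norm r)\<^sup>2 / m + 2 * k * (norm r)\<^sup>2) + (norm Y)\<^sup>2 * (1 / (4 * k)) + (d + r) \<bullet> (V x - Z x)"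
    using dE 1 2 3 unfolding 4 split by linarith
  then show ?thesis
    unfolding FF Y using 5 unfolding E_def Y_def b_def by linarith
qed

lemma Cea_estimate:
  assumes A: "A \<in> sets borel" "emeasure lborel A < \<infinity>"
    and sq: "square_integrable G" "square_integrable V" "square_integrable W" "square_integrable Z"
    and near: "AE x in lborel. x \<in> A \<longrightarrow> norm (U - G x) \<le> \<sigma>"
    and orth: "(\<integral>x. (flux A G V x - flux A (\<lambda>x. U) W x) \<bullet> (V x - Z x) \<partial>lborel) = 0"
  shows "(m / 2) * (\<integral>x. (norm (V x - W x))\<^sup>2 \<partial>lborel)
     \<le> (4 * \<nu>0\<^sup>2 / m + m) * \<sigma>\<^sup>2 * measure lborel A + (2 * \<nu>0\<^sup>2 / m) * (\<integral>x. (norm (Z x - W x))\<^sup>2 \<partial>lborel)"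
proof -
  let ?c1 = "4 * \<nu>0\<^sup>2 / m + m" and ?c2 = "2 * \<nu>0\<^sup>2 / m"
  have c1: "0 \<le> ?c1" using m_pos by simp
  have i1: "integrable lborel (\<lambda>x. ?c1 * \<sigma>\<^sup>2 * indicat_real A x)"
    using A by (intro integrable_mult_right integrable_real_indicator) auto
  have i2: "integrable lborel (\<lambda>x. ?c2 * (norm (Z x - W x))\<^sup>2)"
    by (intro integrable_mult_right square_integrableD square_integrable_diff sq)
  have i3: "integrable lborel (\<lambda>x. (flux A G V x - flux A (\<lambda>x. U) W x) \<bullet> (V x - Z x))"
    by (intro square_integrable_inner square_integrable_diff square_integrable_flux A sq)
  have "(m / 2) * (\<integral>x. (norm (V x - W x))\<^sup>2 \<partial>lborel) = (\<integral>x. (m / 2) * (norm (V x - W x))\<^sup>2 \<partial>lborel)" by simp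
  also have "\<dots> \<le> (\<integral>x. ?c1 * \<sigma>\<^sup>2 * indicat_real A x + ?c2 * (norm (Z x - W x))\<^sup>2
      + (flux A G V x - flux A (\<lambda>x. U) W x) \<bullet> (V x - Z x) \<partial>lborel)"
  proof (rule integral_mono_AE)
    show "integrable lborel (\<lambda>x. (m / 2) * (norm (V x - W x))\<^sup>2)"
      by (intro integrable_mult_right square_integrableD square_integrable_diff sq)
    show "integrable lborel (\<lambda>x. ?c1 * \<sigma>\<^sup>2 * indicat_real A x + ?c2 * (norm (Z x - W x))\<^sup>2
      + (flux A G V x - flux A (\<lambda>x. U) W x) \<bullet> (V x - Z x))"
      by (intro Bochner_Integration.integrable_add i1 i2 i3)
    show "AE x in lborel. (m / 2) * (norm (V x - W x))\<^sup>2 \<le> ?c1 * \<sigma>\<^sup>2 * indicat_real A x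
      + ?c2 * (norm (Z x - W x))\<^sup>2 + (flux A G V x - flux A (\<lambda>x. U) W x) \<bullet> (V x - Z x)"
      using near
    proof eventually_elim
      case (elim x)
      have "indicat_real A x * (norm (U - G x))\<^sup>2 \<le> \<sigma>\<^sup>2 * indicat_real A x"
        using elim by (auto simp: indicator_def power_mono)
      then have "?c1 * (indicat_real A x * (norm (U - G x))\<^sup>2) \<le> ?c1 * (\<sigma>\<^sup>2 * indicat_real A x)"
        using c1 by (rule mult_left_mono)
      then show ?case using Cea_pointwise[of V x W A U G Z] by (simp only: mult.assoc)
    qed
  qed
  also have "\<dots> = ?c1 * \<sigma>\<^sup>2 * measure lborel A + ?c2 * (\<integral>x. (norm (Z x - W x))\<^sup>2 \<partial>lborel)"
    using i1 i2 i3 orth A by simp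
  finally show ?thesis .
qed

end

text \<open>Test functions are dense in \<open>H01 D\<close>.\<close>

lemma H01_orthogonal:
  assumes D: "open D" and V: "square_integrable V"
    and test: "\<And>\<phi>. test_fun D \<phi> \<Longrightarrow> (\<integral>x. V x \<bullet> grad \<phi> x \<partial>lborel) = 0"
    and \<eta>: "\<eta> \<in> H01 D"
  shows "(\<integral>x. V x \<bullet> ext_grad D \<eta> x \<partial>lborel) = 0"
proof -
  obtain \<phi> where \<phi>: "\<And>n::nat. test_fun D (\<phi> n)"
    "(\<lambda>n. \<integral>x. (norm (ext_grad D \<eta> x - grad (\<phi> n) x))\<^sup>2 \<partial>lborel) \<longlonglongrightarrow> 0"
    by (rule H01_approx[OF D \<eta>]) (rule that; assumption)
  have e: "square_integrable (ext_grad D \<eta>)"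
    by (rule ext_grad_square_integrable[OF D H01_imp_H1[OF \<eta>]])
  have "(\<lambda>n. \<integral>x. grad (\<phi> n) x \<bullet> V x \<partial>lborel) \<longlonglongrightarrow> (\<integral>x. ext_grad D \<eta> x \<bullet> V x \<partial>lborel)"
    using \<phi>(2) by (intro integral_inner_tendsto square_integrable_test_fun(2)[OF \<phi>(1)] e V)
      (simp add: norm_minus_commute)
  moreover have "(\<integral>x. grad (\<phi> n) x \<bullet> V x \<partial>lborel) = 0" for n
    using test[OF \<phi>(1)[of n]] by (simp add: inner_commute)
  ultimately show ?thesis by (simp add: LIMSEQ_const_iff inner_commute)
qed

text \<open>For small \<open>\<epsilon>\<close> the shrunken support of \<open>\<zeta>\<close> fits into \<open>D\<close>; the function \<open>\<epsilon> \<zeta> ((x - x0) / \<epsilon>)\<close> has the rescaled gradient.\<close>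

lemma scaled_test_fun:
  assumes D: "open D" "x0 \<in> D" and t: "test_fun UNIV \<zeta>"
  obtains \<epsilon>1 where "0 < \<epsilon>1"
    "\<And>\<epsilon>. 0 < \<epsilon> \<Longrightarrow> \<epsilon> < \<epsilon>1 \<Longrightarrow> \<exists>\<xi>. test_fun D \<xi> \<and> (\<forall>x. grad \<xi> x = grad \<zeta> ((1 / \<epsilon>) *\<^sub>R (x - x0)))"
proof -
  obtain K where K: "compact K" "\<And>x. x \<notin> K \<Longrightarrow> \<zeta> x = 0" using test_fun_supportE[OF t] by metis
  obtain B where B: "0 < B" "\<And>x. x \<in> K \<Longrightarrow> norm x \<le> B"
    using compact_imp_bounded[OF K(1)] by (auto simp: bounded_pos)
  obtain \<rho> where \<rho>: "0 < \<rho>" "cball x0 \<rho> \<subseteq> D" using D open_contains_cball by blast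
  show thesis
  proof (rule that[of "\<rho> / B"])
    fix \<epsilon> :: real assume \<epsilon>: "0 < \<epsilon>" "\<epsilon> < \<rho> / B"
    have n0: "1 / \<epsilon> \<noteq> 0" using \<epsilon> by simp
    note s = test_fun_affine[OF t n0, of x0]
    let ?\<xi> = "\<lambda>x. \<epsilon> * \<zeta> ((1 / \<epsilon>) *\<^sub>R (x - x0))"
    have t\<xi>: "test_fun UNIV ?\<xi>" by (rule test_fun_cmult[OF s(1)])
    have "test_fun D ?\<xi>"
    proof (rule test_funI[OF test_fun_Ck[OF t\<xi>] compact_cball \<rho>(2)])
      fix x assume "x \<notin> cball x0 \<rho>"
      then have "\<rho> < norm (x - x0)" by (simp add: dist_norm norm_minus_commute)
      moreover have "B * \<epsilon> < \<rho>" using \<epsilon> B by (simp add: field_simps)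
      ultimately have "B * \<epsilon> < norm (x - x0)" by linarith
      then have "B < norm ((1 / \<epsilon>) *\<^sub>R (x - x0))"
        unfolding norm_scaleR using \<epsilon> by (simp add: pos_less_divide_eq)
      then have "(1 / \<epsilon>) *\<^sub>R (x - x0) \<notin> K" using B(2) by fastforce
      then show "?\<xi> x = 0" using K(2) by simp
    qed
    moreover have "grad ?\<xi> x = grad \<zeta> ((1 / \<epsilon>) *\<^sub>R (x - x0))" for x
      using \<epsilon>(1) by (subst grad_test_cmult[OF s(1)]) (simp only: s(2), simp)
    ultimately show "\<exists>\<xi>. test_fun D \<xi> \<and> (\<forall>x. grad \<xi> x = grad \<zeta> ((1 / \<epsilon>) *\<^sub>R (x - x0)))" by blast
  qed (use \<rho> B in simp)
qed

lemma emeasure_ball_finite: "emeasure lborel (ball (z::plane) r) < \<infinity>"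
  using emeasure_lborel_ball_finite by blast

context monotone_law begin

lemma flux_scale:
  assumes \<epsilon>: "0 < \<epsilon>"
  shows "flux (ball x0 \<epsilon>) (\<lambda>x. U) (\<lambda>x. h ((1 / \<epsilon>) *\<^sub>R (x - x0))) x
    = flux (ball 0 1) (\<lambda>x. U) h ((1 / \<epsilon>) *\<^sub>R (x - x0))"
  using mem_ball_scale[OF \<epsilon>, of x x0] unfolding flux_def indicator_def by simp

text \<open>The equation of the corrector at scale \<open>\<epsilon>\<close>, obtained by the change of variables \<open>x = x0 + \<epsilon> y\<close> in the one at scale one.\<close>

lemma flux_scale_orthogonal:
  assumes \<epsilon>: "0 < \<epsilon>" and h: "square_integrable h"
    and eq: "\<And>\<phi>. test_fun UNIV \<phi> \<Longrightarrow> (\<integral>x. flux (ball 0 1) (\<lambda>x. U) h x \<bullet> grad \<phi> x \<partial>lborel) = 0"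
    and t: "test_fun UNIV \<phi>"
  shows "(\<integral>x. flux (ball x0 \<epsilon>) (\<lambda>x. U) (\<lambda>x. h ((1 / \<epsilon>) *\<^sub>R (x - x0))) x \<bullet> grad \<phi> x \<partial>lborel) = 0"
proof -
  have \<epsilon>0: "\<epsilon> \<noteq> 0" using \<epsilon> by simp
  define z where "z = - (1 / \<epsilon>) *\<^sub>R x0"
  define \<psi> where "\<psi> y = \<phi> (\<epsilon> *\<^sub>R (y - z))" for y
  note s = test_fun_affine[OF t \<epsilon>0, of z, folded \<psi>_def]
  have pt: "\<epsilon> *\<^sub>R ((1 / \<epsilon>) *\<^sub>R (x - x0) - z) = x" for x
    using \<epsilon> by (simp add: z_def algebra_simps)
  have gr: "grad \<phi> x = (1 / \<epsilon>) *\<^sub>R grad \<psi> ((1 / \<epsilon>) *\<^sub>R (x - x0))" for x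
    unfolding s(2) pt using \<epsilon> by simp
  let ?F = "flux (ball 0 1) (\<lambda>x. U) h"
  let ?f = "\<lambda>y. (1 / \<epsilon>) * (?F y \<bullet> grad \<psi> y)"
  have Fm [measurable]: "?F \<in> borel_measurable borel"
    using square_integrableD(1)[OF square_integrable_flux(1)[OF h _ emeasure_ball_finite]] by simp
  have gm [measurable]: "grad \<psi> \<in> borel_measurable borel"
    using square_integrableD(1)[OF square_integrable_test_fun(2)[OF s(1)]] by simp
  have "?f \<in> borel_measurable borel" by measurable
  from integral_scale(1)[OF \<epsilon> this, of x0]
  have "(\<integral>x. (1 / \<epsilon>) * (?F ((1 / \<epsilon>) *\<^sub>R (x - x0)) \<bullet> grad \<psi> ((1 / \<epsilon>) *\<^sub>R (x - x0))) \<partial>lborel)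
      = \<epsilon>\<^sup>2 * ((1 / \<epsilon>) * (\<integral>y. ?F y \<bullet> grad \<psi> y \<partial>lborel))" by simp
  also have "\<dots> = 0" using eq[OF s(1)] by simp
  finally show ?thesis unfolding flux_scale[OF \<epsilon>] gr by simp
qed

text \<open>The rescaled corrector does not vanish on the boundary of \<open>D\<close> and is not an admissible comparison function itself. It is
  approximated by the rescaling of a fixed test function \<open>\<zeta>\<close>, whose error in \<open>L\<^sup>2\<close> is \<open>\<epsilon>\<close> times the one at scale one.\<close>

lemma corrector_convergence:
  assumes D: "open D" "x0 \<in> D"
    and h: "square_integrable h"
    and h_rot: "\<And>\<psi>. test_fun UNIV \<psi> \<Longrightarrow> (\<integral>x. h x \<bullet> rot (grad \<psi> x) \<partial>lborel) = 0"
    and h_eq: "\<And>\<phi>. test_fun UNIV \<phi> \<Longrightarrow> (\<integral>x. flux (ball 0 1) (\<lambda>x. U) h x \<bullet> grad \<phi> x \<partial>lborel) = 0"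
    and G: "square_integrable G"
    and near: "\<And>\<sigma>. 0 < \<sigma> \<Longrightarrow> \<exists>\<rho>>0. AE x in lborel. x \<in> ball x0 \<rho> \<longrightarrow> norm (U - G x) \<le> \<sigma>"
    and w: "\<And>\<epsilon>. 0 < \<epsilon> \<Longrightarrow> w \<epsilon> \<in> H01 D"
    and w_eq: "\<And>\<epsilon> \<eta>. 0 < \<epsilon> \<Longrightarrow> ball x0 \<epsilon> \<subseteq> D \<Longrightarrow> \<eta> \<in> H01 D \<Longrightarrow>
       (\<integral>x. flux (ball x0 \<epsilon>) G (ext_grad D (w \<epsilon>)) x \<bullet> ext_grad D \<eta> x \<partial>lborel) = 0"
    and \<delta>: "0 < \<delta>"
  shows "\<exists>\<epsilon>1>0. \<forall>\<epsilon>. 0 < \<epsilon> \<and> \<epsilon> < \<epsilon>1 \<longrightarrow>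
    (\<integral>x. (norm (ext_grad D (w \<epsilon>) x - h ((1 / \<epsilon>) *\<^sub>R (x - x0))))\<^sup>2 \<partial>lborel) \<le> \<delta> * \<epsilon>\<^sup>2"
proof -
  define c1 c2 where "c1 = 4 * \<nu>0\<^sup>2 / m + m" and "c2 = 2 * \<nu>0\<^sup>2 / m"
  have c: "0 < c1" "0 < c2" using m_pos \<nu>0_pos by (auto simp: c1_def c2_def intro!: add_nonneg_pos)
  define \<mu> where "\<mu> = measure lborel (ball (0::plane) 1)"
  have \<mu>: "0 \<le> \<mu>" by (simp add: \<mu>_def)
  define \<delta>1 where "\<delta>1 = m / 4 * \<delta>"
  have \<delta>1: "0 < \<delta>1" using \<delta> m_pos by (simp add: \<delta>1_def)
  define \<sigma> where "\<sigma> = sqrt (\<delta>1 / (c1 * (\<mu> + 1)))"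
  have \<sigma>: "0 < \<sigma>" using \<delta>1 c \<mu> by (simp add: \<sigma>_def)
  have \<sigma>2: "c1 * \<sigma>\<^sup>2 * \<mu> \<le> \<delta>1"
  proof -
    have "\<sigma>\<^sup>2 = \<delta>1 / (c1 * (\<mu> + 1))" unfolding \<sigma>_def using \<delta>1 c \<mu> by (simp add: real_sqrt_pow2)
    then have "c1 * \<sigma>\<^sup>2 * \<mu> = \<delta>1 * (\<mu> / (\<mu> + 1))" using c by simp
    also have "\<dots> \<le> \<delta>1 * 1" using \<delta>1 \<mu> by (intro mult_left_mono) auto
    finally show ?thesis by simp
  qed
  obtain \<zeta> where \<zeta>: "test_fun UNIV \<zeta>" "(\<integral>x. (norm (h x - grad \<zeta> x))\<^sup>2 \<partial>lborel) < \<delta>1 / c2"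
    using curl_free_approx[OF h h_rot, of "\<delta>1 / c2"] \<delta>1 c by auto
  obtain \<rho> where \<rho>: "0 < \<rho>" "AE x in lborel. x \<in> ball x0 \<rho> \<longrightarrow> norm (U - G x) \<le> \<sigma>"
    using near[OF \<sigma>] by blast
  obtain \<rho>' where \<rho>': "0 < \<rho>'" "ball x0 \<rho>' \<subseteq> D" using D openE by blast
  obtain \<epsilon>0 where \<epsilon>0: "0 < \<epsilon>0"
    "\<And>\<epsilon>. 0 < \<epsilon> \<Longrightarrow> \<epsilon> < \<epsilon>0 \<Longrightarrow> \<exists>\<xi>. test_fun D \<xi> \<and> (\<forall>x. grad \<xi> x = grad \<zeta> ((1 / \<epsilon>) *\<^sub>R (x - x0)))"
    by (rule scaled_test_fun[OF D \<zeta>(1)]) (rule that; assumption)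
  show ?thesis
  proof (intro exI[of _ "min \<epsilon>0 (min \<rho> \<rho>')"] conjI allI impI)
    show "0 < min \<epsilon>0 (min \<rho> \<rho>')" using \<epsilon>0(1) \<rho>(1) \<rho>'(1) by simp
    fix \<epsilon> :: real assume "0 < \<epsilon> \<and> \<epsilon> < min \<epsilon>0 (min \<rho> \<rho>')"
    then have \<epsilon>: "0 < \<epsilon>" "\<epsilon> < \<epsilon>0" "\<epsilon> < \<rho>" "\<epsilon> < \<rho>'" by auto
    obtain \<xi> where \<xi>: "test_fun D \<xi>" "\<And>x. grad \<xi> x = grad \<zeta> ((1 / \<epsilon>) *\<^sub>R (x - x0))"
      using \<epsilon>0(2)[OF \<epsilon>(1,2)] by blast
    let ?A = "ball x0 \<epsilon>"
    let ?V = "ext_grad D (w \<epsilon>)"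
    let ?W = "\<lambda>x. h ((1 / \<epsilon>) *\<^sub>R (x - x0))"
    have A: "?A \<in> sets borel" "emeasure lborel ?A < \<infinity>" by (simp, rule emeasure_ball_finite)
    have AD: "?A \<subseteq> D" using \<rho>'(2) \<epsilon>(4) by (meson less_imp_le subset_ball subset_trans)
    have wH: "w \<epsilon> \<in> H01 D" by (rule w[OF \<epsilon>(1)])
    have V: "square_integrable ?V" by (rule ext_grad_square_integrable[OF D(1) H01_imp_H1[OF wH]])
    have W: "square_integrable ?W" by (rule square_integrable_scale[OF \<epsilon>(1) h])
    have Z: "square_integrable (grad \<xi>)" by (rule square_integrable_test_fun(2)[OF \<xi>(1)])
    have F1: "square_integrable (flux ?A G ?V)" by (rule square_integrable_flux(2)[OF V A G])
    have F2: "square_integrable (flux ?A (\<lambda>x. U) ?W)" by (rule square_integrable_flux(1)[OF W A])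
    have F2_test: "(\<integral>x. flux ?A (\<lambda>x. U) ?W x \<bullet> grad \<phi> x \<partial>lborel) = 0" if "test_fun D \<phi>" for \<phi>
      by (rule flux_scale_orthogonal[OF \<epsilon>(1) h h_eq test_fun_mono[OF that subset_UNIV]])
    have F1_test: "(\<integral>x. flux ?A G ?V x \<bullet> grad \<xi> x \<partial>lborel) = 0"
    proof -
      note p = test_fun_H1[OF D(1) \<xi>(1)]
      have "(\<integral>x. flux ?A G ?V x \<bullet> grad \<xi> x \<partial>lborel) = (\<integral>x. flux ?A G ?V x \<bullet> ext_grad D \<xi> x \<partial>lborel)"
      proof (rule integral_cong_AE)
        show "AE x in lborel. flux ?A G ?V x \<bullet> grad \<xi> x = flux ?A G ?V x \<bullet> ext_grad D \<xi> x"
          using p(2) by eventually_elim simp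
      qed (intro borel_measurable_inner square_integrableD(1) F1 Z ext_grad_square_integrable[OF D(1) p(1)])+
      then show ?thesis using w_eq[OF \<epsilon>(1) AD test_fun_H01[OF D(1) \<xi>(1)]] by simp
    qed
    have orth: "(\<integral>x. (flux ?A G ?V x - flux ?A (\<lambda>x. U) ?W x) \<bullet> (?V x - grad \<xi> x) \<partial>lborel) = 0"
    proof -
      have 1: "(\<integral>x. flux ?A G ?V x \<bullet> ?V x \<partial>lborel) = 0" by (rule w_eq[OF \<epsilon>(1) AD wH])
      have 2: "(\<integral>x. flux ?A (\<lambda>x. U) ?W x \<bullet> ?V x \<partial>lborel) = 0"
        by (rule H01_orthogonal[OF D(1) F2 F2_test wH])
      show ?thesis
        unfolding inner_diff_left inner_diff_right
        using square_integrable_inner[OF F1 V] square_integrable_inner[OF F1 Z]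
          square_integrable_inner[OF F2 V] square_integrable_inner[OF F2 Z] 1 2 F1_test F2_test[OF \<xi>(1)]
        by simp
    qed
    have near': "AE x in lborel. x \<in> ?A \<longrightarrow> norm (U - G x) \<le> \<sigma>"
      using \<rho>(2) by eventually_elim (use \<epsilon>(3) in auto)
    have Zd: "(\<integral>x. (norm (grad \<xi> x - ?W x))\<^sup>2 \<partial>lborel) \<le> \<epsilon>\<^sup>2 * (\<delta>1 / c2)"
    proof -
      have [measurable]: "h \<in> borel_measurable borel" "grad \<zeta> \<in> borel_measurable borel"
        using h square_integrable_test_fun(2)[OF \<zeta>(1)] by (auto simp: square_integrable_def)
      have "(\<lambda>y. (norm (h y - grad \<zeta> y))\<^sup>2) \<in> borel_measurable borel" by measurable
      from integral_scale(1)[OF \<epsilon>(1) this, of x0]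
      have "(\<integral>x. (norm (grad \<xi> x - ?W x))\<^sup>2 \<partial>lborel) = \<epsilon>\<^sup>2 * (\<integral>y. (norm (h y - grad \<zeta> y))\<^sup>2 \<partial>lborel)"
        by (simp add: \<xi>(2) norm_minus_commute)
      also have "\<dots> \<le> \<epsilon>\<^sup>2 * (\<delta>1 / c2)" using \<zeta>(2) by (intro mult_left_mono) auto
      finally show ?thesis .
    qed
    have "(m / 2) * (\<integral>x. (norm (?V x - ?W x))\<^sup>2 \<partial>lborel)
       \<le> c1 * \<sigma>\<^sup>2 * measure lborel ?A + c2 * (\<integral>x. (norm (grad \<xi> x - ?W x))\<^sup>2 \<partial>lborel)"
      unfolding c1_def c2_def by (rule Cea_estimate[OF A G V W Z near' orth])
    also have "\<dots> \<le> \<delta>1 * \<epsilon>\<^sup>2 + \<delta>1 * \<epsilon>\<^sup>2"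
    proof (rule add_mono)
      have "c1 * \<sigma>\<^sup>2 * measure lborel ?A = (c1 * \<sigma>\<^sup>2 * \<mu>) * \<epsilon>\<^sup>2"
        by (simp add: measure_ball_scale[OF \<epsilon>(1)] \<mu>_def mult_ac)
      also have "\<dots> \<le> \<delta>1 * \<epsilon>\<^sup>2" using \<sigma>2 by (rule mult_right_mono) simp
      finally show "c1 * \<sigma>\<^sup>2 * measure lborel ?A \<le> \<delta>1 * \<epsilon>\<^sup>2" .
      have "c2 * (\<integral>x. (norm (grad \<xi> x - ?W x))\<^sup>2 \<partial>lborel) \<le> c2 * (\<epsilon>\<^sup>2 * (\<delta>1 / c2))"
        using Zd c by (intro mult_left_mono) auto
      then show "c2 * (\<integral>x. (norm (grad \<xi> x - ?W x))\<^sup>2 \<partial>lborel) \<le> \<delta>1 * \<epsilon>\<^sup>2"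
        using c by (simp add: mult_ac)
    qed
    also have "\<dots> = (m / 2) * (\<delta> * \<epsilon>\<^sup>2)" by (simp add: \<delta>1_def)
    finally show "(\<integral>x. (norm (?V x - ?W x))\<^sup>2 \<partial>lborel) \<le> \<delta> * \<epsilon>\<^sup>2"
      using m_pos by simp
  qed
qed

end

lemma le_add_square_divide:
  assumes "0 < t" "0 \<le> e" shows "e \<le> t + e\<^sup>2 / (t::real)"
proof -
  have "2 * (e * t) \<le> e\<^sup>2 + t\<^sup>2" using sum_squares_bound[of e t] by (simp add: mult.assoc)
  moreover have "0 \<le> e * t" using assms by simp
  ultimately have "e * t \<le> e\<^sup>2 + t\<^sup>2" by linarith
  then have "e \<le> (e\<^sup>2 + t\<^sup>2) / t" using assms by (simp add: pos_le_divide_eq)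
  then show ?thesis using assms by (simp add: add_divide_distrib power2_eq_square)
qed

context monotone_law begin

text \<open>The inclusion has measure of order \<open>\<epsilon>\<^sup>2\<close>, and both backgrounds \<open>G\<close> and \<open>q\<close> are within \<open>\<tau>\<close> of constants on it. The error
  \<open>|V \<epsilon> - h\<^sub>\<epsilon>|\<close> enters linearly; it is split as \<open>\<tau> + |V \<epsilon> - h\<^sub>\<epsilon>|\<^sup>2 / \<tau>\<close>, which needs the squared error to be at most \<open>\<tau>\<^sup>2 \<epsilon>\<^sup>2\<close>.\<close>

lemma contrast_integral_expansion:
  fixes h G q :: "plane \<Rightarrow> plane" and V :: "real \<Rightarrow> plane \<Rightarrow> plane"
  assumes h: "square_integrable h" and G: "square_integrable G" and q: "square_integrable q"
    and V: "\<And>\<epsilon>. 0 < \<epsilon> \<Longrightarrow> square_integrable (V \<epsilon>)"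
    and G_near: "\<And>\<sigma>. 0 < \<sigma> \<Longrightarrow> \<exists>\<rho>>0. AE x in lborel. x \<in> ball x0 \<rho> \<longrightarrow> norm (U - G x) \<le> \<sigma>"
    and q_near: "\<And>\<sigma>. 0 < \<sigma> \<Longrightarrow> \<exists>\<rho>>0. AE x in lborel. x \<in> ball x0 \<rho> \<longrightarrow> norm (P - q x) \<le> \<sigma>"
    and conv: "\<And>\<delta>. 0 < \<delta> \<Longrightarrow> \<exists>\<epsilon>1>0. \<forall>\<epsilon>. 0 < \<epsilon> \<and> \<epsilon> < \<epsilon>1 \<longrightarrow>
      (\<integral>x. (norm (V \<epsilon> x - h ((1 / \<epsilon>) *\<^sub>R (x - x0))))\<^sup>2 \<partial>lborel) \<le> \<delta> * \<epsilon>\<^sup>2"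
    and \<delta>: "0 < \<delta>"
  shows "\<exists>\<epsilon>1>0. \<forall>\<epsilon>. 0 < \<epsilon> \<and> \<epsilon> < \<epsilon>1 \<longrightarrow>
    \<bar>(\<integral>x. (indicat_real (ball x0 \<epsilon>) x *\<^sub>R contrast (G x + V \<epsilon> x)) \<bullet> q x \<partial>lborel)
      - \<epsilon>\<^sup>2 * (\<integral>y. (indicat_real (ball 0 1) y *\<^sub>R contrast (U + h y)) \<bullet> P \<partial>lborel)\<bar> \<le> \<delta> * \<epsilon>\<^sup>2"
proof -
  define \<mu> where "\<mu> = measure lborel (ball (0::plane) 1)"
  define I where "I = (\<integral>y. norm (indicat_real (ball 0 1) y *\<^sub>R contrast (U + h y)) \<partial>lborel)"
  define p where "p = norm P + 1"
  have pos: "0 \<le> \<mu>" "0 \<le> I" "1 \<le> p" by (simp_all add: \<mu>_def I_def p_def)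
  define C where "C = 4 * \<nu>0 * p * \<mu> + 2 * \<nu>0 * p + I"
  have C: "0 \<le> C" using pos \<nu>0_pos by (simp add: C_def)
  define \<tau> where "\<tau> = min 1 (\<delta> / (C + 1))"
  have \<tau>: "0 < \<tau>" "\<tau> \<le> 1" using \<delta> C by (auto simp: \<tau>_def)
  have \<tau>C: "\<tau> * C \<le> \<delta>"
  proof -
    have "\<tau> * C \<le> \<delta> / (C + 1) * (C + 1)" using \<tau> C by (intro mult_mono) (auto simp: \<tau>_def)
    then show ?thesis using C by simp
  qed
  obtain \<rho>1 where \<rho>1: "0 < \<rho>1" "AE x in lborel. x \<in> ball x0 \<rho>1 \<longrightarrow> norm (U - G x) \<le> \<tau>"
    using G_near[OF \<tau>(1)] by blast
  obtain \<rho>2 where \<rho>2: "0 < \<rho>2" "AE x in lborel. x \<in> ball x0 \<rho>2 \<longrightarrow> norm (P - q x) \<le> \<tau>"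
    using q_near[OF \<tau>(1)] by blast
  have "0 < \<tau>\<^sup>2" using \<tau> by simp
  from conv[OF this] obtain \<epsilon>0 where \<epsilon>0: "0 < \<epsilon>0" "\<And>\<epsilon>. 0 < \<epsilon> \<Longrightarrow> \<epsilon> < \<epsilon>0 \<Longrightarrow>
      (\<integral>x. (norm (V \<epsilon> x - h ((1 / \<epsilon>) *\<^sub>R (x - x0))))\<^sup>2 \<partial>lborel) \<le> \<tau>\<^sup>2 * \<epsilon>\<^sup>2" by blast
  show ?thesis
  proof (intro exI[of _ "min \<epsilon>0 (min \<rho>1 \<rho>2)"] conjI allI impI)
    show "0 < min \<epsilon>0 (min \<rho>1 \<rho>2)" using \<epsilon>0(1) \<rho>1(1) \<rho>2(1) by simp
    fix \<epsilon> :: real assume "0 < \<epsilon> \<and> \<epsilon> < min \<epsilon>0 (min \<rho>1 \<rho>2)"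
    then have \<epsilon>: "0 < \<epsilon>" "\<epsilon> < \<epsilon>0" "\<epsilon> < \<rho>1" "\<epsilon> < \<rho>2" by auto
    let ?A = "ball x0 \<epsilon>"
    let ?W = "\<lambda>x. h ((1 / \<epsilon>) *\<^sub>R (x - x0))"
    let ?X = "\<integral>x. (norm (V \<epsilon> x - ?W x))\<^sup>2 \<partial>lborel"
    let ?F = "\<lambda>x. indicat_real ?A x *\<^sub>R contrast (G x + V \<epsilon> x)"
    let ?Q = "\<lambda>x. indicat_real ?A x *\<^sub>R contrast (U + ?W x)"
    let ?H = "\<lambda>y. indicat_real (ball 0 1) y *\<^sub>R contrast (U + h y)"
    have A: "?A \<in> sets borel" "emeasure lborel ?A < \<infinity>" using emeasure_ball_finite[of x0 \<epsilon>] by simp_all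
    have W: "square_integrable ?W" by (rule square_integrable_scale[OF \<epsilon>(1) h])
    have F: "square_integrable ?F"
      using square_integrable_contrast[OF square_integrable_add[OF G V[OF \<epsilon>(1)]] A, of 0] by simp
    have F0: "square_integrable ?Q" by (rule square_integrable_contrast[OF W A])
    have "set_integrable lborel ?A ?Q" by (rule square_integrable_imp_set_integrable[OF F0 A])
    moreover have "(\<lambda>x. indicat_real ?A x *\<^sub>R ?Q x) = ?Q" by (auto simp: indicator_def)
    ultimately have iF0: "integrable lborel ?Q" unfolding set_integrable_def by (simp only:)
    have hm [measurable]: "h \<in> borel_measurable borel" using h by (simp add: square_integrable_def)
    have b1: "ball (0::plane) 1 \<in> sets borel" by simp
    have Hm: "?H \<in> borel_measurable borel" using b1 by measurable
    have F0H: "?Q x = ?H ((1 / \<epsilon>) *\<^sub>R (x - x0))" for x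
      using mem_ball_scale[OF \<epsilon>(1), of x x0] unfolding indicator_def by simp
    have scaleP: "(\<integral>x. ?Q x \<bullet> P \<partial>lborel) = \<epsilon>\<^sup>2 * (\<integral>y. ?H y \<bullet> P \<partial>lborel)"
    proof -
      have "(\<lambda>y. ?H y \<bullet> P) \<in> borel_measurable borel" using Hm by (intro borel_measurable_inner) auto
      from integral_scale(1)[OF \<epsilon>(1) this, of x0] show ?thesis unfolding F0H by simp
    qed
    have scaleN: "(\<integral>x. norm (?Q x) \<partial>lborel) = \<epsilon>\<^sup>2 * I"
    proof -
      have "(\<lambda>y. norm (?H y)) \<in> borel_measurable borel" by (rule measurable_compose[OF Hm borel_measurable_norm])
      from integral_scale(1)[OF \<epsilon>(1) this, of x0] show ?thesis unfolding F0H I_def by simp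
    qed
    have iFq: "integrable lborel (\<lambda>x. ?F x \<bullet> q x)" by (rule square_integrable_inner[OF F q])
    have iF0P: "integrable lborel (\<lambda>x. ?Q x \<bullet> P)" by (rule integrable_inner_left[OF iF0])
    have iE: "integrable lborel (\<lambda>x. (norm (V \<epsilon> x - ?W x))\<^sup>2)"
      by (intro square_integrableD square_integrable_diff V \<epsilon> W)
    have iA: "integrable lborel (\<lambda>x. indicat_real ?A x)" using A by (intro integrable_real_indicator) auto
    define c where "c = 2 * \<nu>0 * p"
    have c: "0 \<le> c" using pos \<nu>0_pos by (simp add: c_def)
    have bound: "AE x in lborel. norm (?F x \<bullet> q x - ?Q x \<bullet> P)
        \<le> c * 2 * \<tau> * indicat_real ?A x + c / \<tau> * (norm (V \<epsilon> x - ?W x))\<^sup>2 + \<tau> * norm (?Q x)"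
      using \<rho>1(2) \<rho>2(2)
    proof eventually_elim
      case (elim x)
      show ?case
      proof (cases "x \<in> ?A")
        case False
        then show ?thesis using c \<tau> by simp
      next
        case True
        let ?e = "norm (V \<epsilon> x - ?W x)"
        have g: "norm (U - G x) \<le> \<tau>" and qd: "norm (P - q x) \<le> \<tau>" using elim True \<epsilon> by auto
        have "norm (q x) \<le> norm P + norm (P - q x)" using norm_triangle_ineq4[of P "P - q x"] by simp
        then have qp: "norm (q x) \<le> p" using qd \<tau> by (simp add: p_def)
        have "norm ((G x + V \<epsilon> x) - (U + ?W x)) \<le> norm (U - G x) + ?e"
        proof -
          have eq: "(G x + V \<epsilon> x) - (U + ?W x) = (V \<epsilon> x - ?W x) - (U - G x)" by simp
          show ?thesis unfolding eq by (metis add.commute norm_triangle_ineq4)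
        qed
        then have "norm ((G x + V \<epsilon> x) - (U + ?W x)) \<le> \<tau> + ?e" using g by simp
        moreover have "?e \<le> \<tau> + ?e\<^sup>2 / \<tau>"
          by (rule le_add_square_divide) (use \<tau> in simp_all)
        ultimately have arg: "norm ((G x + V \<epsilon> x) - (U + ?W x)) \<le> 2 * \<tau> + ?e\<^sup>2 / \<tau>" by simp
        have "norm (contrast (G x + V \<epsilon> x) - contrast (U + ?W x)) \<le> 2 * \<nu>0 * (2 * \<tau> + ?e\<^sup>2 / \<tau>)"
          by (rule order_trans[OF contrast_Lip mult_left_mono[OF arg]]) (use \<nu>0_pos in simp)
        then have m1: "norm (contrast (G x + V \<epsilon> x) - contrast (U + ?W x)) * norm (q x)
            \<le> (2 * \<nu>0 * (2 * \<tau> + ?e\<^sup>2 / \<tau>)) * p"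
          using qp \<nu>0_pos \<tau> by (intro mult_mono) auto
        have 1: "\<bar>(contrast (G x + V \<epsilon> x) - contrast (U + ?W x)) \<bullet> q x\<bar> \<le> c * (2 * \<tau> + ?e\<^sup>2 / \<tau>)"
        proof -
          have "(2 * \<nu>0 * (2 * \<tau> + ?e\<^sup>2 / \<tau>)) * p = c * (2 * \<tau> + ?e\<^sup>2 / \<tau>)"
            unfolding c_def by (simp only: mult_ac)
          then show ?thesis using order_trans[OF Cauchy_Schwarz_ineq2 m1] by (simp only:)
        qed
        have qd': "norm (q x - P) \<le> \<tau>" using qd by (simp only: norm_minus_commute)
        have 2: "\<bar>contrast (U + ?W x) \<bullet> (q x - P)\<bar> \<le> norm (contrast (U + ?W x)) * \<tau>"
          by (rule order_trans[OF Cauchy_Schwarz_ineq2 mult_left_mono[OF qd']]) simp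
        have "?F x \<bullet> q x - ?Q x \<bullet> P = (contrast (G x + V \<epsilon> x) - contrast (U + ?W x)) \<bullet> q x
            + contrast (U + ?W x) \<bullet> (q x - P)"
          using True by (simp add: inner_diff_left inner_diff_right)
        then have "\<bar>?F x \<bullet> q x - ?Q x \<bullet> P\<bar> \<le> c * (2 * \<tau> + ?e\<^sup>2 / \<tau>) + norm (contrast (U + ?W x)) * \<tau>"
          using order_trans[OF abs_triangle_ineq add_mono[OF 1 2]] by (simp only:)
        then show ?thesis using True by (simp add: algebra_simps)
      qed
    qed
    have "\<bar>(\<integral>x. ?F x \<bullet> q x \<partial>lborel) - (\<integral>x. ?Q x \<bullet> P \<partial>lborel)\<bar> = norm (\<integral>x. ?F x \<bullet> q x - ?Q x \<bullet> P \<partial>lborel)"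
      using iFq iF0P by simp
    also have "\<dots> \<le> (\<integral>x. c * 2 * \<tau> * indicat_real ?A x + c / \<tau> * (norm (V \<epsilon> x - ?W x))\<^sup>2 + \<tau> * norm (?Q x) \<partial>lborel)"
    proof (rule order_trans[OF integral_norm_bound integral_mono_AE])
      show "integrable lborel (\<lambda>x. c * 2 * \<tau> * indicat_real ?A x + c / \<tau> * (norm (V \<epsilon> x - ?W x))\<^sup>2 + \<tau> * norm (?Q x))"
        by (intro Bochner_Integration.integrable_add integrable_mult_right iA iE integrable_norm iF0)
      show "AE x in lborel. norm (?F x \<bullet> q x - ?Q x \<bullet> P)
        \<le> c * 2 * \<tau> * indicat_real ?A x + c / \<tau> * (norm (V \<epsilon> x - ?W x))\<^sup>2 + \<tau> * norm (?Q x)" by (rule bound)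
      show "integrable lborel (\<lambda>x. norm (?F x \<bullet> q x - ?Q x \<bullet> P))"
        by (intro integrable_norm Bochner_Integration.integrable_diff iFq iF0P)
    qed
    also have "\<dots> = c * 2 * \<tau> * measure lborel ?A + c / \<tau> * ?X + \<tau> * (\<integral>x. norm (?Q x) \<partial>lborel)"
      using iA iE integrable_norm[OF iF0] A by simp
    also have "\<dots> \<le> c * 2 * \<tau> * (\<epsilon>\<^sup>2 * \<mu>) + c / \<tau> * (\<tau>\<^sup>2 * \<epsilon>\<^sup>2) + \<tau> * (\<epsilon>\<^sup>2 * I)"
      unfolding scaleN measure_ball_scale[OF \<epsilon>(1)] \<mu>_def[symmetric]
      using \<epsilon>0(2)[OF \<epsilon>(1,2)] c \<tau> by (intro add_mono mult_left_mono order_refl) auto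
    also have "\<dots> = \<tau> * C * \<epsilon>\<^sup>2"
    proof -
      have "c / \<tau> * (\<tau>\<^sup>2 * \<epsilon>\<^sup>2) = \<tau> * c * \<epsilon>\<^sup>2" using \<tau> by (simp add: power2_eq_square)
      then show ?thesis by (simp add: C_def c_def algebra_simps)
    qed
    also have "\<dots> \<le> \<delta> * \<epsilon>\<^sup>2" using \<tau>C by (rule mult_right_mono) simp
    finally show "\<bar>(\<integral>x. ?F x \<bullet> q x \<partial>lborel) - \<epsilon>\<^sup>2 * (\<integral>y. ?H y \<bullet> P \<partial>lborel)\<bar> \<le> \<delta> * \<epsilon>\<^sup>2"
      unfolding scaleP .
  qed
qed

end

lemma square_integrable_tail:
  fixes h :: "plane \<Rightarrow> plane"
  assumes h: "square_integrable h" and \<delta>: "0 < \<delta>"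
  obtains N :: real where "0 < N" "(\<integral>y. indicat_real (- ball 0 N) y * (norm (h y))\<^sup>2 \<partial>lborel) < \<delta>"
proof -
  have [measurable]: "h \<in> borel_measurable borel" using h by (simp add: square_integrable_def)
  have [measurable]: "- ball (0::plane) r \<in> sets borel" for r by simp
  have "(\<lambda>n. \<integral>y. indicat_real (- ball 0 (real n)) y * (norm (h y))\<^sup>2 \<partial>lborel) \<longlonglongrightarrow> (\<integral>y. 0 \<partial>(lborel::plane measure))"
  proof (rule integral_dominated_convergence[where w="\<lambda>y. (norm (h y))\<^sup>2"])
    show "AE y in lborel. (\<lambda>n. indicat_real (- ball 0 (real n)) y * (norm (h y))\<^sup>2) \<longlonglongrightarrow> 0"
    proof (rule AE_I2)
      fix y :: plane
      obtain n0 :: nat where "norm y < real n0" using reals_Archimedean2 by blast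
      then have "indicat_real (- ball 0 (real n)) y * (norm (h y))\<^sup>2 = 0" if "n0 \<le> n" for n
        using that by (simp add: indicator_def)
      then have "eventually (\<lambda>n. indicat_real (- ball 0 (real n)) y * (norm (h y))\<^sup>2 = 0) sequentially"
        by (rule eventually_sequentiallyI)
      then show "(\<lambda>n. indicat_real (- ball 0 (real n)) y * (norm (h y))\<^sup>2) \<longlonglongrightarrow> 0"
        by (rule tendsto_eventually)
    qed
    show "integrable lborel (\<lambda>y. (norm (h y))\<^sup>2)" by (rule square_integrableD(2)[OF h])
    show "AE y in lborel. norm (indicat_real (- ball 0 (real n)) y * (norm (h y))\<^sup>2) \<le> (norm (h y))\<^sup>2" for n
      by (intro AE_I2) (simp add: indicator_def)
  qed measurable
  then have "(\<lambda>n. \<integral>y. indicat_real (- ball 0 (real n)) y * (norm (h y))\<^sup>2 \<partial>lborel) \<longlonglongrightarrow> 0" by simp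
  then have "eventually (\<lambda>n. (\<integral>y. indicat_real (- ball 0 (real n)) y * (norm (h y))\<^sup>2 \<partial>lborel) < \<delta>) sequentially"
    using \<delta> by (rule order_tendstoD)
  then obtain M where M: "\<And>n. M \<le> n \<Longrightarrow> (\<integral>y. indicat_real (- ball 0 (real n)) y * (norm (h y))\<^sup>2 \<partial>lborel) < \<delta>"
    unfolding eventually_sequentially by blast
  show thesis by (rule that[of "real (Suc M)"]) (use M[of "Suc M"] in auto)
qed

text \<open>The disc of radius \<open>\<alpha> \<epsilon>\<^sup>r\<close> becomes arbitrarily large in units of \<open>\<epsilon>\<close>, because \<open>r < 1\<close>. Outside of it only the tail of \<open>h\<close> and the
  approximation error are left.\<close>

lemma far_energy_small:
  fixes h :: "plane \<Rightarrow> plane" and V :: "real \<Rightarrow> plane \<Rightarrow> plane"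
  assumes h: "square_integrable h" and V: "\<And>\<epsilon>. 0 < \<epsilon> \<Longrightarrow> square_integrable (V \<epsilon>)"
    and conv: "\<And>\<delta>. 0 < \<delta> \<Longrightarrow> \<exists>\<epsilon>1>0. \<forall>\<epsilon>. 0 < \<epsilon> \<and> \<epsilon> < \<epsilon>1 \<longrightarrow>
      (\<integral>x. (norm (V \<epsilon> x - h ((1 / \<epsilon>) *\<^sub>R (x - x0))))\<^sup>2 \<partial>lborel) \<le> \<delta> * \<epsilon>\<^sup>2"
    and \<alpha>: "0 < \<alpha>" and r: "0 < r" "r < 1" and \<delta>: "0 < \<delta>"
  shows "\<exists>\<epsilon>1>0. \<forall>\<epsilon>. 0 < \<epsilon> \<and> \<epsilon> < \<epsilon>1 \<longrightarrow>
    (\<integral>x. indicat_real (- ball x0 (\<alpha> * \<epsilon> powr r)) x * (norm (V \<epsilon> x))\<^sup>2 \<partial>lborel) \<le> \<delta> * \<epsilon>\<^sup>2"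
proof -
  have \<delta>4: "0 < \<delta> / 4" using \<delta> by simp
  obtain N where N: "0 < N" "(\<integral>y. indicat_real (- ball 0 N) y * (norm (h y))\<^sup>2 \<partial>lborel) < \<delta> / 4"
    by (rule square_integrable_tail[OF h \<delta>4])
  obtain \<epsilon>0 where \<epsilon>0: "0 < \<epsilon>0" "\<And>\<epsilon>. 0 < \<epsilon> \<Longrightarrow> \<epsilon> < \<epsilon>0 \<Longrightarrow>
      (\<integral>x. (norm (V \<epsilon> x - h ((1 / \<epsilon>) *\<^sub>R (x - x0))))\<^sup>2 \<partial>lborel) \<le> \<delta> / 4 * \<epsilon>\<^sup>2"
    using conv[OF \<delta>4] by blast
  \<comment> \<open>Below this threshold \<open>N \<epsilon> \<le> \<alpha> \<epsilon>\<^sup>r\<close>.\<close>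
  define \<epsilon>2 where "\<epsilon>2 = (\<alpha> / N) powr (1 / (1 - r))"
  have \<epsilon>2: "0 < \<epsilon>2" using \<alpha> N by (simp add: \<epsilon>2_def)
  show ?thesis
  proof (intro exI[of _ "min \<epsilon>0 \<epsilon>2"] conjI allI impI)
    show "0 < min \<epsilon>0 \<epsilon>2" using \<epsilon>0(1) \<epsilon>2 by simp
    fix \<epsilon> :: real assume "0 < \<epsilon> \<and> \<epsilon> < min \<epsilon>0 \<epsilon>2"
    then have \<epsilon>: "0 < \<epsilon>" "\<epsilon> < \<epsilon>0" "\<epsilon> < \<epsilon>2" by auto
    have "\<epsilon> powr (1 - r) \<le> \<epsilon>2 powr (1 - r)" using \<epsilon> r by (intro powr_mono2) auto
    also have "\<dots> = \<alpha> / N" using \<alpha> N r by (simp add: \<epsilon>2_def powr_powr)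
    finally have "N * \<epsilon> powr (1 - r) \<le> \<alpha>" using N by (simp add: field_simps)
    then have "(N * \<epsilon> powr (1 - r)) * \<epsilon> powr r \<le> \<alpha> * \<epsilon> powr r" by (intro mult_right_mono) auto
    moreover have "\<epsilon> powr (1 - r) * \<epsilon> powr r = \<epsilon>" using \<epsilon>(1) by (simp add: powr_add[symmetric])
    ultimately have rad: "N * \<epsilon> \<le> \<alpha> * \<epsilon> powr r" by (simp add: mult.assoc)
    let ?B = "- ball x0 (\<alpha> * \<epsilon> powr r)"
    let ?W = "\<lambda>x. h ((1 / \<epsilon>) *\<^sub>R (x - x0))"
    let ?g = "\<lambda>y. indicat_real (- ball 0 N) y * (norm (h y))\<^sup>2"
    have [measurable]: "h \<in> borel_measurable borel" using h by (simp add: square_integrable_def)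
    have [measurable]: "- ball (0::plane) N \<in> sets borel" by simp
    have gm: "?g \<in> borel_measurable borel" by measurable
    have gi: "integrable lborel ?g"
    proof (rule Bochner_Integration.integrable_bound[OF square_integrableD(2)[OF h]])
      show "AE y in lborel. norm (?g y) \<le> norm ((norm (h y))\<^sup>2)" by (intro AE_I2) (simp add: indicator_def)
    qed (use gm in simp)
    note gs = integral_scale[OF \<epsilon>(1) gm, of x0]
    have iE: "integrable lborel (\<lambda>x. (norm (V \<epsilon> x - ?W x))\<^sup>2)"
      by (intro square_integrableD square_integrable_diff V \<epsilon> square_integrable_scale h)
    have pt: "indicat_real ?B x * (norm (V \<epsilon> x))\<^sup>2 \<le> 2 * (norm (V \<epsilon> x - ?W x))\<^sup>2 + 2 * ?g ((1 / \<epsilon>) *\<^sub>R (x - x0))" for x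
    proof (cases "x \<in> ?B")
      case False
      then show ?thesis by simp
    next
      case True
      then have "\<alpha> * \<epsilon> powr r \<le> norm (x - x0)" by (simp add: dist_norm norm_minus_commute)
      then have "N * \<epsilon> \<le> norm (x - x0)" using rad by linarith
      then have "N \<le> norm ((1 / \<epsilon>) *\<^sub>R (x - x0))"
        unfolding norm_scaleR using \<epsilon>(1) by (simp add: pos_le_divide_eq)
      then have "(1 / \<epsilon>) *\<^sub>R (x - x0) \<in> - ball 0 N" by (simp only: Compl_iff mem_ball dist_0_norm not_less)
      then show ?thesis
        using True norm_add_power2_le[of "V \<epsilon> x - ?W x" "?W x"] by simp
    qed
    have "(\<integral>x. indicat_real ?B x * (norm (V \<epsilon> x))\<^sup>2 \<partial>lborel)
        \<le> (\<integral>x. 2 * (norm (V \<epsilon> x - ?W x))\<^sup>2 + 2 * ?g ((1 / \<epsilon>) *\<^sub>R (x - x0)) \<partial>lborel)"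
    proof (rule integral_mono)
      have Bm: "?B \<in> sets lborel" by simp
      show "integrable lborel (\<lambda>x. indicat_real ?B x * (norm (V \<epsilon> x))\<^sup>2)"
        using integrable_mult_indicator[OF Bm square_integrableD(2)[OF V[OF \<epsilon>(1)]]] by simp
      show "integrable lborel (\<lambda>x. 2 * (norm (V \<epsilon> x - ?W x))\<^sup>2 + 2 * ?g ((1 / \<epsilon>) *\<^sub>R (x - x0)))"
        by (intro Bochner_Integration.integrable_add integrable_mult_right iE gs(2) gi)
    qed (rule pt)
    also have "\<dots> = 2 * (\<integral>x. (norm (V \<epsilon> x - ?W x))\<^sup>2 \<partial>lborel) + 2 * (\<integral>x. ?g ((1 / \<epsilon>) *\<^sub>R (x - x0)) \<partial>lborel)"
      using integrable_mult_right[OF iE, of 2] integrable_mult_right[OF gs(2)[OF gi], of 2]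
      by (subst Bochner_Integration.integral_add) (simp_all only: integral_mult_right_zero)
    also have "\<dots> \<le> 2 * (\<delta> / 4 * \<epsilon>\<^sup>2) + 2 * (\<epsilon>\<^sup>2 * (\<delta> / 4))"
      unfolding gs(1) real_scaleR_def using \<epsilon>0(2)[OF \<epsilon>(1,2)] N(2)
      by (intro add_mono mult_left_mono) auto
    also have "\<dots> = \<delta> * \<epsilon>\<^sup>2" by simp
    finally show "(\<integral>x. indicat_real ?B x * (norm (V \<epsilon> x))\<^sup>2 \<partial>lborel) \<le> \<delta> * \<epsilon>\<^sup>2" .
  qed
qed

section \<open>The corrector equations and the polarisation identity\<close>

lemma Hquot_orthogonal_test:
  assumes F: "square_integrable F" and X: "\<And>X. X \<in> Hquot \<Longrightarrow> (\<integral>x. F x \<bullet> cgrad X x \<partial>lborel) = 0"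
    and t: "test_fun UNIV \<phi>"
  shows "(\<integral>x. F x \<bullet> grad \<phi> x \<partial>lborel) = 0"
proof -
  obtain Y where Y: "Y \<in> Hquot" "AE x in lborel. cgrad Y x = grad \<phi> x" by (rule test_fun_represents_class[OF t])
  have "(\<integral>x. F x \<bullet> grad \<phi> x \<partial>lborel) = (\<integral>x. F x \<bullet> cgrad Y x \<partial>lborel)"
  proof (rule integral_cong_AE)
    show "AE x in lborel. F x \<bullet> grad \<phi> x = F x \<bullet> cgrad Y x" using Y(2) by eventually_elim simp
  qed (intro borel_measurable_inner square_integrableD(1) F square_integrable_test_fun(2)[OF t] cgrad_Hquot(2)[OF Y(1)])+
  then show ?thesis using X[OF Y(1)] by simp
qed

lemma square_integrable_matrix:
  "square_integrable k \<Longrightarrow> square_integrable (\<lambda>x. (A :: real^2^2) *v (k x :: plane))"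
proof -
  assume k: "square_integrable k"
  have bl: "bounded_linear ((*v) A)" by (rule matrix_vector_mul_bounded_linear)
  obtain B where B: "\<And>v. norm (A *v v) \<le> norm v * B" using bounded_linear.bounded[OF bl] by blast
  show ?thesis
  proof (rule square_integrable_bound[OF k, of _ B])
    show "(\<lambda>x. A *v k x) \<in> borel_measurable lborel"
      by (rule borel_measurable_continuous_on[OF linear_continuous_on[OF bl] square_integrableD(1)[OF k]])
  qed (use B in \<open>simp add: mult.commute\<close>)
qed

context monotone_law begin

text \<open>The form in which the problem for \<open>H\<close> is stated, with the interior, the exterior and the source separated.\<close>

lemma flux_in_out:
  assumes h: "square_integrable h" and c: "square_integrable c"
  shows "(\<integral>x. flux (ball 0 1) (\<lambda>x. U) h x \<bullet> c x \<partial>lborel)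
    = (LINT x:(- ball 0 1)|lborel. (\<nu>0 *\<^sub>R h x) \<bullet> c x) + (LINT x:ball 0 1|lborel. (T (U + h x) - T U) \<bullet> c x)
      - (LINT x:ball 0 1|lborel. (\<nu>0 *\<^sub>R U - T U) \<bullet> c x)"
proof -
  let ?o = "ball (0::plane) 1"
  have o: "?o \<in> sets borel" "emeasure lborel ?o < \<infinity>" using emeasure_ball_finite[of 0 1] by simp_all
  have co: "- ?o \<in> sets borel" by simp
  have s1: "square_integrable (\<lambda>x. indicat_real (- ?o) x *\<^sub>R (\<nu>0 *\<^sub>R h x))"
    by (intro square_integrable_indicator square_integrable_scaleR h co)
  have s2: "square_integrable (\<lambda>x. indicat_real ?o x *\<^sub>R (T (U + h x) - T U))"
  proof -
    have "square_integrable (\<lambda>x. indicat_real ?o x *\<^sub>R contrast (U + h x) + indicat_real ?o x *\<^sub>R (\<nu>0 *\<^sub>R h x)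
      + indicat_real ?o x *\<^sub>R (\<nu>0 *\<^sub>R U - T U))"
      by (intro square_integrable_add square_integrable_contrast h o square_integrable_indicator
          square_integrable_scaleR square_integrable_indicator_const)
    moreover have "(\<lambda>x. indicat_real ?o x *\<^sub>R contrast (U + h x) + indicat_real ?o x *\<^sub>R (\<nu>0 *\<^sub>R h x)
      + indicat_real ?o x *\<^sub>R (\<nu>0 *\<^sub>R U - T U)) = (\<lambda>x. indicat_real ?o x *\<^sub>R (T (U + h x) - T U))"
      by (auto simp: contrast_def indicator_def algebra_simps)
    ultimately show ?thesis by simp
  qed
  have s3: "square_integrable (\<lambda>x. indicat_real ?o x *\<^sub>R (\<nu>0 *\<^sub>R U - T U))"
    by (rule square_integrable_indicator_const[OF o])
  have "(\<integral>x. flux ?o (\<lambda>x. U) h x \<bullet> c x \<partial>lborel)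
    = (\<integral>x. (indicat_real (- ?o) x *\<^sub>R (\<nu>0 *\<^sub>R h x)) \<bullet> c x + (indicat_real ?o x *\<^sub>R (T (U + h x) - T U)) \<bullet> c x
      - (indicat_real ?o x *\<^sub>R (\<nu>0 *\<^sub>R U - T U)) \<bullet> c x \<partial>lborel)"
    by (intro Bochner_Integration.integral_cong refl)
       (auto simp: flux_def contrast_def indicator_def algebra_simps)
  also have "\<dots> = (\<integral>x. (indicat_real (- ?o) x *\<^sub>R (\<nu>0 *\<^sub>R h x)) \<bullet> c x \<partial>lborel)
      + (\<integral>x. (indicat_real ?o x *\<^sub>R (T (U + h x) - T U)) \<bullet> c x \<partial>lborel)
      - (\<integral>x. (indicat_real ?o x *\<^sub>R (\<nu>0 *\<^sub>R U - T U)) \<bullet> c x \<partial>lborel)"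
    using square_integrable_inner[OF s1 c] square_integrable_inner[OF s2 c] square_integrable_inner[OF s3 c]
    by (subst Bochner_Integration.integral_diff Bochner_Integration.integral_add,
        auto intro!: Bochner_Integration.integrable_add)+
  finally show ?thesis by (simp only: set_lebesgue_integral_def inner_scaleR_left real_scaleR_def)
qed

end

lemma H_flux_orthogonal:
  assumes law: "monotone_law (T_op \<nu>) \<nu>0 m" and H: "solves_H \<nu> \<nu>0 (ball 0 1) U H" and X: "X \<in> Hquot"
  shows "(\<integral>x. monotone_law.flux (T_op \<nu>) \<nu>0 (ball 0 1) (\<lambda>x. U) (cgrad H) x \<bullet> cgrad X x \<partial>lborel) = 0"
proof -
  interpret monotone_law "T_op \<nu>" \<nu>0 m by (rule law)
  have "H \<in> Hquot" using H by (simp add: solves_H_def)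
  then have sq: "square_integrable (cgrad H)" "square_integrable (cgrad X)" using X by (auto intro: cgrad_Hquot(2))
  have "(\<nu>0 - \<nu> (norm U)) *\<^sub>R U = \<nu>0 *\<^sub>R U - T_op \<nu> U" by (simp add: T_op_def scaleR_diff_left)
  then show ?thesis
    using H X unfolding flux_in_out[OF sq] solves_H_def by simp
qed

text \<open>The flux of the linearised problem with its source moved to the left, so that the equation for \<open>K\<close> says that
  it is orthogonal to all gradients.\<close>

definition K_flux :: "(real \<Rightarrow> real) \<Rightarrow> real \<Rightarrow> plane \<Rightarrow> plane \<Rightarrow> (plane \<Rightarrow> plane) \<Rightarrow> plane \<Rightarrow> plane" where
  "K_flux \<nu> \<nu>0 U P k x = \<nu>0 *\<^sub>R k x
     + indicat_real (ball 0 1) x *\<^sub>R (DT \<nu> U *v k x - \<nu>0 *\<^sub>R k x - (\<nu>0 *\<^sub>R P - DT \<nu> U *v P))"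

lemma square_integrable_K_flux:
  assumes k: "square_integrable k" shows "square_integrable (K_flux \<nu> \<nu>0 U P k)"
proof -
  have o: "ball (0::plane) 1 \<in> sets borel" "emeasure lborel (ball (0::plane) 1) < \<infinity>"
    using emeasure_ball_finite[of 0 1] by simp_all
  have "square_integrable (\<lambda>x. \<nu>0 *\<^sub>R k x + (indicat_real (ball 0 1) x *\<^sub>R (DT \<nu> U *v k x - \<nu>0 *\<^sub>R k x)
      - indicat_real (ball 0 1) x *\<^sub>R (\<nu>0 *\<^sub>R P - DT \<nu> U *v P)))"
    by (intro square_integrable_add square_integrable_diff square_integrable_scaleR k o
        square_integrable_indicator square_integrable_matrix square_integrable_indicator_const)
  then show ?thesis unfolding K_flux_def[abs_def] by (simp add: scaleR_diff_right)
qed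

lemma K_flux_orthogonal:
  assumes K: "solves_K \<nu> \<nu>0 (ball 0 1) U P K" and X: "X \<in> Hquot"
  shows "(\<integral>x. K_flux \<nu> \<nu>0 U P (cgrad K) x \<bullet> cgrad X x \<partial>lborel) = 0"
proof -
  let ?o = "ball (0::plane) 1" and ?k = "cgrad K" and ?c = "cgrad X"
  have "K \<in> Hquot" using K by (simp add: solves_K_def)
  then have k: "square_integrable ?k" and c: "square_integrable ?c" using X by (auto intro: cgrad_Hquot(2))
  have o: "?o \<in> sets borel" "emeasure lborel ?o < \<infinity>" using emeasure_ball_finite[of 0 1] by simp_all
  have co: "- ?o \<in> sets borel" by simp
  have P: "(mat \<nu>0 - DT \<nu> U) *v P = \<nu>0 *\<^sub>R P - DT \<nu> U *v P"
    by (simp add: matrix_vector_mult_diff_rdistrib mat_mult_vec)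
  let ?f1 = "\<lambda>x. (indicat_real (- ?o) x *\<^sub>R (\<nu>0 *\<^sub>R ?k x)) \<bullet> ?c x"
    and ?f2 = "\<lambda>x. (indicat_real ?o x *\<^sub>R (DT \<nu> U *v ?k x)) \<bullet> ?c x"
    and ?f3 = "\<lambda>x. (indicat_real ?o x *\<^sub>R (\<nu>0 *\<^sub>R P - DT \<nu> U *v P)) \<bullet> ?c x"
  have i: "integrable lborel ?f1" "integrable lborel ?f2" "integrable lborel ?f3"
    by (intro square_integrable_inner square_integrable_indicator square_integrable_scaleR
        square_integrable_matrix square_integrable_indicator_const k c o co)+
  have "(\<integral>x. K_flux \<nu> \<nu>0 U P ?k x \<bullet> ?c x \<partial>lborel) = (\<integral>x. (?f1 x + ?f2 x) - ?f3 x \<partial>lborel)"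
    by (intro Bochner_Integration.integral_cong refl)
       (auto simp: K_flux_def indicator_def algebra_simps)
  also have "\<dots> = (\<integral>x. ?f1 x + ?f2 x \<partial>lborel) - (\<integral>x. ?f3 x \<partial>lborel)"
    by (rule Bochner_Integration.integral_diff[OF Bochner_Integration.integrable_add[OF i(1,2)] i(3)])
  also have "(\<integral>x. ?f1 x + ?f2 x \<partial>lborel) = (\<integral>x. ?f1 x \<partial>lborel) + (\<integral>x. ?f2 x \<partial>lborel)"
    by (rule Bochner_Integration.integral_add[OF i(1,2)])
  finally show ?thesis
    using K X unfolding solves_K_def set_lebesgue_integral_def P by (simp add: mult.assoc)
qed

lemma integral_indicator_inner:
  assumes "square_integrable k"
  shows "integrable lborel (\<lambda>x. indicat_real (ball (0::plane) 1) x * (k x \<bullet> (a::plane)))"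
proof -
  have o: "ball (0::plane) 1 \<in> sets borel" "emeasure lborel (ball (0::plane) 1) < \<infinity>"
    using emeasure_ball_finite[of 0 1] by simp_all
  have "integrable lborel (\<lambda>x. k x \<bullet> (indicat_real (ball 0 1) x *\<^sub>R a))"
    by (intro square_integrable_inner assms square_integrable_indicator_const o)
  then show ?thesis by simp
qed

text \<open>Testing the equation of \<open>K\<close> with the dipole of moment \<open>U\<close> on the unit disc: inside of the disc the gradient of the test function is \<open>U\<close>, an
  eigenvector of \<open>DT \<nu> U\<close>, and over the plane the limit is twice the integral of \<open>\<nabla>K \<cdot> U\<close> over the disc.\<close>

lemma polarisation_average:
  assumes K: "solves_K \<nu> \<nu>0 (ball 0 1) U P K"
  defines "l2 \<equiv> \<nu> (norm U) + deriv_half \<nu> (norm U) * norm U"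
  shows "(\<nu>0 + l2) * (LINT x:ball 0 1|lborel. cgrad K x \<bullet> U)
    = (\<nu>0 - l2) * (measure lborel (ball (0::plane) 1) * (U \<bullet> P))"
proof -
  let ?o = "ball (0::plane) 1" and ?k = "cgrad K"
  define a where "a = (\<integral>x. indicat_real ?o x * (?k x \<bullet> U) \<partial>lborel)"
  have KQ: "K \<in> Hquot" using K by (simp add: solves_K_def)
  have k: "square_integrable ?k" by (rule cgrad_Hquot(2)[OF KQ])
  have C: "square_integrable (K_flux \<nu> \<nu>0 U P ?k)" by (rule square_integrable_K_flux[OF k])
  have iU: "integrable lborel (\<lambda>x. indicat_real ?o x * (?k x \<bullet> U))" by (rule integral_indicator_inner[OF k])
  have oi: "integrable lborel (indicat_real ?o)"
    using emeasure_ball_finite[of 0 1] by (intro integrable_real_indicator) auto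
  have disc: "(LINT x:cball 0 1|lborel. ?k x \<bullet> U) = a"
  proof -
    have "sphere (0::plane) 1 \<in> null_sets lebesgue"
      using negligible_sphere[of "0::plane" 1] by (simp add: negligible_iff_null_sets)
    then have "AE x in lebesgue. x \<notin> sphere (0::plane) 1" by (rule AE_not_in)
    then have "AE x in lborel. x \<notin> sphere (0::plane) 1" by (simp add: AE_completion_iff)
    then have ae: "AE x in lborel. indicat_real (cball 0 1) x *\<^sub>R (?k x \<bullet> U) = indicat_real ?o x * (?k x \<bullet> U)"
      by eventually_elim (auto simp: indicator_def)
    have [measurable]: "?k \<in> borel_measurable borel" using k by (simp add: square_integrable_def)
    have [measurable]: "cball (0::plane) 1 \<in> sets borel" "?o \<in> sets borel" by simp_all
    show ?thesis
      unfolding set_lebesgue_integral_def a_def by (rule integral_cong_AE[OF _ _ ae]) measurable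
  qed
  let ?\<eta> = "\<lambda>m. dipole (real m + 2) 0 1 U"
  have t: "test_fun UNIV (?\<eta> m)" for m by (intro test_fun_dipole) auto
  have lim: "(\<lambda>m. \<integral>x. ?k x \<bullet> grad (?\<eta> m) x \<partial>lborel) \<longlonglongrightarrow> 2 * a"
    using integral_dipole_limit[OF k cgrad_orthogonal_rot_grad[OF KQ], of 1 0 U] disc by simp
  define b where "b = (l2 - \<nu>0) * a - (\<nu>0 - l2) * (measure lborel ?o * (U \<bullet> P))"
  have "\<nu>0 * (\<integral>x. ?k x \<bullet> grad (?\<eta> m) x \<partial>lborel) + b = 0" for m
  proof -
    have kg: "integrable lborel (\<lambda>x. ?k x \<bullet> grad (?\<eta> m) x)"
      by (rule square_integrable_inner[OF k square_integrable_test_fun(2)[OF t]])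
    have "0 = (\<integral>x. K_flux \<nu> \<nu>0 U P ?k x \<bullet> grad (?\<eta> m) x \<partial>lborel)"
      by (rule Hquot_orthogonal_test[OF C K_flux_orthogonal[OF K] t, symmetric])
    also have "\<dots> = (\<integral>x. \<nu>0 * (?k x \<bullet> grad (?\<eta> m) x) + ((l2 - \<nu>0) * (indicat_real ?o x * (?k x \<bullet> U))
        - (\<nu>0 - l2) * (U \<bullet> P) * indicat_real ?o x) \<partial>lborel)"
    proof (intro Bochner_Integration.integral_cong refl)
      fix x
      show "K_flux \<nu> \<nu>0 U P ?k x \<bullet> grad (?\<eta> m) x = \<nu>0 * (?k x \<bullet> grad (?\<eta> m) x)
          + ((l2 - \<nu>0) * (indicat_real ?o x * (?k x \<bullet> U)) - (\<nu>0 - l2) * (U \<bullet> P) * indicat_real ?o x)"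
      proof (cases "x \<in> ?o")
        case True
        then have g: "grad (?\<eta> m) x = U" by (intro grad_dipole_inside) auto
        show ?thesis
          using True DT_eigen[of \<nu> U "?k x"] DT_eigen[of \<nu> U P]
          unfolding K_flux_def g l2_def
          by (simp add: inner_add_left inner_diff_left inner_commute[of P U] algebra_simps)
      qed (simp add: K_flux_def)
    qed
    also have "\<dots> = \<nu>0 * (\<integral>x. ?k x \<bullet> grad (?\<eta> m) x \<partial>lborel) + ((l2 - \<nu>0) * a - (\<nu>0 - l2) * (U \<bullet> P) * measure lborel ?o)"
      using kg iU oi unfolding a_def by simp
    finally show ?thesis by (simp add: b_def mult_ac)
  qed
  moreover have "(\<lambda>m. \<nu>0 * (\<integral>x. ?k x \<bullet> grad (?\<eta> m) x \<partial>lborel) + b) \<longlonglongrightarrow> \<nu>0 * (2 * a) + b"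
    by (intro tendsto_add tendsto_mult tendsto_const lim)
  ultimately have "\<nu>0 * (2 * a) + b = 0" by (simp add: LIMSEQ_const_iff)
  then show ?thesis
    unfolding set_lebesgue_integral_def real_scaleR_def a_def[symmetric] by (simp add: b_def algebra_simps)
qed

text \<open>Testing the equation of \<open>H\<close> with \<open>K\<close> and the one of \<open>K\<close> with \<open>H\<close>, the exterior terms and, by symmetry of \<open>DT \<nu> U\<close>, the
  linear interior terms cancel. What is left besides the contrast integral are terms constant in \<open>\<nabla>H\<close>, given by the
  integral of \<open>\<nabla>K \<cdot> U\<close>.\<close>

lemma polarisation_identity:
  assumes N1: "cond_N1 \<nu> \<nu>0" and law: "monotone_law (T_op \<nu>) \<nu>0 m"
    and H: "solves_H \<nu> \<nu>0 (ball 0 1) U H" and K: "solves_K \<nu> \<nu>0 (ball 0 1) U P K"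
    and R: "rotation_matrix R" "U = R *v vector [norm U, 0]"
  shows "(\<integral>y. (indicat_real (ball 0 1) y *\<^sub>R monotone_law.contrast (T_op \<nu>) \<nu>0 (U + cgrad H y)) \<bullet> P \<partial>lborel)
    = U \<bullet> (pol_matrix \<nu> \<nu>0 (ball 0 1) U R *v P)
      + (LINT x:ball 0 1|lborel. S_op \<nu> U (cgrad H x) \<bullet> (P + cgrad K x))"
proof -
  interpret monotone_law "T_op \<nu>" \<nu>0 m by (rule law)
  let ?o = "ball (0::plane) 1" and ?h = "cgrad H" and ?k = "cgrad K"
  have Q: "H \<in> Hquot" "K \<in> Hquot" using H K by (auto simp: solves_H_def solves_K_def)
  have h: "square_integrable ?h" and k: "square_integrable ?k" using Q by (auto intro: cgrad_Hquot(2))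
  have o: "?o \<in> sets borel" "emeasure lborel ?o < \<infinity>" using emeasure_ball_finite[of 0 1] by simp_all
  let ?F = "flux ?o (\<lambda>x. U) ?h" and ?C = "K_flux \<nu> \<nu>0 U P ?k"
  define l where "l = \<nu> (norm U)"
  have TU: "T_op \<nu> U = l *\<^sub>R U" by (simp add: T_op_def l_def)
  define \<mu> where "\<mu> = measure lborel ?o"
  define a where "a = (LINT x:?o|lborel. ?k x \<bullet> U)"
  define L where "L = (\<integral>y. (indicat_real ?o y *\<^sub>R contrast (U + ?h y)) \<bullet> P \<partial>lborel)"
  have i1: "integrable lborel (\<lambda>x. ?F x \<bullet> ?k x)"
    by (intro square_integrable_inner square_integrable_flux(1) h k o)
  have i2: "integrable lborel (\<lambda>x. ?C x \<bullet> ?h x)"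
    by (intro square_integrable_inner square_integrable_K_flux h k)
  have i3: "integrable lborel (\<lambda>x. indicat_real ?o x * (?k x \<bullet> U))" by (rule integral_indicator_inner[OF k])
  have i4: "integrable lborel (\<lambda>x. (indicat_real ?o x *\<^sub>R contrast (U + ?h x)) \<bullet> P)"
  proof -
    have "integrable lborel (\<lambda>x. indicat_real ?o x * ((indicat_real ?o x *\<^sub>R contrast (U + ?h x)) \<bullet> P))"
      by (intro integral_indicator_inner square_integrable_contrast h o)
    moreover have "(\<lambda>x. indicat_real ?o x * ((indicat_real ?o x *\<^sub>R contrast (U + ?h x)) \<bullet> P))
        = (\<lambda>x. (indicat_real ?o x *\<^sub>R contrast (U + ?h x)) \<bullet> P)" by (auto simp: indicator_def)
    ultimately show ?thesis by simp
  qed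
  have i5: "integrable lborel (indicat_real ?o)" using o by (intro integrable_real_indicator) auto
  have "(LINT x:?o|lborel. S_op \<nu> U (?h x) \<bullet> (P + ?k x))
    = (\<integral>x. (?F x \<bullet> ?k x - ?C x \<bullet> ?h x) + ((\<nu>0 - l) * (indicat_real ?o x * (?k x \<bullet> U))
        + ((indicat_real ?o x *\<^sub>R contrast (U + ?h x)) \<bullet> P + (\<nu>0 - l) * (U \<bullet> P) * indicat_real ?o x)) \<partial>lborel)"
    unfolding set_lebesgue_integral_def
  proof (intro Bochner_Integration.integral_cong refl)
    fix x
    show "indicat_real ?o x *\<^sub>R (S_op \<nu> U (?h x) \<bullet> (P + ?k x)) = (?F x \<bullet> ?k x - ?C x \<bullet> ?h x)
        + ((\<nu>0 - l) * (indicat_real ?o x * (?k x \<bullet> U))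
        + ((indicat_real ?o x *\<^sub>R contrast (U + ?h x)) \<bullet> P + (\<nu>0 - l) * (U \<bullet> P) * indicat_real ?o x))"
    proof (cases "x \<in> ?o")
      case True
      have i: "indicat_real ?o x = 1" using True by simp
      show ?thesis
        using DT_symmetric[of \<nu> U "?h x" P] DT_symmetric[of \<nu> U "?h x" "?k x"]
        unfolding flux_def K_flux_def contrast_def S_op_def TU i
        by (simp add: inner_add_left inner_add_right inner_diff_left inner_diff_right algebra_simps
            inner_commute[of "?k x" U] inner_commute[of P "?h x"] inner_commute[of "?k x" "?h x"])
    next
      case False
      then show ?thesis by (simp add: flux_def K_flux_def inner_commute)
    qed
  qed
  also have "\<dots> = (0 - 0) + ((\<nu>0 - l) * a + (L + (\<nu>0 - l) * (U \<bullet> P) * \<mu>))"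
  proof -
    have z: "(\<integral>x. ?F x \<bullet> ?k x \<partial>lborel) = 0" "(\<integral>x. ?C x \<bullet> ?h x \<partial>lborel) = 0"
      by (rule H_flux_orthogonal[OF law H Q(2)], rule K_flux_orthogonal[OF K Q(1)])
    have a: "a = (\<integral>x. indicat_real ?o x * (?k x \<bullet> U) \<partial>lborel)" by (simp add: a_def set_lebesgue_integral_def)
    note j3 = integrable_mult_right[OF i3, of "\<nu>0 - l"] and j5 = integrable_mult_right[OF i5, of "(\<nu>0 - l) * (U \<bullet> P)"]
    show ?thesis
      unfolding Bochner_Integration.integral_add[OF Bochner_Integration.integrable_diff[OF i1 i2]
          Bochner_Integration.integrable_add[OF j3 Bochner_Integration.integrable_add[OF i4 j5]]]
        Bochner_Integration.integral_diff[OF i1 i2]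
        Bochner_Integration.integral_add[OF j3 Bochner_Integration.integrable_add[OF i4 j5]]
        Bochner_Integration.integral_add[OF i4 j5] z L_def a \<mu>_def
      by simp
  qed
  finally have S: "(LINT x:?o|lborel. S_op \<nu> U (?h x) \<bullet> (P + ?k x)) = (\<nu>0 - l) * a + L + (\<nu>0 - l) * (U \<bullet> P) * \<mu>" by simp
  define l2 where "l2 = \<nu> (norm U) + deriv_half \<nu> (norm U) * norm U"
  have "0 < l2" unfolding l2_def by (rule BH_curve_bounds[OF N1]) (simp add: norm_ge_zero)
  then have pos: "0 < \<nu>0 + l2" using \<nu>0_pos by simp
  have "(\<nu>0 + l2) * a = (\<nu>0 - l2) * (\<mu> * (U \<bullet> P))"
    unfolding a_def l2_def \<mu>_def by (rule polarisation_average[OF K])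
  then have "(\<nu>0 + l2) * (a + \<mu> * (U \<bullet> P)) = 2 * \<nu>0 * \<mu> * (U \<bullet> P)" by (simp add: algebra_simps)
  then have a: "a + \<mu> * (U \<bullet> P) = 2 * \<nu>0 * \<mu> * (U \<bullet> P) / (\<nu>0 + l2)"
    using pos by (simp add: eq_divide_eq mult.commute)
  have "U \<bullet> (pol_matrix \<nu> \<nu>0 ?o U R *v P) = (l - \<nu>0) * (2 * \<nu>0 * \<mu> * (U \<bullet> P) / (\<nu>0 + l2))"
    unfolding pol_matrix_first_axis[OF R] \<mu>_def l_def l2_def by (simp add: add.commute mult_ac)
  also have "\<dots> = (l - \<nu>0) * (a + \<mu> * (U \<bullet> P))" by (simp only: a)
  finally have "L = U \<bullet> (pol_matrix \<nu> \<nu>0 ?o U R *v P) + (LINT x:?o|lborel. S_op \<nu> U (?h x) \<bullet> (P + ?k x))"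
    unfolding S by (simp add: algebra_simps)
  then show ?thesis by (simp only: L_def)
qed

section \<open>The perturbed state\<close>

lemma set_integral_wgrad:
  "(LINT x:D|lborel. (c *\<^sub>R wgrad D u x) \<bullet> wgrad D \<eta> x) = (\<integral>x. (c *\<^sub>R ext_grad D u x) \<bullet> ext_grad D \<eta> x \<partial>lborel)"
  unfolding set_lebesgue_integral_def ext_grad_def
  by (intro Bochner_Integration.integral_cong) (auto simp: indicator_def)

text \<open>Both states satisfy their equations with the same right-hand side \<open>F\<close>, which drops out of the difference.\<close>

lemma perturbed_difference_equation:
  assumes law: "monotone_law (T_op \<nu>) \<nu>0 m" and D: "open D"
    and A: "A \<in> sets borel" "emeasure lborel A < \<infinity>" "A \<subseteq> D"
    and u: "solves_perturbed D \<nu> \<nu>0 A F u" and u0: "solves_unperturbed D \<nu>0 F u0" and \<eta>: "\<eta> \<in> H01 D"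
  shows "(\<integral>x. monotone_law.flux (T_op \<nu>) \<nu>0 A (ext_grad D u0) (ext_grad D (\<lambda>x. u x - u0 x)) x
      \<bullet> ext_grad D \<eta> x \<partial>lborel) = 0"
proof -
  interpret monotone_law "T_op \<nu>" \<nu>0 m by (rule law)
  let ?g = "ext_grad D u" and ?b = "ext_grad D u0" and ?v = "ext_grad D (\<lambda>x. u x - u0 x)" and ?e = "ext_grad D \<eta>"
  have uH: "u \<in> H1 D" "u0 \<in> H1 D" "\<eta> \<in> H1 D"
    using u u0 \<eta> by (auto simp: solves_perturbed_def solves_unperturbed_def intro: H01_imp_H1)
  note sq = ext_grad_square_integrable[OF D]
  have g: "square_integrable ?g" "square_integrable ?b" "square_integrable ?e" "square_integrable ?v"
    by (intro sq uH H1_diff(1)[OF D])+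
  let ?B = "flux A (\<lambda>x. 0) ?g"
  have B: "square_integrable ?B" by (rule square_integrable_flux(1)[OF g(1) A(1,2)])
  have 1: "(\<integral>x. ?B x \<bullet> ?e x \<partial>lborel) = F \<eta>"
  proof -
    have "(\<integral>x. ?B x \<bullet> ?e x \<partial>lborel) = (LINT x:D|lborel. T_pert \<nu> \<nu>0 A x (wgrad D u x) \<bullet> wgrad D \<eta> x)"
      unfolding set_lebesgue_integral_def
      by (intro Bochner_Integration.integral_cong refl)
         (use A(3) in \<open>auto simp: flux_def contrast_def T_pert_def ext_grad_def indicator_def\<close>)
    then show ?thesis using u \<eta> by (simp add: solves_perturbed_def)
  qed
  have 2: "(\<integral>x. (\<nu>0 *\<^sub>R ?b x) \<bullet> ?e x \<partial>lborel) = F \<eta>"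
    using u0 \<eta> unfolding solves_unperturbed_def set_integral_wgrad by blast
  have "(\<integral>x. flux A ?b ?v x \<bullet> ?e x \<partial>lborel) = (\<integral>x. ?B x \<bullet> ?e x - (\<nu>0 *\<^sub>R ?b x) \<bullet> ?e x \<partial>lborel)"
  proof (rule integral_cong_AE)
    show "(\<lambda>x. flux A ?b ?v x \<bullet> ?e x) \<in> borel_measurable lborel"
      by (intro borel_measurable_inner square_integrableD(1) square_integrable_flux(2) g A)
    show "(\<lambda>x. ?B x \<bullet> ?e x - (\<nu>0 *\<^sub>R ?b x) \<bullet> ?e x) \<in> borel_measurable lborel"
      by (intro borel_measurable_diff borel_measurable_inner square_integrableD(1) B g square_integrable_scaleR)
    show "AE x in lborel. flux A ?b ?v x \<bullet> ?e x = ?B x \<bullet> ?e x - (\<nu>0 *\<^sub>R ?b x) \<bullet> ?e x"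
      using H1_diff(2)[OF D uH(1,2)]
    proof eventually_elim
      case (elim x)
      have "flux A ?b ?v x = ?B x - \<nu>0 *\<^sub>R ?b x"
        unfolding flux_def elim by (simp add: algebra_simps)
      then show ?case by (simp add: inner_diff_left)
    qed
  qed
  also have "\<dots> = (\<integral>x. ?B x \<bullet> ?e x \<partial>lborel) - (\<integral>x. (\<nu>0 *\<^sub>R ?b x) \<bullet> ?e x \<partial>lborel)"
    by (intro Bochner_Integration.integral_diff square_integrable_inner B g square_integrable_scaleR)
  finally show ?thesis using 1 2 by simp
qed

text \<open>The local Hoelder condition makes the classical gradient continuous, and the classical gradient is the weak
  gradient.\<close>

lemma C1_holder_gradient_near:
  assumes D: "open D" and \<Omega>: "open \<Omega>" "\<Omega> \<subseteq> D" "x0 \<in> \<Omega>" and u: "u \<in> H1 D"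
    and \<beta>: "0 < \<beta>" and v: "C1_holder_repr \<Omega> \<beta> u v" and \<sigma>: "0 < \<sigma>"
  shows "\<exists>\<rho>>0. AE x in lborel. x \<in> ball x0 \<rho> \<longrightarrow> norm (grad v x0 - ext_grad D u x) \<le> \<sigma>"
proof -
  have "isCont (grad v) z" if z: "z \<in> \<Omega>" for z
  proof -
    obtain r where r: "0 < r" "cball z r \<subseteq> \<Omega>" using \<Omega>(1) z open_contains_cball by blast
    have "\<exists>C. \<forall>x\<in>cball z r. \<forall>y\<in>cball z r. norm (grad v x - grad v y) \<le> C * norm (x - y) powr \<beta>"
      using v r(2) unfolding C1_holder_repr_def by simp
    then obtain C where C: "\<And>x y. x \<in> cball z r \<Longrightarrow> y \<in> cball z r \<Longrightarrow>
        norm (grad v x - grad v y) \<le> C * norm (x - y) powr \<beta>"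
      by blast
    have n0: "((\<lambda>x. norm (x - z)) \<longlongrightarrow> 0) (at z)"
      by (rule tendsto_norm_zero) (simp add: LIM_zero)
    have "((\<lambda>x. norm (x - z) powr \<beta>) \<longlongrightarrow> 0) (at z)"
      by (rule tendsto_zero_powrI[OF n0 tendsto_const _ \<beta>]) simp
    then have lim: "((\<lambda>x. C * norm (x - z) powr \<beta>) \<longlongrightarrow> 0) (at z)" by (rule tendsto_mult_right_zero)
    have "((\<lambda>x. grad v x - grad v z) \<longlongrightarrow> 0) (at z)"
    proof (rule Lim_null_comparison[OF _ lim])
      show "eventually (\<lambda>x. norm (grad v x - grad v z) \<le> C * norm (x - z) powr \<beta>) (at z)"
        unfolding eventually_at using r C by (intro exI[of _ r]) (auto simp: dist_commute)
    qed
    then show ?thesis unfolding isCont_def by (rule LIM_zero_cancel)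
  qed
  then have cont: "continuous_on \<Omega> (grad v)" by (simp add: continuous_at_imp_continuous_on)
  have "has_weak_grad \<Omega> v (grad v)"
    by (rule has_weak_grad_C1[OF \<Omega>(1) _ cont]) (use v in \<open>simp add: C1_holder_repr_def\<close>)
  moreover have "has_weak_grad \<Omega> u (wgrad D u)" by (rule has_weak_grad_subset[OF H1_wgrad[OF u] \<Omega>(2)])
  moreover have "AE x in lborel. x \<in> \<Omega> \<longrightarrow> v x - u x = 0"
    using v unfolding C1_holder_repr_def by (auto elim: eventually_mono)
  ultimately have ae: "AE x in lborel. x \<in> \<Omega> \<longrightarrow> grad v x = wgrad D u x"
    using has_weak_grad_unique[OF _ _ \<Omega>(1)] by blast
  have "isCont (grad v) x0" using cont \<Omega> by (simp add: continuous_on_eq_continuous_at)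
  then obtain d where d: "0 < d" "\<And>x. dist x x0 < d \<Longrightarrow> dist (grad v x) (grad v x0) < \<sigma>"
    using \<sigma> unfolding continuous_at_eps_delta by blast
  obtain r where r: "0 < r" "ball x0 r \<subseteq> \<Omega>" using \<Omega> openE by blast
  show ?thesis
  proof (intro exI[of _ "min d r"] conjI)
    show "0 < min d r" using d r by simp
    show "AE x in lborel. x \<in> ball x0 (min d r) \<longrightarrow> norm (grad v x0 - ext_grad D u x) \<le> \<sigma>"
      using ae
    proof eventually_elim
      case (elim x)
      show ?case
      proof
        assume x: "x \<in> ball x0 (min d r)"
        then have xO: "x \<in> \<Omega>" "dist x x0 < d" using r by (auto simp: dist_commute)
        then have "ext_grad D u x = grad v x" using elim \<Omega>(2) by (auto simp: ext_grad_def)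
        then show "norm (grad v x0 - ext_grad D u x) \<le> \<sigma>"
          using d(2)[OF xO(2)] by (simp add: dist_norm norm_minus_commute)
      qed
    qed
  qed
qed

lemma smallo_square_at_right_0I:
  fixes f :: "real \<Rightarrow> real"
  assumes "\<And>\<delta>. 0 < \<delta> \<Longrightarrow> \<exists>\<epsilon>1>0. \<forall>\<epsilon>. 0 < \<epsilon> \<and> \<epsilon> < \<epsilon>1 \<longrightarrow> \<bar>f \<epsilon>\<bar> \<le> \<delta> * \<epsilon>\<^sup>2"
  shows "f \<in> o[at_right 0](\<lambda>\<epsilon>. \<epsilon>\<^sup>2)"
proof (rule landau_o.smallI)
  fix c :: real assume "0 < c"
  from assms[OF this] obtain \<epsilon>1 where "0 < \<epsilon>1" "\<And>\<epsilon>. 0 < \<epsilon> \<Longrightarrow> \<epsilon> < \<epsilon>1 \<Longrightarrow> \<bar>f \<epsilon>\<bar> \<le> c * \<epsilon>\<^sup>2" by blast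
  then show "eventually (\<lambda>x. norm (f x) \<le> c * norm (x\<^sup>2)) (at_right 0)"
    unfolding eventually_at_right_field by (intro exI[of _ \<epsilon>1]) simp
qed

theorem theorem3:
  fixes \<nu> :: "real \<Rightarrow> real" and \<nu>0 :: real
    and D \<Omega>d \<omega> :: "plane set" and x0 :: plane
    and F J G :: "(plane \<Rightarrow> real) \<Rightarrow> real" and \<delta>J :: real
    and u :: "real \<Rightarrow> plane \<Rightarrow> real" and p u0 p0 :: "plane \<Rightarrow> real"
    and \<beta> \<beta>' :: real
    and U P :: plane and H K :: "(plane \<Rightarrow> real) set" and R :: "real^2^2"
  assumes "\<nu>0 > 0" and "\<forall>s\<ge>0. \<nu> s \<ge> 0"
    and "cond_N1 \<nu> \<nu>0" and "cond_N2 \<nu>"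
    and "open D" and "connected D" and "bounded D"
    and "bounded_form D F" and "compactly_in (supp_form D F) D"
    and "open \<Omega>d" and "compactly_in \<Omega>d (D - supp_form D F)"
    and "x0 \<in> \<Omega>d"
    and "\<omega> = ball 0 1"
    and "solves_unperturbed D \<nu>0 F (u 0)"
    and "\<And>\<epsilon>. \<epsilon> > 0 \<Longrightarrow> solves_perturbed D \<nu> \<nu>0 (scaled x0 \<epsilon> \<omega>) F (u \<epsilon>)"
    and "cond_J D x0 u J G \<delta>J"
    and "solves_unperturbed D \<nu>0 (\<lambda>\<eta>. - G \<eta>) p"
    and "\<beta> > 0" and "C1_holder_repr \<Omega>d \<beta> (u 0) u0" and "U = grad u0 x0"
    and "\<beta>' > 0" and "C1_holder_repr \<Omega>d \<beta>' p p0" and "P = grad p0 x0"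
    and "solves_H \<nu> \<nu>0 \<omega> U H"
    and "solves_K \<nu> \<nu>0 \<omega> U P K"
    and "rotation_matrix R" and "U = R *v vector [norm U, 0]"
  shows "(\<lambda>\<epsilon>. J (u \<epsilon>) - J (u 0)
            - \<epsilon>\<^sup>2 * (U \<bullet> (pol_matrix \<nu> \<nu>0 \<omega> U R *v P)
                   + (LINT x:\<omega>|lborel. S_op \<nu> U (cgrad H x) \<bullet> (P + cgrad K x))
                   + \<delta>J))
         \<in> o[at_right 0](\<lambda>\<epsilon>. \<epsilon>\<^sup>2)"
proof -
  note N1 = assms(3) and D = assms(5) and \<omega> = assms(13)
  have H: "solves_H \<nu> \<nu>0 (ball 0 1) U H" and K: "solves_K \<nu> \<nu>0 (ball 0 1) U P K"
    using assms(24,25) \<omega> by auto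
  obtain m where m: "0 < m" "m \<le> \<nu>0"
    "\<And>V W. m * (norm (V - W))\<^sup>2 \<le> (T_op \<nu> V - T_op \<nu> W) \<bullet> (V - W)"
    "\<And>V W. norm (T_op \<nu> V - T_op \<nu> W) \<le> \<nu>0 * norm (V - W)"
    by (rule T_op_monotone_Lipschitz[OF N1]) (rule that; assumption)
  have law: "monotone_law (T_op \<nu>) \<nu>0 m" by (rule monotone_law.intro[OF m])
  interpret monotone_law "T_op \<nu>" \<nu>0 m by (rule law)
  have \<Omega>D: "\<Omega>d \<subseteq> D" using assms(11) closure_subset[of \<Omega>d] by (auto simp: compactly_in_def)
  have x0: "x0 \<in> D" using assms(12) \<Omega>D by blast
  let ?h = "cgrad H" and ?b = "ext_grad D (u 0)" and ?q = "ext_grad D p"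
  define w where "w \<epsilon> = (\<lambda>x. u \<epsilon> x - u 0 x)" for \<epsilon>
  let ?V = "\<lambda>\<epsilon>. ext_grad D (w \<epsilon>)"
  have HQ: "H \<in> Hquot" using H by (simp add: solves_H_def)
  have h: "square_integrable ?h" by (rule cgrad_Hquot(2)[OF HQ])
  have u0H: "u 0 \<in> H01 D" and pH: "p \<in> H01 D" using assms(14,17) by (auto simp: solves_unperturbed_def)
  have ueq: "solves_perturbed D \<nu> \<nu>0 (ball x0 \<epsilon>) F (u \<epsilon>)" if "0 < \<epsilon>" for \<epsilon>
    using assms(15)[OF that] scaled_ball[OF that] \<omega> by simp
  have wH: "w \<epsilon> \<in> H01 D" if "0 < \<epsilon>" for \<epsilon>
    unfolding w_def by (rule H01_diff[OF D _ u0H]) (use ueq[OF that] in \<open>simp add: solves_perturbed_def\<close>)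
  have V: "square_integrable (?V \<epsilon>)" if "0 < \<epsilon>" for \<epsilon>
    by (rule ext_grad_square_integrable[OF D H01_imp_H1[OF wH[OF that]]])
  have g0: "square_integrable ?b" by (rule ext_grad_square_integrable[OF D H01_imp_H1[OF u0H]])
  have q: "square_integrable ?q" by (rule ext_grad_square_integrable[OF D H01_imp_H1[OF pH]])
  have U_near: "\<exists>\<rho>>0. AE x in lborel. x \<in> ball x0 \<rho> \<longrightarrow> norm (U - ?b x) \<le> \<sigma>" if "0 < \<sigma>" for \<sigma>
    unfolding assms(20)
    by (rule C1_holder_gradient_near[OF D assms(10) \<Omega>D assms(12) H01_imp_H1[OF u0H] assms(18,19) that])
  have P_near: "\<exists>\<rho>>0. AE x in lborel. x \<in> ball x0 \<rho> \<longrightarrow> norm (P - ?q x) \<le> \<sigma>" if "0 < \<sigma>" for \<sigma>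
    unfolding assms(23)
    by (rule C1_holder_gradient_near[OF D assms(10) \<Omega>D assms(12) H01_imp_H1[OF pH] assms(21,22) that])
  have w_eq: "(\<integral>x. flux (ball x0 \<epsilon>) ?b (?V \<epsilon>) x \<bullet> ext_grad D \<eta> x \<partial>lborel) = 0"
    if "0 < \<epsilon>" "ball x0 \<epsilon> \<subseteq> D" "\<eta> \<in> H01 D" for \<epsilon> \<eta>
    unfolding w_def
    by (rule perturbed_difference_equation[OF law D _ emeasure_ball_finite that(2) ueq[OF that(1)] assms(14) that(3)]) simp
  have h_eq: "(\<integral>x. flux (ball 0 1) (\<lambda>x. U) ?h x \<bullet> grad \<phi> x \<partial>lborel) = 0" if "test_fun UNIV \<phi>" for \<phi>
    by (rule Hquot_orthogonal_test[OF square_integrable_flux(1)[OF h _ emeasure_ball_finite]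
          H_flux_orthogonal[OF law H] that]) simp
  have conv: "\<exists>\<epsilon>1>0. \<forall>\<epsilon>. 0 < \<epsilon> \<and> \<epsilon> < \<epsilon>1 \<longrightarrow>
    (\<integral>x. (norm (?V \<epsilon> x - ?h ((1 / \<epsilon>) *\<^sub>R (x - x0))))\<^sup>2 \<partial>lborel) \<le> \<delta> * \<epsilon>\<^sup>2" if "0 < \<delta>" for \<delta>
    by (rule corrector_convergence[OF D x0 h cgrad_orthogonal_rot_grad[OF HQ] h_eq g0 U_near wH w_eq that])
  define L where "L = (\<integral>y. (indicat_real (ball 0 1) y *\<^sub>R contrast (U + ?h y)) \<bullet> P \<partial>lborel)"
  have L: "L = U \<bullet> (pol_matrix \<nu> \<nu>0 \<omega> U R *v P) + (LINT x:\<omega>|lborel. S_op \<nu> U (?h x) \<bullet> (P + cgrad K x))"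
    unfolding L_def \<omega> by (rule polarisation_identity[OF N1 law H K assms(26,27)])
  obtain \<rho> where \<rho>: "0 < \<rho>" "ball x0 \<rho> \<subseteq> D" using D x0 openE by blast
  \<comment> \<open>The difference equation tested with \<open>p\<close>, combined with the adjoint equation tested with \<open>w \<epsilon>\<close>.\<close>
  have Gw: "G (w \<epsilon>) = (\<integral>x. (indicat_real (ball x0 \<epsilon>) x *\<^sub>R contrast (?b x + ?V \<epsilon> x)) \<bullet> ?q x \<partial>lborel)"
    if \<epsilon>: "0 < \<epsilon>" "\<epsilon> < \<rho>" for \<epsilon>
  proof -
    have ball: "ball x0 \<epsilon> \<subseteq> D" using \<rho>(2) \<epsilon>(2) by (meson less_imp_le subset_ball subset_trans)
    let ?C = "\<lambda>x. indicat_real (ball x0 \<epsilon>) x *\<^sub>R contrast (?b x + ?V \<epsilon> x)"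
    have C: "square_integrable ?C"
      using square_integrable_contrast[OF square_integrable_add[OF g0 V[OF \<epsilon>(1)]] _ emeasure_ball_finite, where U=0]
      by simp
    have sV: "square_integrable (\<lambda>x. \<nu>0 *\<^sub>R ?V \<epsilon> x)" by (intro square_integrable_scaleR V \<epsilon>)
    have "0 = (\<integral>x. flux (ball x0 \<epsilon>) ?b (?V \<epsilon>) x \<bullet> ?q x \<partial>lborel)"
      by (rule w_eq[OF \<epsilon>(1) ball pH, symmetric])
    also have "\<dots> = (\<integral>x. (\<nu>0 *\<^sub>R ?V \<epsilon> x) \<bullet> ?q x + ?C x \<bullet> ?q x \<partial>lborel)"
      unfolding flux_def inner_add_left ..
    also have "\<dots> = (\<integral>x. (\<nu>0 *\<^sub>R ?V \<epsilon> x) \<bullet> ?q x \<partial>lborel) + (\<integral>x. ?C x \<bullet> ?q x \<partial>lborel)"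
      by (intro Bochner_Integration.integral_add square_integrable_inner sV C q)
    also have "(\<integral>x. (\<nu>0 *\<^sub>R ?V \<epsilon> x) \<bullet> ?q x \<partial>lborel) = (\<integral>x. (\<nu>0 *\<^sub>R ?q x) \<bullet> ?V \<epsilon> x \<partial>lborel)"
      by (simp add: inner_commute)
    also have "\<dots> = - G (w \<epsilon>)"
      using assms(17) wH[OF \<epsilon>(1)] unfolding solves_unperturbed_def set_integral_wgrad by blast
    finally show ?thesis by simp
  qed
  have main: "(\<lambda>\<epsilon>. G (w \<epsilon>) - \<epsilon>\<^sup>2 * L) \<in> o[at_right 0](\<lambda>\<epsilon>. \<epsilon>\<^sup>2)"
  proof (rule smallo_square_at_right_0I)
    fix \<delta> :: real assume \<delta>: "0 < \<delta>"
    obtain \<epsilon>1 where \<epsilon>1: "0 < \<epsilon>1" "\<And>\<epsilon>. 0 < \<epsilon> \<Longrightarrow> \<epsilon> < \<epsilon>1 \<Longrightarrow>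
      \<bar>(\<integral>x. (indicat_real (ball x0 \<epsilon>) x *\<^sub>R contrast (?b x + ?V \<epsilon> x)) \<bullet> ?q x \<partial>lborel) - \<epsilon>\<^sup>2 * L\<bar> \<le> \<delta> * \<epsilon>\<^sup>2"
      using contrast_integral_expansion[OF h g0 q V U_near P_near conv \<delta>] unfolding L_def by blast
    show "\<exists>\<epsilon>1>0. \<forall>\<epsilon>. 0 < \<epsilon> \<and> \<epsilon> < \<epsilon>1 \<longrightarrow> \<bar>G (w \<epsilon>) - \<epsilon>\<^sup>2 * L\<bar> \<le> \<delta> * \<epsilon>\<^sup>2"
      using \<epsilon>1 \<rho>(1) Gw by (intro exI[of _ "min \<epsilon>1 \<rho>"]) simp
  qed
  from assms(16) obtain Rem \<alpha> r \<epsilon>0 where J: "0 < \<alpha>" "0 < r" "r < 1" "0 < \<epsilon>0"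
    "\<And>\<epsilon>. \<epsilon> \<in> {0..<\<epsilon>0} \<Longrightarrow> J (u \<epsilon>) = J (u 0) + G (w \<epsilon>) + \<delta>J * \<epsilon>\<^sup>2 + Rem \<epsilon>"
    "Rem \<in> O[at_right 0](\<lambda>\<epsilon>. LINT x:(D - ball x0 (\<alpha> * \<epsilon> powr r))|lborel. (norm (wgrad D (w \<epsilon>) x))\<^sup>2)"
    unfolding cond_J_def w_def by blast
  have far: "(\<lambda>\<epsilon>. LINT x:(D - ball x0 (\<alpha> * \<epsilon> powr r))|lborel. (norm (wgrad D (w \<epsilon>) x))\<^sup>2) \<in> o[at_right 0](\<lambda>\<epsilon>. \<epsilon>\<^sup>2)"
  proof (rule smallo_square_at_right_0I)
    fix \<delta> :: real assume \<delta>: "0 < \<delta>"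
    have eq: "(LINT x:(D - ball x0 \<rho>)|lborel. (norm (wgrad D (w \<epsilon>) x))\<^sup>2)
        = (\<integral>x. indicat_real (- ball x0 \<rho>) x * (norm (?V \<epsilon> x))\<^sup>2 \<partial>lborel)" for \<epsilon> \<rho>
      unfolding set_lebesgue_integral_def ext_grad_def
      by (intro Bochner_Integration.integral_cong) (auto simp: indicator_def)
    have "0 \<le> (\<integral>x. indicat_real (- ball x0 \<rho>) x * (norm (?V \<epsilon> x))\<^sup>2 \<partial>lborel)" for \<epsilon> \<rho>
      by (intro Bochner_Integration.integral_nonneg) simp
    then show "\<exists>\<epsilon>1>0. \<forall>\<epsilon>. 0 < \<epsilon> \<and> \<epsilon> < \<epsilon>1 \<longrightarrow>
        \<bar>LINT x:(D - ball x0 (\<alpha> * \<epsilon> powr r))|lborel. (norm (wgrad D (w \<epsilon>) x))\<^sup>2\<bar> \<le> \<delta> * \<epsilon>\<^sup>2"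
      unfolding eq using far_energy_small[OF h V conv J(1-3) \<delta>] by (simp only: abs_of_nonneg)
  qed
  have Rem: "Rem \<in> o[at_right 0](\<lambda>\<epsilon>. \<epsilon>\<^sup>2)" by (rule landau_o.big_small_trans[OF J(6) far])
  have sum: "(\<lambda>\<epsilon>. (G (w \<epsilon>) - \<epsilon>\<^sup>2 * L) + Rem \<epsilon>) \<in> o[at_right 0](\<lambda>\<epsilon>. \<epsilon>\<^sup>2)" by (rule sum_in_smallo(1)[OF main Rem])
  have "eventually (\<lambda>\<epsilon>. J (u \<epsilon>) - J (u 0) - \<epsilon>\<^sup>2 * (L + \<delta>J) = (G (w \<epsilon>) - \<epsilon>\<^sup>2 * L) + Rem \<epsilon>) (at_right 0)"
    unfolding eventually_at_right_field
  proof (intro exI[of _ \<epsilon>0] conjI allI impI)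
    fix \<epsilon> :: real assume "0 < \<epsilon>" "\<epsilon> < \<epsilon>0"
    then have "J (u \<epsilon>) = J (u 0) + G (w \<epsilon>) + \<delta>J * \<epsilon>\<^sup>2 + Rem \<epsilon>" by (intro J(5)) simp
    then show "J (u \<epsilon>) - J (u 0) - \<epsilon>\<^sup>2 * (L + \<delta>J) = (G (w \<epsilon>) - \<epsilon>\<^sup>2 * L) + Rem \<epsilon>"
      by (simp add: algebra_simps)
  qed (rule J(4))
  from iffD2[OF landau_o.small.in_cong[OF this] sum] show ?thesis
    unfolding L .
qed

end
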